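(* (Primary Andronov–Hopf bifurcation $H_1$.) For the normal form system $$\dot y_1=y_2,\quad \dot y_2=[\alpha_1+\phi_1]y_1+[\alpha_2+\phi_2]y_2,\quad \dot r=[\alpha_3+\phi_3]r,\quad \dot\theta=1+\phi_4,$$ the $z$-plane is a two-dimensional invariant subspace, on which the equations reduce to $$y_1=y_2=0,\qquad \dot r=[\alpha_3+\phi_3(0,r^2)]\,r,\qquad \dot\theta=1+\phi_4(0,r^2).$$ This has the family of periodic solutions $$y_1=y_2=0,\qquad r=\sqrt{\frac{-\alpha_3}{\phi_{3,01}}}+\cdots,\qquad \theta(t)=\theta_0+[1+\phi_4(0,r^2)]\,t \pmod{2\pi}.$$ This is a classical Andronov–Hopf bifurcation, giving birth to a limit cycle in the $z$-plane with period near $2\pi$ (angular frequency $1$) as the parameter $\alpha_3$ crosses through $0$, provided $\alpha_1,\alpha_2\neq0$. It is assumed that $\phi_{3,01}\neq0$ (the generic, nondegenerate case); then the limit cycle is locally unique. If $\phi_{3,01}<0$, the bifurcation is supercritical (the limit cycle exists for $\alpha_3>0$), and if $\phi_{3,01}>0$ the bifurcation is subcritical (the limit cycle exists for $\alpha_3<0$). A supercritical limit cycle is stable if $\alpha_1,\alpha_2<0$; otherwise the cycle is unstable.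
   Context: Here $y_1,y_2\in\mathbb{R}$, $z=re^{i\theta}\in\mathbb{C}$, and $\alpha_1,\alpha_2,\alpha_3$ are real unfolding parameters near $0$. The $\phi_j=\phi_j(y_1^2,r^2)$, $j=1,\dots,4$, are real-valued formal power series (which may not converge) in $y_1^2$ and $r^2=z\bar z$ with $\phi_j(0,0)=0$; $\phi_{j,kl}$ is the coefficient of $y_1^{2k}r^{2l}$ in $\phi_j(y_1^2,r^2)$. The system is a normal form near the trivial equilibrium at the origin, and the bifurcation is from this equilibrium. The dots in the formula for $r$ denote higher order terms, and $\theta_0$ is an arbitrary initial phase. *)

theory Defs
  imports "HOL-Analysis.Analysis" "HOL-Library.Landau_Symbols"
begin

section \<open>Smooth functions with a prescribed formal Taylor series\<close>

text \<open>
  A formal power series \<open>\<Sum> c k l u^k v^l\<close> need not converge, so it has no pointwise values.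
  As a term of a differential equation it stands for any \<open>C\<^sup>\<infinity>\<close> function whose Taylor series
  at the origin is the given one; polynomial truncations and convergent sums are instances.
  \<open>D k l\<close> is the mixed partial derivative of order \<open>k\<close> in \<open>u\<close> and \<open>l\<close> in \<open>v\<close>.
\<close>

definition smooth_with_taylor ::
    "(real \<times> real) set \<Rightarrow> (real \<Rightarrow> real \<Rightarrow> real) \<Rightarrow> (nat \<Rightarrow> nat \<Rightarrow> real) \<Rightarrow> bool" where
  "smooth_with_taylor U f c \<longleftrightarrow>
    (\<exists>D :: nat \<Rightarrow> nat \<Rightarrow> real \<times> real \<Rightarrow> real.
      (\<forall>(u, v)\<in>U. D 0 0 (u, v) = f u v) \<and>
      (\<forall>k l. \<forall>p\<in>U.
        (D k l has_derivative (\<lambda>(a, b). D (Suc k) l p * a + D k (Suc l) p * b)) (at p)) \<and>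
      (\<forall>k l. D k l (0, 0) = fact k * fact l * c k l))"


section \<open>Periodic orbits, limit cycles and orbital stability\<close>

text \<open>
  The system enters through its trajectories: \<open>traj T w\<close> means that the curve \<open>w\<close> is a
  solution on the time set \<open>T\<close>.
\<close>

text \<open>Requiring \<open>P\<close> to be the least period excludes equilibria.\<close>

definition periodic_solution ::
    "(real set \<Rightarrow> (real \<Rightarrow> 'a) \<Rightarrow> bool) \<Rightarrow> real \<Rightarrow> (real \<Rightarrow> 'a) \<Rightarrow> bool" where
  "periodic_solution traj P w \<longleftrightarrow>
    traj UNIV w \<and> 0 < P \<and> (\<forall>t. w (t + P) = w t) \<and>
    (\<forall>Q. 0 < Q \<and> Q < P \<longrightarrow> (\<exists>t. w (t + Q) \<noteq> w t))"

definition periodic_orbit ::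
    "(real set \<Rightarrow> (real \<Rightarrow> 'a) \<Rightarrow> bool) \<Rightarrow> 'a set \<Rightarrow> bool" where
  "periodic_orbit traj \<Gamma> \<longleftrightarrow> (\<exists>P w. periodic_solution traj P w \<and> \<Gamma> = range w)"

definition limit_cycle ::
    "(real set \<Rightarrow> (real \<Rightarrow> 'a::topological_space) \<Rightarrow> bool) \<Rightarrow> 'a set \<Rightarrow> bool" where
  "limit_cycle traj \<Gamma> \<longleftrightarrow> periodic_orbit traj \<Gamma> \<and>
    (\<exists>V. open V \<and> \<Gamma> \<subseteq> V \<and> (\<forall>\<Gamma>'. periodic_orbit traj \<Gamma>' \<and> \<Gamma>' \<subseteq> V \<longrightarrow> \<Gamma>' = \<Gamma>))"

definition invariant_set ::
    "(real set \<Rightarrow> (real \<Rightarrow> 'a) \<Rightarrow> bool) \<Rightarrow> 'a set \<Rightarrow> bool" where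
  "invariant_set traj S \<longleftrightarrow>
    (\<forall>T w t0. is_interval T \<and> traj T w \<and> t0 \<in> T \<and> w t0 \<in> S \<longrightarrow> (\<forall>t\<in>T. w t \<in> S))"

text \<open>
  Lyapunov stability of the orbit is tested on all finite pieces of trajectories, so its
  negation yields an actual trajectory that escapes.  Global forward existence is part of
  asymptotic stability.
\<close>

definition orbitally_stable ::
    "(real set \<Rightarrow> (real \<Rightarrow> 'a::metric_space) \<Rightarrow> bool) \<Rightarrow> 'a set \<Rightarrow> bool" where
  "orbitally_stable traj \<Gamma> \<longleftrightarrow>
    (\<forall>\<epsilon>>0. \<exists>\<delta>>0. \<forall>b\<ge>0. \<forall>w. traj {0..b} w \<and> infdist (w 0) \<Gamma> < \<delta> \<longrightarrow>
      (\<forall>t\<in>{0..b}. infdist (w t) \<Gamma> < \<epsilon>))"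

definition orbitally_asymptotically_stable ::
    "(real set \<Rightarrow> (real \<Rightarrow> 'a::metric_space) \<Rightarrow> bool) \<Rightarrow> 'a set \<Rightarrow> bool" where
  "orbitally_asymptotically_stable traj \<Gamma> \<longleftrightarrow> orbitally_stable traj \<Gamma> \<and>
    (\<exists>\<delta>>0. \<forall>x. infdist x \<Gamma> < \<delta> \<longrightarrow>
      (\<exists>w. traj {0..} w \<and> w 0 = x) \<and>
      (\<forall>w. traj {0..} w \<and> w 0 = x \<longrightarrow> ((\<lambda>t. infdist (w t) \<Gamma>) \<longlongrightarrow> 0) at_top))"


section \<open>Eigenvalue conditions of an Andronov--Hopf bifurcation\<close>

text \<open>\<open>u + i v\<close> is an eigenvector of the complexification of \<open>L\<close>.\<close>

definition complex_eigenvalue :: "('a::real_vector \<Rightarrow> 'a) \<Rightarrow> complex \<Rightarrow> bool" where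
  "complex_eigenvalue L \<nu> \<longleftrightarrow>
    (\<exists>u v. (u \<noteq> 0 \<or> v \<noteq> 0) \<and>
      L u = Re \<nu> *\<^sub>R u - Im \<nu> *\<^sub>R v \<and> L v = Im \<nu> *\<^sub>R u + Re \<nu> *\<^sub>R v)"

text \<open>
  For \<open>\<omega> > 0\<close> the pair \<open>\<plusminus>i\<omega>\<close> is algebraically simple iff the kernel of
  \<open>(L\<^sup>2 + \<omega>\<^sup>2)\<^sup>2\<close> has real dimension \<open>2\<close>.
\<close>

definition simple_imaginary_pair :: "('a::real_vector \<Rightarrow> 'a) \<Rightarrow> real \<Rightarrow> bool" where
  "simple_imaginary_pair L \<omega> \<longleftrightarrow>
    (let Q = (\<lambda>x. L (L x) + \<omega>\<^sup>2 *\<^sub>R x)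
     in complex_eigenvalue L (Complex 0 \<omega>) \<and> dim {x. Q (Q x) = 0} = 2)"

definition hopf_crossing :: "(real \<Rightarrow> 'a::real_normed_vector \<Rightarrow> 'a) \<Rightarrow> real \<Rightarrow> bool" where
  "hopf_crossing F \<omega> \<longleftrightarrow> 0 < \<omega> \<and>
    (\<exists>L l l'.
      (\<forall>\<^sub>F \<mu> in nhds 0. F \<mu> 0 = 0 \<and> (F \<mu> has_derivative L \<mu>) (at 0) \<and>
        complex_eigenvalue (L \<mu>) (l \<mu>)) \<and>
      l 0 = Complex 0 \<omega> \<and> (l has_vector_derivative l') (at 0) \<and> Re l' \<noteq> 0 \<and>
      simple_imaginary_pair (L 0) \<omega> \<and>
      (\<forall>\<nu>. complex_eigenvalue (L 0) \<nu> \<and> Re \<nu> = 0 \<longrightarrow> \<nu> \<in> {Complex 0 \<omega>, Complex 0 (- \<omega>)}))"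


section \<open>The normal form system\<close>

text \<open>
  \<open>\<phi> j u v\<close> is evaluated at \<open>u = y1\<^sup>2\<close>, \<open>v = r\<^sup>2\<close>, for \<open>j = 1, \<dots>, 4\<close>; solutions
  are confined to the region where \<open>(y1\<^sup>2, r\<^sup>2)\<close> lies in the common domain \<open>U\<close>.
\<close>

definition nf_solution ::
    "(real \<times> real) set \<Rightarrow> (nat \<Rightarrow> real \<Rightarrow> real \<Rightarrow> real) \<Rightarrow> real \<Rightarrow> real \<Rightarrow> real \<Rightarrow> real set \<Rightarrow>
      (real \<Rightarrow> real) \<Rightarrow> (real \<Rightarrow> real) \<Rightarrow> (real \<Rightarrow> real) \<Rightarrow> (real \<Rightarrow> real) \<Rightarrow> bool" where
  "nf_solution U \<phi> \<alpha>1 \<alpha>2 \<alpha>3 T y1 y2 r \<theta> \<longleftrightarrow>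
    (\<forall>t\<in>T. 0 \<le> r t \<and> ((y1 t)\<^sup>2, (r t)\<^sup>2) \<in> U \<and>
      (y1 has_real_derivative y2 t) (at t within T) \<and>
      (y2 has_real_derivative
        (\<alpha>1 + \<phi> 1 ((y1 t)\<^sup>2) ((r t)\<^sup>2)) * y1 t + (\<alpha>2 + \<phi> 2 ((y1 t)\<^sup>2) ((r t)\<^sup>2)) * y2 t)
        (at t within T) \<and>
      (r has_real_derivative (\<alpha>3 + \<phi> 3 ((y1 t)\<^sup>2) ((r t)\<^sup>2)) * r t) (at t within T) \<and>
      (\<theta> has_real_derivative 1 + \<phi> 4 ((y1 t)\<^sup>2) ((r t)\<^sup>2)) (at t within T))"

definition nf_point :: "real \<Rightarrow> real \<Rightarrow> real \<Rightarrow> real \<Rightarrow> real \<times> real \<times> complex" where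
  "nf_point y1 y2 r \<theta> = (y1, y2, complex_of_real r * cis \<theta>)"

definition nf_trajectory ::
    "(real \<times> real) set \<Rightarrow> (nat \<Rightarrow> real \<Rightarrow> real \<Rightarrow> real) \<Rightarrow> real \<Rightarrow> real \<Rightarrow> real \<Rightarrow> real set \<Rightarrow>
      (real \<Rightarrow> real \<times> real \<times> complex) \<Rightarrow> bool" where
  "nf_trajectory U \<phi> \<alpha>1 \<alpha>2 \<alpha>3 T w \<longleftrightarrow>
    (\<exists>y1 y2 r \<theta>. nf_solution U \<phi> \<alpha>1 \<alpha>2 \<alpha>3 T y1 y2 r \<theta> \<and>
      (\<forall>t\<in>T. w t = nf_point (y1 t) (y2 t) (r t) (\<theta> t)))"

text \<open>
  The same system in \<open>z = r e^(i\<theta>)\<close>, needed because polar coordinates degenerate at the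
  equilibrium, where the linearization is taken.
\<close>

definition nf_field ::
    "(nat \<Rightarrow> real \<Rightarrow> real \<Rightarrow> real) \<Rightarrow> real \<Rightarrow> real \<Rightarrow> real \<Rightarrow>
      real \<times> real \<times> complex \<Rightarrow> real \<times> real \<times> complex" where
  "nf_field \<phi> \<alpha>1 \<alpha>2 \<alpha>3 = (\<lambda>(y1, y2, z).
    let u = y1\<^sup>2; v = (cmod z)\<^sup>2
    in (y2, (\<alpha>1 + \<phi> 1 u v) * y1 + (\<alpha>2 + \<phi> 2 u v) * y2, Complex (\<alpha>3 + \<phi> 3 u v) (1 + \<phi> 4 u v) * z))"

lemma nf_trajectory_has_vector_derivative:
  assumes "nf_trajectory U \<phi> \<alpha>1 \<alpha>2 \<alpha>3 T w" and "t \<in> T"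
  shows "(w has_vector_derivative nf_field \<phi> \<alpha>1 \<alpha>2 \<alpha>3 (w t)) (at t within T)"
proof -
  obtain y1 y2 r \<theta> where sol: "nf_solution U \<phi> \<alpha>1 \<alpha>2 \<alpha>3 T y1 y2 r \<theta>"
    and w: "\<And>t. t \<in> T \<Longrightarrow> w t = nf_point (y1 t) (y2 t) (r t) (\<theta> t)"
    using assms(1) unfolding nf_trajectory_def by blast
  define a where "a = \<alpha>3 + \<phi> 3 ((y1 t)\<^sup>2) ((r t)\<^sup>2)"
  define b where "b = 1 + \<phi> 4 ((y1 t)\<^sup>2) ((r t)\<^sup>2)"
  define c where "c = (\<alpha>1 + \<phi> 1 ((y1 t)\<^sup>2) ((r t)\<^sup>2)) * y1 t + (\<alpha>2 + \<phi> 2 ((y1 t)\<^sup>2) ((r t)\<^sup>2)) * y2 t"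
  have d: "(y1 has_vector_derivative y2 t) (at t within T)"
    "(y2 has_vector_derivative c) (at t within T)"
    "(r has_real_derivative a * r t) (at t within T)"
    "(\<theta> has_real_derivative b) (at t within T)"
    using sol assms(2) unfolding nf_solution_def a_def b_def c_def
    by (auto simp: has_real_derivative_iff_has_vector_derivative)
  have "((\<lambda>s. complex_of_real (r s) * cis (\<theta> s)) has_vector_derivative
      Complex a b * (complex_of_real (r t) * cis (\<theta> t))) (at t within T)"
  proof -
    have re: "((\<lambda>s. r s * cos (\<theta> s)) has_real_derivative
        a * (r t * cos (\<theta> t)) - b * (r t * sin (\<theta> t))) (at t within T)"
      using d(3,4) by (auto intro!: derivative_eq_intros simp: algebra_simps)
    have im: "((\<lambda>s. r s * sin (\<theta> s)) has_real_derivative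
        a * (r t * sin (\<theta> t)) + b * (r t * cos (\<theta> t))) (at t within T)"
      using d(3,4) by (auto intro!: derivative_eq_intros simp: algebra_simps)
    show ?thesis
      unfolding has_vector_derivative_complex_iff
      using re im by (simp add: has_real_derivative_iff_has_vector_derivative)
  qed
  then have "((\<lambda>s. nf_point (y1 s) (y2 s) (r s) (\<theta> s)) has_vector_derivative
      (y2 t, c, Complex a b * (complex_of_real (r t) * cis (\<theta> t)))) (at t within T)"
    unfolding nf_point_def
    by (intro has_vector_derivative_Pair d)
  moreover have "nf_field \<phi> \<alpha>1 \<alpha>2 \<alpha>3 (w t) =
      (y2 t, c, Complex a b * (complex_of_real (r t) * cis (\<theta> t)))"
    using w[OF assms(2)]
    by (simp add: nf_field_def nf_point_def a_def b_def c_def Let_def norm_mult)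
  ultimately show ?thesis
    using w assms(2) by (metis (mono_tags, lifting) has_vector_derivative_transform)
qed

definition z_plane :: "(real \<times> real \<times> complex) set" where
  "z_plane = {(y1, y2, z). y1 = 0 \<and> y2 = 0}"

definition z_circle :: "real \<Rightarrow> (real \<times> real \<times> complex) set" where
  "z_circle \<rho> = {(y1, y2, z). y1 = 0 \<and> y2 = 0 \<and> cmod z = \<rho>}"

end

theory Submission
  imports Defs
begin

text \<open>
  Near the bifurcating circle \<open>y\<^sub>1 = y\<^sub>2 = 0, r = R\<close> everything is read off one quadratic form
  in \<open>(y\<^sub>1, y\<^sub>2, r - R)\<close> that strictly increases along trajectories.  If it is negative definite
  the cycle attracts exponentially; if it takes positive values arbitrarily near the circle, a
  trajectory starting there must leave, which requires an existence theorem for Lipschitz fields.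
  Its part in \<open>(y\<^sub>1, y\<^sub>2)\<close> is independent of \<open>\<alpha>\<^sub>3\<close> and already excludes small periodic orbits off
  the \<open>z\<close>-plane, since an increasing periodic function is constant.  Inside the \<open>z\<close>-plane the same
  remark applied to a primitive of the radial rate forces \<open>r\<close> to be constant, and \<open>R\<close> is the unique
  small root of \<open>\<alpha>\<^sub>3 + \<phi>\<^sub>3(0, R\<^sup>2) = 0\<close>.
\<close>

section \<open>Global solutions of Lipschitz fields\<close>

text \<open>The coefficients depend on \<open>y\<^sub>1\<close> and \<open>r\<close> only, so the
  phase decouples: the circle becomes an equilibrium \<open>(0, 0, R)\<close> in the variables
  \<open>(y\<^sub>1, y\<^sub>2, r)\<close>, distance to the orbit becomes Euclidean distance to that
  point, and the phase is recovered afterwards by quadrature. The obstacle is uniformity in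
  \<open>\<alpha>3\<close>. With \<open>k\<close> the coefficient \<open>c 3 0 1\<close>, the radial
  rate near the circle has size |k| R^2 and degenerates as \<open>\<alpha>3\<close> tends to 0, so
  stability is decided in a ball of radius R/2 that shrinks with the cycle. Uniqueness, however,
  must hold in one ball of radius \<open>\<delta>\<close> for all small \<open>\<alpha>3\<close>.
  Hence the form in the transversal plane is built to tolerate perturbations of
  \<open>\<alpha>1\<close>, \<open>\<alpha>2\<close> up to a fixed \<open>d\<close>;
  \<open>\<delta>\<close> is chosen from \<open>d\<close>, and only then \<open>\<epsilon>\<close>,
  small enough to bring the cycle inside. The formal series enter only through continuity, the
  values at the origin, Lipschitz bounds, a second-order expansion of \<phi>_3(0, v), and the fact
  that this function has a slope of the sign of \<open>k\<close> and of size at least |k|/2.\<close>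

lemma integral_has_vector_derivative_atLeast:
  fixes g :: "real \<Rightarrow> 'a::banach"
  assumes "continuous_on {0..} g" and "0 \<le> t"
  shows "((\<lambda>u. integral {0..u} g) has_vector_derivative g t) (at t within {0..})"
proof -
  have "((\<lambda>u. integral {0..u} g) has_vector_derivative g t) (at t within {0..t + 1})"
    using assms by (intro integral_has_vector_derivative) (auto intro: continuous_on_subset)
  moreover have "at t within {0..} = at t within {0..t + 1}"
    by (rule at_within_nhd[where S = "{..<t + 1}"]) auto
  ultimately show ?thesis by simp
qed

text \<open>The factor 1/K gained by integrating the weight is what makes the Picard operator
  contract.\<close>

lemma integral_exp_weight:
  fixes K t :: real
  assumes "0 < K" and "0 \<le> t"
  shows "((\<lambda>s. exp (K * s)) has_integral (exp (K * t) - 1) / K) {0..t}"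
proof -
  have "((\<lambda>s. exp (K * s)) has_integral (exp (K * t) / K - exp (K * 0) / K)) {0..t}"
    using assms by (intro fundamental_theorem_of_calculus)
      (auto intro!: derivative_eq_intros simp: has_real_derivative_iff_has_vector_derivative[symmetric])
  then show ?thesis by (simp add: diff_divide_distrib)
qed

text \<open>
  In the weighted norm \<open>sup\<^sub>t e\<^sup>-\<^sup>K\<^sup>t |x t|\<close> with \<open>K > L\<close> the Picard operator is a contraction on
  the whole half line, so no gluing of local solutions is necessary.
\<close>

lemma lipschitz_field_solution:
  fixes F :: "'a::euclidean_space \<Rightarrow> 'a"
  assumes lip: "L-lipschitz_on UNIV F" and bd: "bounded (range F)"
  obtains x where "x 0 = x0" "\<And>t. 0 \<le> t \<Longrightarrow> (x has_vector_derivative F (x t)) (at t within {0..})"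
proof -
  obtain M where M: "\<And>x. norm (F x) \<le> M" and "0 < M"
    using bd by (auto simp: bounded_pos)
  have L: "0 \<le> L" using lip lipschitz_on_nonneg by blast
  define K where "K = L + 1"
  have K: "0 < K" "L < K" using L by (auto simp: K_def)
  have cF: "continuous_on UNIV F" using lip by (rule lipschitz_on_continuous_on)
  \<comment> \<open>The unknown is \<open>Y t = exp (- K t) x t\<close>, so that the weighted norm
    of \<open>x\<close> is the plain supremum norm of \<open>Y\<close>; \<open>g Y\<close> is the
    field along the unweighted curve.\<close>
  define g where "g Y s = F (exp (K * s) *\<^sub>R apply_bcontfun Y s)" for Y :: "real \<Rightarrow>\<^sub>C 'a" and s
  have cg: "continuous_on S (g Y)" for S Y
    unfolding g_def by (rule continuous_on_compose2[OF cF]) (auto intro!: continuous_intros)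
  have ig: "g Y integrable_on {0..t}" for Y t
    using cg by (rule integrable_continuous_real)
  define P where "P Y t = x0 + integral {0..t} (g Y)" for Y t
  have P_der: "(P Y has_vector_derivative g Y t) (at t within {0..})" if "0 \<le> t" for Y t
    unfolding P_def
    by (auto intro!: derivative_eq_intros integral_has_vector_derivative_atLeast cg that)
  have P_cont: "continuous_on {0..} (P Y)" for Y
    using P_der by (meson atLeast_iff continuous_on_eq_continuous_within has_vector_derivative_continuous)
  \<comment> \<open>Bounded continuous functions are defined on the whole line here, hence the
    constant continuation to negative times through \<open>max 0 t\<close>.\<close>
  define Q where "Q Y t = exp (- (K * max 0 t)) *\<^sub>R P Y (max 0 t)" for Y t
  have Q_bc: "Q Y \<in> bcontfun" for Y
  proof (rule bcontfun_normI)
    show "continuous_on UNIV (Q Y)"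
      unfolding Q_def
      by (intro continuous_intros continuous_on_compose2[OF P_cont]) auto
    fix t :: real
    define \<tau> where "\<tau> = max 0 t"
    have \<tau>: "0 \<le> \<tau>" by (simp add: \<tau>_def)
    have "norm (integral {0..\<tau>} (g Y)) \<le> M * (\<tau> - 0)"
      by (rule integral_bound) (use \<tau> cg M in \<open>auto simp: g_def\<close>)
    then have "norm (P Y \<tau>) \<le> norm x0 + M * \<tau>"
      unfolding P_def by (smt (verit) norm_triangle_ineq)
    moreover have "exp (- (K * \<tau>)) * norm x0 \<le> 1 * norm x0"
      using K \<tau> by (intro mult_right_mono) auto
    \<comment> \<open>Since the field is bounded by \<open>M\<close>, the Picard iterate grows at
      most linearly, and the exponential weight dominates linear growth.\<close>
    moreover have "exp (- (K * \<tau>)) * (M * \<tau>) \<le> M / K"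
    proof -
      have "K * \<tau> \<le> exp (K * \<tau>)" using exp_ge_add_one_self[of "K * \<tau>"] by linarith
      then have "exp (- (K * \<tau>)) * (K * \<tau>) \<le> exp (- (K * \<tau>)) * exp (K * \<tau>)"
        by (intro mult_left_mono) auto
      then have "exp (- (K * \<tau>)) * (K * \<tau>) * M \<le> 1 * M"
        using \<open>0 < M\<close> by (intro mult_right_mono) (auto simp: exp_minus)
      then show ?thesis using K by (simp add: field_simps)
    qed
    ultimately have "exp (- (K * \<tau>)) * norm (P Y \<tau>) \<le> norm x0 + M / K"
      by (smt (verit) distrib_left exp_gt_zero mult_left_mono)
    then show "norm (Q Y t) \<le> norm x0 + M / K"
      by (simp add: Q_def \<tau>_def)
  qed
  define \<Phi> where "\<Phi> Y = Bcontfun (Q Y)" for Y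
  have \<Phi>: "apply_bcontfun (\<Phi> Y) = Q Y" for Y
    unfolding \<Phi>_def by (rule Bcontfun_inverse[OF Q_bc])
  have contr: "dist (\<Phi> Y) (\<Phi> Z) \<le> (L / K) * dist Y Z" for Y Z
  proof (rule dist_bound)
    fix t :: real
    define \<tau> where "\<tau> = max 0 t"
    have \<tau>: "0 \<le> \<tau>" by (simp add: \<tau>_def)
    define d where "d = dist Y Z"
    have d: "0 \<le> d" by (simp add: d_def)
    have pw: "norm (g Y s - g Z s) \<le> L * d * exp (K * s)" for s
    proof -
      have "norm (g Y s - g Z s) \<le> L * dist (exp (K * s) *\<^sub>R apply_bcontfun Y s) (exp (K * s) *\<^sub>R apply_bcontfun Z s)"
        using lipschitz_onD[OF lip, of "exp (K * s) *\<^sub>R apply_bcontfun Y s" "exp (K * s) *\<^sub>R apply_bcontfun Z s"]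
        by (simp add: g_def dist_norm)
      also have "\<dots> = L * (exp (K * s) * dist (apply_bcontfun Y s) (apply_bcontfun Z s))"
        by (simp add: dist_norm scaleR_diff_right[symmetric])
      also have "\<dots> \<le> L * (exp (K * s) * d)"
        unfolding d_def using L by (intro mult_left_mono dist_bounded) auto
      finally show ?thesis by (simp add: mult_ac)
    qed
    have hi: "((\<lambda>s. L * d * exp (K * s)) has_integral (L * d * ((exp (K * \<tau>) - 1) / K))) {0..\<tau>}"
      by (intro has_integral_mult_right integral_exp_weight K \<tau>)
    have "norm (P Y \<tau> - P Z \<tau>) = norm (integral {0..\<tau>} (\<lambda>s. g Y s - g Z s))"
      unfolding P_def by (simp add: integral_diff ig)
    also have "\<dots> \<le> integral {0..\<tau>} (\<lambda>s. L * d * exp (K * s))"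
      using hi pw by (intro integral_norm_bound_integral integrable_diff ig) auto
    also have "\<dots> = L * d * ((exp (K * \<tau>) - 1) / K)"
      using hi by (rule integral_unique)
    also have "\<dots> \<le> L * d * (exp (K * \<tau>) / K)"
      using K L d by (intro mult_left_mono divide_right_mono) auto
    finally have "norm (P Y \<tau> - P Z \<tau>) \<le> L * d * (exp (K * \<tau>) / K)" .
    then have "exp (- (K * \<tau>)) * norm (P Y \<tau> - P Z \<tau>) \<le> exp (- (K * \<tau>)) * (L * d * (exp (K * \<tau>) / K))"
      by (intro mult_left_mono) auto
    also have "\<dots> = L / K * d" by (simp add: exp_minus field_simps)
    finally show "dist (apply_bcontfun (\<Phi> Y) t) (apply_bcontfun (\<Phi> Z) t) \<le> (L / K) * dist Y Z"
      unfolding \<Phi> by (simp add: Q_def dist_norm \<tau>_def[symmetric] scaleR_diff_right[symmetric] d_def)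
  qed
  have "\<exists>!Y. \<Phi> Y = Y"
    using contr K L by (intro banach_fix_type[of "L / K"]) auto
  then obtain Y where Y: "\<Phi> Y = Y" by blast
  \<comment> \<open>Removing the weight from the fixed point equation gives back the integral
    equation of the initial value problem.\<close>
  have YQ: "exp (K * t) *\<^sub>R apply_bcontfun Y t = P Y t" if "0 \<le> t" for t
    using that \<Phi>[of Y] unfolding Y by (simp add: Q_def exp_minus)
  show thesis
  proof (rule that[of "P Y"])
    show "P Y 0 = x0" by (simp add: P_def)
    show "(P Y has_vector_derivative F (P Y t)) (at t within {0..})" if "0 \<le> t" for t
      using P_der[OF that, of Y] YQ[OF that] by (simp add: g_def)
  qed
qed

text \<open>Precomposing with the nearest-point projection onto the ball, which is 1-Lipschitz,
  extends the field to a bounded Lipschitz field on the whole space. Its global solution obeys the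
  original equation at every time at which it lies in the ball; whether it stays there is left to
  the Lyapunov arguments.\<close>

lemma lipschitz_field_solution_in_cball:
  fixes F :: "'a::euclidean_space \<Rightarrow> 'a"
  assumes lip: "L-lipschitz_on (cball p m) F" and "0 \<le> m"
  obtains x where "x 0 = x0" "continuous_on {0..} x"
    "\<And>t. 0 \<le> t \<Longrightarrow> x t \<in> cball p m \<Longrightarrow> (x has_vector_derivative F (x t)) (at t within {0..})"
proof -
  define \<pi> where "\<pi> = closest_point (cball p m)"
  have ne: "cball p m \<noteq> {}" using assms by auto
  have \<pi>_in: "\<pi> y \<in> cball p m" for y
    unfolding \<pi>_def using ne by (intro closest_point_in_set) auto
  have \<pi>_lip: "1-lipschitz_on UNIV \<pi>"
    unfolding \<pi>_def using ne
    by (intro lipschitz_onI) (auto intro!: closest_point_lipschitz)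
  have 1: "(L * 1)-lipschitz_on UNIV (\<lambda>y. F (\<pi> y))"
    by (rule lipschitz_on_compose2[OF \<pi>_lip]) (use lip \<pi>_in in \<open>auto intro: lipschitz_on_subset\<close>)
  have "bounded (F ` cball p m)"
    using lip by (intro compact_imp_bounded compact_continuous_image lipschitz_on_continuous_on) auto
  then have 2: "bounded (range (\<lambda>y. F (\<pi> y)))"
    by (rule bounded_subset) (use \<pi>_in in auto)
  obtain x where x: "x 0 = x0"
    "\<And>t. 0 \<le> t \<Longrightarrow> (x has_vector_derivative F (\<pi> (x t))) (at t within {0..})"
    using lipschitz_field_solution[OF 1 2] by metis
  show thesis
  proof (rule that[of x, OF x(1)])
    show "continuous_on {0..} x"
      using x(2) by (meson atLeast_iff continuous_on_eq_continuous_within has_vector_derivative_continuous)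
    show "(x has_vector_derivative F (x t)) (at t within {0..})" if "0 \<le> t" "x t \<in> cball p m" for t
      using x(2)[OF that(1)] that(2) by (simp add: \<pi>_def closest_point_self)
  qed
qed

section \<open>Lyapunov functions\<close>

lemma increment_ge_of_derivative_ge:
  fixes f f' :: "real \<Rightarrow> real"
  assumes "a \<le> b"
    and f: "\<And>t. t \<in> {a..b} \<Longrightarrow> (f has_real_derivative f' t) (at t within {a..b})"
    and k: "\<And>t. t \<in> {a..b} \<Longrightarrow> k \<le> f' t"
  shows "k * (b - a) \<le> f b - f a"
proof (cases "a = b")
  case False
  then have "a < b" using assms(1) by simp
  then obtain s where s: "s \<in> {a<..<b}" "f b - f a = f' s * (b - a)"
    using mvt_simple[of a b f "\<lambda>t h. f' t * h"] f
    by (auto simp: has_field_derivative_def)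
  then show ?thesis using k[of s] \<open>a < b\<close> by (auto intro!: mult_right_mono)
qed simp

lemma decreasing_of_derivative_le_0:
  fixes f f' :: "real \<Rightarrow> real"
  assumes "a \<le> b"
    and f: "\<And>t. t \<in> {a..b} \<Longrightarrow> (f has_real_derivative f' t) (at t within {a..b})"
    and "\<And>t. t \<in> {a..b} \<Longrightarrow> f' t \<le> 0"
  shows "f b \<le> f a"
proof -
  have "0 * (b - a) \<le> (- f b) - (- f a)"
    by (rule increment_ge_of_derivative_ge[OF assms(1) DERIV_minus[OF f]]) (use assms in auto)
  then show ?thesis by simp
qed

lemma first_hitting_time:
  fixes f :: "real \<Rightarrow> real"
  assumes cont: "continuous_on {0..c} f" and "0 \<le> c" "f 0 < m" "m \<le> f c"
  obtains b where "0 \<le> b" "b \<le> c" "f b = m" "\<And>t. 0 \<le> t \<Longrightarrow> t < b \<Longrightarrow> f t < m"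
proof -
  define S where "S = {t \<in> {0..c}. m \<le> f t}"
  have "closed S"
    unfolding S_def by (intro continuous_on_closed_Collect_le continuous_intros cont)
  moreover have S: "S \<noteq> {}" "bdd_below S" "c \<in> S"
    using assms by (auto simp: S_def intro!: bdd_belowI[of _ 0])
  ultimately have b: "Inf S \<in> S" by (intro closed_contains_Inf)
  define b where "b = Inf S"
  have b_in: "0 \<le> b" "b \<le> c" "m \<le> f b" using b by (auto simp: b_def S_def)
  have low: "b \<le> t" if "t \<in> S" for t
    unfolding b_def using S that by (intro cInf_lower) auto
  \<comment> \<open>The infimum only gives \<open>m \<le> f b\<close>. The intermediate value
    theorem supplies a point of equality in \<open>{0..b}\<close>, and minimality forces it to be
    \<open>b\<close>.\<close>
  have "continuous_on {0..b} f" using cont b_in by (auto intro: continuous_on_subset)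
  then obtain t where t: "0 \<le> t" "t \<le> b" "f t = m"
    using IVT'[of f 0 m b] assms b_in by auto
  then have "t = b" using low[of t] b_in by (auto simp: S_def)
  show thesis
  proof (rule that[of b])
    show "f t < m" if "0 \<le> t" "t < b" for t
      using low[of t] that b_in by (force simp: S_def)
    show "f b = m" using t(3) \<open>t = b\<close> by simp
  qed (use b_in in auto)
qed

lemma has_real_derivative_along_curve:
  assumes "(V has_derivative V') (at (x t))"
    and "(x has_vector_derivative v) (at t within S)"
  shows "((\<lambda>s. V (x s)) has_real_derivative V' v) (at t within S)"
proof -
  have "((\<lambda>s. V (x s)) has_derivative (\<lambda>h. V' (h *\<^sub>R v))) (at t within S)"
    using has_derivative_compose[OF assms(2)[unfolded has_vector_derivative_def] assms(1)] .
  moreover have "linear V'" using assms(1) has_derivative_linear by blast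
  then have "(\<lambda>h. V' (h *\<^sub>R v)) = (*) (V' v)"
    by (auto simp: linear_scale mult.commute)
  ultimately show ?thesis
    by (simp add: has_field_derivative_def)
qed

text \<open>A Chetaev argument: \<open>V\<close> may be indefinite. It cannot decrease along the
  solution, so it stays above \<open>V x0 > 0\<close>; the upper bound then keeps the solution away
  from \<open>p\<close>, hence \<open>V\<close> grows at least linearly, which is incompatible with
  its boundedness on the ball.\<close>

lemma lyapunov_escape:
  fixes F :: "'a::euclidean_space \<Rightarrow> 'a"
  assumes lip: "L-lipschitz_on (cball p m) F" and "0 < lam" "0 < M"
    and V: "\<And>x. (V has_derivative V' x) (at x)"
    and grow: "\<And>x. x \<in> cball p m \<Longrightarrow> lam * (dist x p)\<^sup>2 \<le> V' x (F x)"
    and bound: "\<And>x. x \<in> cball p m \<Longrightarrow> V x \<le> M * (dist x p)\<^sup>2"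
    and x0: "dist x0 p < m" "0 < V x0"
  obtains x b where "0 \<le> b" "x 0 = x0" "dist (x b) p = m"
    "\<And>t. t \<in> {0..b} \<Longrightarrow> x t \<in> cball p m"
    "\<And>t. t \<in> {0..b} \<Longrightarrow> (x has_vector_derivative F (x t)) (at t within {0..b})"
proof -
  have m: "0 < m" using x0 zero_le_dist[of x0 p] by linarith
  obtain x where x: "x 0 = x0" "continuous_on {0..} x"
    "\<And>t. 0 \<le> t \<Longrightarrow> x t \<in> cball p m \<Longrightarrow> (x has_vector_derivative F (x t)) (at t within {0..})"
    using lipschitz_field_solution_in_cball[OF lip, of x0] m by auto
  have "\<exists>c\<ge>0. m \<le> dist (x c) p"
  proof (rule ccontr)
    assume "\<not> (\<exists>c\<ge>0. m \<le> dist (x c) p)"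
    then have inside: "x t \<in> cball p m" if "0 \<le> t" for t
      using that by (force simp: dist_commute)
    have der: "((\<lambda>s. V (x s)) has_real_derivative V' (x t) (F (x t))) (at t within {0..b})"
      if "t \<in> {0..b}" for t b
      using that has_real_derivative_along_curve[OF V x(3)[of t]] inside
      by (auto intro: DERIV_subset)
    have mono: "V x0 \<le> V (x t)" if "0 \<le> t" for t
    proof -
      have "0 * (t - 0) \<le> V (x t) - V (x 0)"
      proof (rule increment_ge_of_derivative_ge[OF that der])
        fix s assume "s \<in> {0..t}"
        then have "lam * (dist (x s) p)\<^sup>2 \<le> V' (x s) (F (x s))" using grow inside by auto
        moreover have "0 \<le> lam * (dist (x s) p)\<^sup>2" using \<open>0 < lam\<close> by auto
        ultimately show "0 \<le> V' (x s) (F (x s))" by linarith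
      qed
      then show ?thesis by (simp add: x(1))
    qed
    \<comment> \<open>From \<open>V x0 \<le> V (x s) \<le> M * (dist (x s) p)\<^sup>2\<close> the
      squared distance is at least \<open>V x0 / M\<close>; \<open>k\<close> is the resulting lower
      bound for the growth rate.\<close>
    define k where "k = lam * (V x0 / M)"
    have k: "0 < k" using assms by (simp add: k_def)
    have lin: "k * (t - 0) \<le> V (x t) - V (x 0)" if "0 \<le> t" for t
    proof (rule increment_ge_of_derivative_ge[OF that der])
      fix s assume "s \<in> {0..t}"
      then have s: "x s \<in> cball p m" "0 \<le> s" using inside by auto
      have "V x0 \<le> M * (dist (x s) p)\<^sup>2" using mono[OF s(2)] bound[OF s(1)] by linarith
      then have "V x0 / M \<le> (dist (x s) p)\<^sup>2" using \<open>0 < M\<close> by (simp add: field_simps)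
      then have "k \<le> lam * (dist (x s) p)\<^sup>2" unfolding k_def using \<open>0 < lam\<close> by (intro mult_left_mono) auto
      then show "k \<le> V' (x s) (F (x s))" using grow[OF s(1)] by linarith
    qed
    \<comment> \<open>By this time linear growth alone has used up the largest value
      \<open>M * m\<^sup>2\<close> possible in the ball, and the positive initial value leads beyond
      it.\<close>
    define t where "t = M * m\<^sup>2 / k"
    have t: "0 \<le> t" using k \<open>0 < M\<close> by (simp add: t_def)
    have "dist (x t) p \<le> m" using inside[OF t] by (simp add: dist_commute)
    then have "(dist (x t) p)\<^sup>2 \<le> m\<^sup>2" by (intro power_mono) auto
    then have "M * (dist (x t) p)\<^sup>2 \<le> M * m\<^sup>2" using \<open>0 < M\<close> by simp
    then have "V (x t) \<le> M * m\<^sup>2" using bound[OF inside[OF t]] by linarith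
    moreover have "k * t = M * m\<^sup>2" using k by (simp add: t_def)
    ultimately show False using lin[OF t] x0 x(1) by simp
  qed
  then obtain c where c: "0 \<le> c" "m \<le> dist (x c) p" by blast
  have "continuous_on {0..c} (\<lambda>t. dist (x t) p)"
    by (intro continuous_intros continuous_on_subset[OF x(2)]) auto
  then obtain b where b: "0 \<le> b" "dist (x b) p = m" "\<And>t. 0 \<le> t \<Longrightarrow> t < b \<Longrightarrow> dist (x t) p < m"
    using first_hitting_time[of c "\<lambda>t. dist (x t) p" m] c x0 x(1) by auto
  have inside: "x t \<in> cball p m" if "t \<in> {0..b}" for t
    using b(2) b(3)[of t] that by (cases "t = b") (auto simp: dist_commute)
  show thesis
  proof (rule that[of b x])
    show "(x has_vector_derivative F (x t)) (at t within {0..b})" if "t \<in> {0..b}" for t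
      using x(3)[of t] inside[OF that] that
      by (auto intro: has_vector_derivative_within_subset)
  qed (use b x inside in auto)
qed

text \<open>The two bounds turn the decay into \<open>E' \<le> - (lam / M) * E\<close> inside the
  ball, and \<open>M * \<delta>\<^sup>2 \<le> \<mu> * \<epsilon>\<^sup>2\<close> says that the
  sublevel set entered at distance below \<open>\<delta>\<close> does not reach distance
  \<open>\<epsilon>\<close>. The equation is assumed only while the curve is in the ball, so that
  solutions of the truncated field qualify and are shown never to notice the truncation.\<close>

lemma lyapunov_decay:
  fixes F :: "'a::euclidean_space \<Rightarrow> 'a"
  assumes pos: "0 < lam" "0 < M" "0 < \<mu>"
    and E: "\<And>x. (E has_derivative E' x) (at x)"
    and decay: "\<And>x. x \<in> cball p m \<Longrightarrow> E' x (F x) \<le> - lam * (dist x p)\<^sup>2"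
    and bound: "\<And>x. x \<in> cball p m \<Longrightarrow> E x \<le> M * (dist x p)\<^sup>2"
    and lower: "\<And>x. x \<in> cball p m \<Longrightarrow> \<mu> * (dist x p)\<^sup>2 \<le> E x"
    and eps: "0 < \<epsilon>" "\<epsilon> \<le> m" "0 < \<delta>" "\<delta> \<le> \<epsilon>" "M * \<delta>\<^sup>2 \<le> \<mu> * \<epsilon>\<^sup>2"
    and "0 \<le> b" and cont: "continuous_on {0..b} x"
    and x: "\<And>t. t \<in> {0..b} \<Longrightarrow> x t \<in> cball p m \<Longrightarrow>
      (x has_vector_derivative F (x t)) (at t within {0..b})"
    and x0: "dist (x 0) p < \<delta>"
  shows "dist (x b) p < \<epsilon>" and "E (x b) \<le> exp (- (lam / M) * b) * E (x 0)"
proof -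
  define k where "k = lam / M"
  have k: "0 < k" using pos by (simp add: k_def)
  have main: "E (x c) \<le> exp (- k * c) * E (x 0)"
    if c: "0 \<le> c" "c \<le> b" and inside: "\<And>t. t \<in> {0..c} \<Longrightarrow> x t \<in> cball p m" for c
  proof -
    have der: "((\<lambda>s. exp (k * s) * E (x s)) has_real_derivative
        exp (k * t) * (k * E (x t) + E' (x t) (F (x t)))) (at t within {0..c})" if "t \<in> {0..c}" for t
    proof -
      have "(x has_vector_derivative F (x t)) (at t within {0..c})"
        using that c inside by (intro has_vector_derivative_within_subset[OF x]) auto
      from has_real_derivative_along_curve[OF E this]
      show ?thesis by (auto intro!: derivative_eq_intros simp: algebra_simps)
    qed
    have "exp (k * c) * E (x c) \<le> exp (k * 0) * E (x 0)"
    proof (rule decreasing_of_derivative_le_0[OF c(1) der])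
      fix t assume t: "t \<in> {0..c}"
      have "k * E (x t) \<le> k * (M * (dist (x t) p)\<^sup>2)"
        using bound[OF inside[OF t]] k by (intro mult_left_mono) auto
      also have "\<dots> = lam * (dist (x t) p)\<^sup>2" using pos by (simp add: k_def)
      finally have "k * E (x t) + E' (x t) (F (x t)) \<le> 0"
        using decay[OF inside[OF t]] by linarith
      then show "exp (k * t) * (k * E (x t) + E' (x t) (F (x t))) \<le> 0"
        by (simp add: mult_nonneg_nonpos)
    qed
    then show ?thesis by (simp add: exp_minus field_simps)
  qed
  \<comment> \<open>At a first time of distance \<open>\<epsilon>\<close> the curve has so far
    stayed in the ball, so the exponential estimate is available up to that time and contradicts the
    lower bound on \<open>E\<close>.\<close>
  have near: "dist (x c) p < \<epsilon>" if c: "c \<in> {0..b}" for c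
  proof (rule ccontr)
    assume "\<not> dist (x c) p < \<epsilon>"
    moreover have "continuous_on {0..c} (\<lambda>t. dist (x t) p)"
      using c by (intro continuous_intros continuous_on_subset[OF cont]) auto
    ultimately obtain s where s: "0 \<le> s" "s \<le> c" "dist (x s) p = \<epsilon>"
        "\<And>t. 0 \<le> t \<Longrightarrow> t < s \<Longrightarrow> dist (x t) p < \<epsilon>"
      using first_hitting_time[of c "\<lambda>t. dist (x t) p" \<epsilon>] c x0 eps by auto
    have inside: "x t \<in> cball p m" if "t \<in> {0..s}" for t
      using s(3) s(4)[of t] that eps by (cases "t = s") (auto simp: dist_commute)
    have "\<mu> * \<epsilon>\<^sup>2 \<le> E (x s)" using lower[OF inside[of s]] s by auto
    also have "\<dots> \<le> exp (- k * s) * E (x 0)" using main[of s] s c inside by auto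
    also have "\<dots> \<le> 1 * E (x 0)"
    proof (rule mult_right_mono)
      have "0 \<le> \<mu> * (dist (x 0) p)\<^sup>2" using pos by auto
      then show "0 \<le> E (x 0)" using lower[OF inside[of 0]] s by auto
    qed (use k s in auto)
    also have "\<dots> \<le> M * (dist (x 0) p)\<^sup>2" using bound[OF inside[of 0]] s by auto
    also have "\<dots> < M * \<delta>\<^sup>2"
      using pos x0 by (intro mult_strict_left_mono power_strict_mono) auto
    finally show False using eps by linarith
  qed
  show "dist (x b) p < \<epsilon>" using near \<open>0 \<le> b\<close> by auto
  have "x t \<in> cball p m" if "t \<in> {0..b}" for t
    using near[OF that] eps by (auto simp: dist_commute)
  then show "E (x b) \<le> exp (- (lam / M) * b) * E (x 0)"
    using main[of b] \<open>0 \<le> b\<close> by (simp add: k_def)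
qed

section \<open>Stability of circles in polar coordinates\<close>

text \<open>The phase is dropped because it occurs in no right-hand side. The remaining field is
  regular also at \<open>r = 0\<close>, and a circle of radius \<open>R\<close> corresponds to the
  single point \<open>(0, 0, R)\<close>.\<close>

definition polar_field ::
    "(nat \<Rightarrow> real \<Rightarrow> real \<Rightarrow> real) \<Rightarrow> real \<Rightarrow> real \<Rightarrow> real \<Rightarrow> real \<times> real \<times> real \<Rightarrow> real \<times> real \<times> real" where
  "polar_field \<phi> \<alpha>1 \<alpha>2 \<alpha>3 = (\<lambda>(y1, y2, r).
    (y2, (\<alpha>1 + \<phi> 1 (y1\<^sup>2) (r\<^sup>2)) * y1 + (\<alpha>2 + \<phi> 2 (y1\<^sup>2) (r\<^sup>2)) * y2, (\<alpha>3 + \<phi> 3 (y1\<^sup>2) (r\<^sup>2)) * r))"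

lemma has_vector_derivative_Pair_iff:
  "((\<lambda>t. (f t, g t)) has_vector_derivative (a, b)) (at t within S) \<longleftrightarrow>
    (f has_vector_derivative a) (at t within S) \<and> (g has_vector_derivative b) (at t within S)"
proof
  assume h: "((\<lambda>t. (f t, g t)) has_vector_derivative (a, b)) (at t within S)"
  show "(f has_vector_derivative a) (at t within S) \<and> (g has_vector_derivative b) (at t within S)"
    using bounded_linear.has_vector_derivative[OF bounded_linear_fst h]
      bounded_linear.has_vector_derivative[OF bounded_linear_snd h] by simp
qed (auto intro: has_vector_derivative_Pair)

lemma nf_solution_iff_polar_field:
  "nf_solution U \<phi> \<alpha>1 \<alpha>2 \<alpha>3 T y1 y2 r \<theta> \<longleftrightarrow>
    (\<forall>t\<in>T. 0 \<le> r t \<and> ((y1 t)\<^sup>2, (r t)\<^sup>2) \<in> U \<and>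
      ((\<lambda>t. (y1 t, y2 t, r t)) has_vector_derivative
        polar_field \<phi> \<alpha>1 \<alpha>2 \<alpha>3 (y1 t, y2 t, r t)) (at t within T) \<and>
      (\<theta> has_real_derivative 1 + \<phi> 4 ((y1 t)\<^sup>2) ((r t)\<^sup>2)) (at t within T))"
  unfolding nf_solution_def polar_field_def
  by (simp add: has_vector_derivative_Pair_iff has_real_derivative_iff_has_vector_derivative conj_ac)

text \<open>These are the two time sets that occur in the stability notions: segments for escape,
  the ray for attraction.\<close>

lemma antiderivative_on_ray_or_segment:
  fixes g :: "real \<Rightarrow> real"
  assumes T: "T = {0..} \<or> T = {0..b}" and g: "continuous_on T g"
  obtains G where "G 0 = G0" "\<And>t. t \<in> T \<Longrightarrow> (G has_real_derivative g t) (at t within T)"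
proof (rule that[of "\<lambda>t. G0 + integral {0..t} g"])
  show "((\<lambda>t. G0 + integral {0..t} g) has_real_derivative g t) (at t within T)" if "t \<in> T" for t
  proof -
    have "((\<lambda>t. integral {0..t} g) has_vector_derivative g t) (at t within T)"
      using T
    proof
      assume "T = {0..}"
      then show ?thesis using g that by (auto intro!: integral_has_vector_derivative_atLeast)
    next
      assume "T = {0..b}"
      then show ?thesis using g that by (auto intro!: integral_has_vector_derivative)
    qed
    then show ?thesis
      by (auto intro!: derivative_eq_intros simp: has_real_derivative_iff_has_vector_derivative)
  qed
qed simp

text \<open>The phase equation has a right-hand side known along the curve, so a prescribed initial
  phase is continued by integration.\<close>

lemma nf_trajectory_of_polar_curve:
  assumes \<phi>4: "continuous_on U (\<lambda>p. \<phi> 4 (fst p) (snd p))"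
    and T: "T = {0..} \<or> T = {0..b}"
    and x: "\<And>t. t \<in> T \<Longrightarrow> (x has_vector_derivative polar_field \<phi> \<alpha>1 \<alpha>2 \<alpha>3 (x t)) (at t within T)"
    and dom: "\<And>t. t \<in> T \<Longrightarrow> 0 \<le> snd (snd (x t)) \<and> ((fst (x t))\<^sup>2, (snd (snd (x t)))\<^sup>2) \<in> U"
  obtains w \<theta> where "nf_trajectory U \<phi> \<alpha>1 \<alpha>2 \<alpha>3 T w" "\<theta> 0 = \<theta>0"
    "\<And>t. w t = nf_point (fst (x t)) (fst (snd (x t))) (snd (snd (x t))) (\<theta> t)"
proof -
  have cx: "continuous_on T x"
    using x by (meson continuous_on_eq_continuous_within has_vector_derivative_continuous)
  have cc: "continuous_on T (\<lambda>t. \<phi> 4 ((fst (x t))\<^sup>2) ((snd (snd (x t)))\<^sup>2))"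
  proof -
    have "continuous_on T (\<lambda>t. ((fst (x t))\<^sup>2, (snd (snd (x t)))\<^sup>2))"
      by (intro continuous_on_Pair continuous_on_power continuous_on_fst continuous_on_snd cx)
    from continuous_on_compose2[OF \<phi>4 this] dom show ?thesis by auto
  qed
  have "continuous_on T (\<lambda>t. 1 + \<phi> 4 ((fst (x t))\<^sup>2) ((snd (snd (x t)))\<^sup>2))"
    by (intro continuous_intros cc)
  then obtain \<theta> where \<theta>: "\<theta> 0 = \<theta>0" "\<And>t. t \<in> T \<Longrightarrow> (\<theta> has_real_derivative
      1 + \<phi> 4 ((fst (x t))\<^sup>2) ((snd (snd (x t)))\<^sup>2)) (at t within T)"
    using antiderivative_on_ray_or_segment[OF T, where ?G0.0 = \<theta>0] by blast
  have "nf_solution U \<phi> \<alpha>1 \<alpha>2 \<alpha>3 T (\<lambda>t. fst (x t)) (\<lambda>t. fst (snd (x t))) (\<lambda>t. snd (snd (x t))) \<theta>"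
    unfolding nf_solution_iff_polar_field using x dom \<theta> by simp
  then show thesis
    
    by (intro that[where \<theta> = \<theta> and
          w = "\<lambda>t. nf_point (fst (x t)) (fst (snd (x t))) (snd (snd (x t))) (\<theta> t)"])
      (auto simp: nf_trajectory_def \<theta>(1))
qed

text \<open>The point of the circle with the same argument realizes the distance; the reverse
  triangle inequality for the modulus shows that no other point is closer. This reduces orbital
  stability to stability of a point.\<close>

lemma infdist_z_circle:
  assumes "0 \<le> r" "0 \<le> R"
  shows "infdist (nf_point y1 y2 r \<theta>) (z_circle R) = dist (y1, y2, r) (0, 0, R)"
proof (rule antisym)
  have "(0, 0, complex_of_real R * cis \<theta>) \<in> z_circle R"
    using assms by (simp add: z_circle_def norm_mult)
  then have "infdist (nf_point y1 y2 r \<theta>) (z_circle R)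
      \<le> dist (nf_point y1 y2 r \<theta>) (0, 0, complex_of_real R * cis \<theta>)"
    by (rule infdist_le)
  also have "dist (complex_of_real r * cis \<theta>) (complex_of_real R * cis \<theta>) = dist r R"
    by (simp add: dist_norm left_diff_distrib[symmetric] norm_mult flip: of_real_diff)
  then have "dist (nf_point y1 y2 r \<theta>) (0, 0, complex_of_real R * cis \<theta>) = dist (y1, y2, r) (0, 0, R)"
    by (simp add: nf_point_def dist_Pair_Pair)
  finally show "infdist (nf_point y1 y2 r \<theta>) (z_circle R) \<le> dist (y1, y2, r) (0, 0, R)" .
  have ne: "z_circle R \<noteq> {}" using \<open>(0, 0, complex_of_real R * cis \<theta>) \<in> z_circle R\<close> by auto
  have "dist (y1, y2, r) (0, 0, R) \<le> dist (nf_point y1 y2 r \<theta>) q" if "q \<in> z_circle R" for q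
  proof -
    have q: "q = (0, 0, snd (snd q))" "cmod (snd (snd q)) = R"
      using that by (auto simp: z_circle_def)
    define z where "z = snd (snd q)"
    note q = q[folded z_def]
    have "\<bar>cmod (complex_of_real r * cis \<theta>) - cmod z\<bar> \<le> cmod (complex_of_real r * cis \<theta> - z)"
      by (rule norm_triangle_ineq3)
    then have "dist r R \<le> dist (complex_of_real r * cis \<theta>) z"
      using q assms by (simp add: dist_norm norm_mult)
    then show ?thesis
      by (subst q(1)) (simp add: nf_point_def dist_Pair_Pair)
  qed
  then show "dist (y1, y2, r) (0, 0, R) \<le> infdist (nf_point y1 y2 r \<theta>) (z_circle R)"
    unfolding infdist_notempty[OF ne] by (intro cINF_greatest ne)
qed

text \<open>Stability fails for the tolerance \<open>m\<close> itself: from arbitrarily close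
  starting points with \<open>V > 0\<close>, the escape lemma gives a solution on a finite segment
  that reaches distance exactly \<open>m\<close>.\<close>

lemma nf_not_orbitally_stable:
  assumes \<phi>4: "continuous_on U (\<lambda>p. \<phi> 4 (fst p) (snd p))"
    and dom: "\<And>(y1::real) (y2::real) (r::real). (y1, y2, r) \<in> cball (0, 0, R) m \<Longrightarrow> 0 \<le> r \<and> (y1\<^sup>2, r\<^sup>2) \<in> U"
    and lip: "L-lipschitz_on (cball (0, 0, R) m) (polar_field \<phi> \<alpha>1 \<alpha>2 \<alpha>3)"
    and pos: "0 < lam" "0 < M" "0 < m" "0 \<le> R"
    and V: "\<And>x. (V has_derivative V' x) (at x)"
    and grow: "\<And>x. x \<in> cball (0, 0, R) m \<Longrightarrow>
      lam * (dist x (0, 0, R))\<^sup>2 \<le> V' x (polar_field \<phi> \<alpha>1 \<alpha>2 \<alpha>3 x)"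
    and bound: "\<And>x. x \<in> cball (0, 0, R) m \<Longrightarrow> V x \<le> M * (dist x (0, 0, R))\<^sup>2"
    and near: "\<And>\<delta>. 0 < \<delta> \<Longrightarrow> \<exists>x. dist x (0, 0, R) < \<delta> \<and> 0 < V x"
  shows "\<not> orbitally_stable (nf_trajectory U \<phi> \<alpha>1 \<alpha>2 \<alpha>3) (z_circle R)"
proof
  assume "orbitally_stable (nf_trajectory U \<phi> \<alpha>1 \<alpha>2 \<alpha>3) (z_circle R)"
  then obtain \<delta> where \<delta>: "0 < \<delta>" and st: "\<And>b w t. \<lbrakk>0 \<le> b; nf_trajectory U \<phi> \<alpha>1 \<alpha>2 \<alpha>3 {0..b} w;
      infdist (w 0) (z_circle R) < \<delta>; t \<in> {0..b}\<rbrakk> \<Longrightarrow> infdist (w t) (z_circle R) < m"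
    unfolding orbitally_stable_def using pos by meson
  obtain x0 where x0: "dist x0 (0, 0, R) < min \<delta> m" "0 < V x0"
    using near[of "min \<delta> m"] \<delta> pos by auto
  have "dist x0 (0, 0, R) < m" using x0(1) by simp
  obtain x b where x: "0 \<le> b" "x 0 = x0" "dist (x b) (0, 0, R) = m"
    "\<And>t. t \<in> {0..b} \<Longrightarrow> x t \<in> cball (0, 0, R) m"
    "\<And>t. t \<in> {0..b} \<Longrightarrow> (x has_vector_derivative polar_field \<phi> \<alpha>1 \<alpha>2 \<alpha>3 (x t)) (at t within {0..b})"
    by (rule lyapunov_escape[OF lip pos(1,2) V grow bound \<open>dist x0 (0, 0, R) < m\<close> x0(2)]) blast+
  have in_dom: "0 \<le> snd (snd (x t)) \<and> ((fst (x t))\<^sup>2, (snd (snd (x t)))\<^sup>2) \<in> U"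
    if "t \<in> {0..b}" for t
    using dom[of "fst (x t)" "fst (snd (x t))" "snd (snd (x t))"] x(4)[OF that] by simp
  obtain w \<theta> where w: "nf_trajectory U \<phi> \<alpha>1 \<alpha>2 \<alpha>3 {0..b} w"
    "\<And>t. w t = nf_point (fst (x t)) (fst (snd (x t))) (snd (snd (x t))) (\<theta> t)"
    using nf_trajectory_of_polar_curve[OF \<phi>4 _ x(5) in_dom] by blast
  have inf: "infdist (w t) (z_circle R) = dist (x t) (0, 0, R)" if "t \<in> {0..b}" for t
    unfolding w(2) using infdist_z_circle in_dom[OF that] pos by simp
  have "infdist (w b) (z_circle R) < m"
    using x x0 inf[of 0] by (intro st[OF x(1) w(1)]) auto
  then show False using inf[of b] x by simp
qed

lemma nf_orbitally_asymptotically_stable: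
  assumes \<phi>4: "continuous_on U (\<lambda>p. \<phi> 4 (fst p) (snd p))"
    and dom: "\<And>(y1::real) (y2::real) (r::real). (y1, y2, r) \<in> cball (0, 0, R) m \<Longrightarrow> 0 \<le> r \<and> (y1\<^sup>2, r\<^sup>2) \<in> U"
    and lip: "L-lipschitz_on (cball (0, 0, R) m) (polar_field \<phi> \<alpha>1 \<alpha>2 \<alpha>3)"
    and pos: "0 < lam" "0 < M" "0 < \<mu>" "0 < m" "0 \<le> R"
    and E: "\<And>x. (E has_derivative E' x) (at x)"
    and decay: "\<And>x. x \<in> cball (0, 0, R) m \<Longrightarrow>
      E' x (polar_field \<phi> \<alpha>1 \<alpha>2 \<alpha>3 x) \<le> - lam * (dist x (0, 0, R))\<^sup>2"
    and bound: "\<And>x. x \<in> cball (0, 0, R) m \<Longrightarrow> E x \<le> M * (dist x (0, 0, R))\<^sup>2"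
    and lower: "\<And>x. x \<in> cball (0, 0, R) m \<Longrightarrow> \<mu> * (dist x (0, 0, R))\<^sup>2 \<le> E x"
  shows "orbitally_asymptotically_stable (nf_trajectory U \<phi> \<alpha>1 \<alpha>2 \<alpha>3) (z_circle R)"
proof -
  let ?tr = "nf_trajectory U \<phi> \<alpha>1 \<alpha>2 \<alpha>3" and ?\<Gamma> = "z_circle R"
  let ?F = "polar_field \<phi> \<alpha>1 \<alpha>2 \<alpha>3"
  \<comment> \<open>The largest radius not exceeding \<open>\<epsilon>\<close> with \<open>M *
    (\<delta> \<epsilon>)\<^sup>2 \<le> \<mu> * \<epsilon>\<^sup>2\<close>.\<close>
  define \<delta> where "\<delta> \<epsilon> = \<epsilon> * min 1 (sqrt (\<mu> / M))" for \<epsilon> :: real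
  have \<delta>: "0 < \<delta> \<epsilon>" "\<delta> \<epsilon> \<le> \<epsilon>" "M * (\<delta> \<epsilon>)\<^sup>2 \<le> \<mu> * \<epsilon>\<^sup>2" if "0 < \<epsilon>" for \<epsilon>
  proof -
    show "0 < \<delta> \<epsilon>" using that pos by (simp add: \<delta>_def)
    show "\<delta> \<epsilon> \<le> \<epsilon>" using that by (simp add: \<delta>_def mult_le_cancel_left2)
    have "\<delta> \<epsilon> \<le> \<epsilon> * sqrt (\<mu> / M)" using that by (simp add: \<delta>_def)
    then have "(\<delta> \<epsilon>)\<^sup>2 \<le> (\<epsilon> * sqrt (\<mu> / M))\<^sup>2"
      using \<open>0 < \<delta> \<epsilon>\<close> by (intro power_mono) auto
    also have "\<dots> = \<epsilon>\<^sup>2 * (\<mu> / M)" using pos by (simp add: power_mult_distrib)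
    finally have "M * (\<delta> \<epsilon>)\<^sup>2 \<le> M * (\<epsilon>\<^sup>2 * (\<mu> / M))" using pos by (intro mult_left_mono) auto
    then show "M * (\<delta> \<epsilon>)\<^sup>2 \<le> \<mu> * \<epsilon>\<^sup>2" using pos by (simp add: mult.commute)
  qed
  have decay': "dist (x b) (0, 0, R) < \<epsilon>" "E (x b) \<le> exp (- (lam / M) * b) * E (x 0)"
    if "0 < \<epsilon>" "\<epsilon> \<le> m" "0 \<le> b" "continuous_on {0..b} x"
      "\<And>t. t \<in> {0..b} \<Longrightarrow> x t \<in> cball (0, 0, R) m \<Longrightarrow>
        (x has_vector_derivative ?F (x t)) (at t within {0..b})"
      "dist (x 0) (0, 0, R) < \<delta> \<epsilon>" for \<epsilon> b x
    by (rule lyapunov_decay[where m = m, OF pos(1-3) E decay bound lower that(1,2) \<delta>[OF that(1)] that(3-5)],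
        (assumption | rule that(6))+)+
  \<comment> \<open>Stated for an arbitrary given trajectory, since both stability and attraction
    quantify over all of them; the trajectory built below serves only the existence clause.\<close>
  have traj: "infdist (w b) ?\<Gamma> < \<epsilon> \<and>
      \<mu> * (infdist (w b) ?\<Gamma>)\<^sup>2 \<le> exp (- (lam / M) * b) * (M * (infdist (w 0) ?\<Gamma>)\<^sup>2)"
    if tr: "?tr T w" and T: "{0..b} \<subseteq> T" "0 \<le> b" and eps: "0 < \<epsilon>" "\<epsilon> \<le> m"
      and w0: "infdist (w 0) ?\<Gamma> < \<delta> \<epsilon>" for T w b \<epsilon>
  proof -
    obtain y1 y2 r \<theta> where sol: "nf_solution U \<phi> \<alpha>1 \<alpha>2 \<alpha>3 T y1 y2 r \<theta>"
      and w: "\<And>t. t \<in> T \<Longrightarrow> w t = nf_point (y1 t) (y2 t) (r t) (\<theta> t)"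
      using tr unfolding nf_trajectory_def by blast
    define x where "x t = (y1 t, y2 t, r t)" for t
    have x: "(x has_vector_derivative ?F (x t)) (at t within {0..b})" if "t \<in> {0..b}" for t
      using sol T that unfolding nf_solution_iff_polar_field x_def
      by (blast intro: has_vector_derivative_within_subset)
    have cont: "continuous_on {0..b} x"
      using x by (meson continuous_on_eq_continuous_within has_vector_derivative_continuous)
    have inf: "infdist (w t) ?\<Gamma> = dist (x t) (0, 0, R)" if "t \<in> {0..b}" for t
      using that T w sol infdist_z_circle pos unfolding x_def nf_solution_def by auto
    have x0: "dist (x 0) (0, 0, R) < \<delta> \<epsilon>" using w0 inf[of 0] T by auto
    have d: "dist (x b) (0, 0, R) < \<epsilon>" "E (x b) \<le> exp (- (lam / M) * b) * E (x 0)"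
      using decay'[OF eps T(2) cont x x0] by blast+
    have "\<mu> * (dist (x b) (0, 0, R))\<^sup>2 \<le> E (x b)"
      using lower d eps by (auto simp: dist_commute)
    also note d(2)
    also have "E (x 0) \<le> M * (dist (x 0) (0, 0, R))\<^sup>2"
      using bound x0 \<delta>[OF eps(1)] eps by (auto simp: dist_commute)
    finally show ?thesis
      using inf[of b] inf[of 0] d(1) T by auto
  qed
  have "orbitally_stable ?tr ?\<Gamma>"
    unfolding orbitally_stable_def
  proof (intro allI impI)
    fix \<epsilon> :: real assume "0 < \<epsilon>"
    define e where "e = min \<epsilon> m"
    have e: "0 < e" "e \<le> m" "e \<le> \<epsilon>" using \<open>0 < \<epsilon>\<close> pos by (auto simp: e_def)
    have "infdist (w t) ?\<Gamma> < \<epsilon>"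
      if "?tr {0..b} w" "infdist (w 0) ?\<Gamma> < \<delta> e" "t \<in> {0..b}" for b w t
      using traj[OF that(1), of t e] that e by auto
    then show "\<exists>\<delta>>0. \<forall>b\<ge>0. \<forall>w. ?tr {0..b} w \<and> infdist (w 0) ?\<Gamma> < \<delta> \<longrightarrow>
        (\<forall>t\<in>{0..b}. infdist (w t) ?\<Gamma> < \<epsilon>)"
      using \<delta>(1)[OF e(1)] by blast
  qed
  moreover have "(\<exists>w. ?tr {0..} w \<and> w 0 = q) \<and>
      (\<forall>w. ?tr {0..} w \<and> w 0 = q \<longrightarrow> ((\<lambda>t. infdist (w t) ?\<Gamma>) \<longlongrightarrow> 0) at_top)"
    if q: "infdist q ?\<Gamma> < \<delta> m" for q
  proof
    obtain y1 y2 z where "q = (y1, y2, z)" by (cases q) auto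
    then have q': "q = nf_point y1 y2 (cmod z) (Arg z)"
      by (simp add: nf_point_def rcis_cmod_Arg flip: rcis_def)
    obtain x where x: "x 0 = (y1, y2, cmod z)" "continuous_on {0..} x"
      "\<And>t. 0 \<le> t \<Longrightarrow> x t \<in> cball (0, 0, R) m \<Longrightarrow> (x has_vector_derivative ?F (x t)) (at t within {0..})"
      using lipschitz_field_solution_in_cball[OF lip, of "(y1, y2, cmod z)"] pos by auto
    have x0: "dist (x 0) (0, 0, R) < \<delta> m"
      using q pos unfolding q' x(1) by (subst (asm) infdist_z_circle) auto
    \<comment> \<open>The decay estimate confines the truncated solution to the ball, so it solves
      the true equation for all forward times.\<close>
    have inside: "x t \<in> cball (0, 0, R) m" if t: "0 \<le> t" for t
    proof -
      have "dist (x t) (0, 0, R) < m"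
        using t pos by (intro decay'(1)[where x = x and \<epsilon> = m] x0)
          (auto intro: continuous_on_subset[OF x(2)] has_vector_derivative_within_subset[OF x(3)])
      then show ?thesis by (simp add: dist_commute)
    qed
    have in_dom: "0 \<le> snd (snd (x t)) \<and> ((fst (x t))\<^sup>2, (snd (snd (x t)))\<^sup>2) \<in> U"
      if "t \<in> {0..}" for t
      using dom[of "fst (x t)" "fst (snd (x t))" "snd (snd (x t))"] inside[of t] that by simp
    obtain w \<theta> where w: "?tr {0..} w" "\<theta> 0 = Arg z"
      "\<And>t. w t = nf_point (fst (x t)) (fst (snd (x t))) (snd (snd (x t))) (\<theta> t)"
      by (rule nf_trajectory_of_polar_curve[where U = U and \<phi> = \<phi> and x = x and T = "{0..}" and ?\<theta>0.0 = "Arg z", OF \<phi>4])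
        (use x(3) inside in_dom in auto)
    then have "w 0 = q" by (simp add: q' x(1))
    then show "\<exists>w. ?tr {0..} w \<and> w 0 = q" using w by blast
    show "\<forall>w. ?tr {0..} w \<and> w 0 = q \<longrightarrow> ((\<lambda>t. infdist (w t) ?\<Gamma>) \<longlongrightarrow> 0) at_top"
    proof (intro allI impI)
      fix w assume w: "?tr {0..} w \<and> w 0 = q"
      define C where "C = M * (infdist q ?\<Gamma>)\<^sup>2 / \<mu>"
      have le: "(infdist (w t) ?\<Gamma>)\<^sup>2 \<le> exp (- (lam / M) * t) * C" if "0 \<le> t" for t
        using traj[of "{0..}" w t m] w q that pos by (simp add: C_def field_simps)
      have "((\<lambda>t. exp (- (lam / M) * t) * C) \<longlongrightarrow> 0 * C) at_top"
      proof (intro tendsto_mult tendsto_const)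
        have "filterlim (\<lambda>t. - (lam / M) * t) at_bot at_top"
          using pos filterlim_tendsto_neg_mult_at_bot[OF tendsto_const, of "- (lam / M)" "\<lambda>t. t" at_top]
          by (simp add: filterlim_ident)
        then show "((\<lambda>t. exp (- (lam / M) * t)) \<longlongrightarrow> 0) at_top"
          by (rule filterlim_compose[OF exp_at_bot])
      qed
      then have lim: "((\<lambda>t. exp (- (lam / M) * t) * C) \<longlongrightarrow> 0) at_top" by simp
      have "((\<lambda>t. (infdist (w t) ?\<Gamma>)\<^sup>2) \<longlongrightarrow> 0) at_top"
      proof (rule tendsto_sandwich[OF _ _ tendsto_const lim])
        show "\<forall>\<^sub>F t in at_top. (infdist (w t) ?\<Gamma>)\<^sup>2 \<le> exp (- (lam / M) * t) * C"
          by (rule eventually_mono[OF eventually_ge_at_top[of 0]]) (rule le)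
      qed simp
      from tendsto_real_sqrt[OF this] show "((\<lambda>t. infdist (w t) ?\<Gamma>) \<longlongrightarrow> 0) at_top"
        by (simp add: infdist_nonneg)
    qed
  qed
  ultimately show ?thesis
    unfolding orbitally_asymptotically_stable_def using \<delta>(1)[OF pos(4)] by blast
qed

section \<open>Strict Lyapunov forms and Taylor estimates\<close>

lemma abs_cross_term_le:
  fixes P Q m x y :: real
  assumes "0 \<le> P" "0 \<le> Q" "m\<^sup>2 \<le> P * Q"
  shows "\<bar>m * (x * y)\<bar> \<le> (Q * x\<^sup>2 + P * y\<^sup>2) / 2"
proof -
  have "(2 * (m * (x * y)))\<^sup>2 = 4 * m\<^sup>2 * (x\<^sup>2 * y\<^sup>2)" by (simp add: power_mult_distrib)
  also have "\<dots> \<le> 4 * (P * Q) * (x\<^sup>2 * y\<^sup>2)"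
    using assms by (intro mult_right_mono mult_left_mono) auto
  \<comment> \<open>The difference of the two sides is the square of
    \<open>Q * x\<^sup>2 - P * y\<^sup>2\<close>.\<close>
  also have "\<dots> \<le> (Q * x\<^sup>2 + P * y\<^sup>2)\<^sup>2"
    using zero_le_power2[of "Q * x\<^sup>2 - P * y\<^sup>2"] by (simp add: power2_eq_square algebra_simps)
  finally have "\<bar>2 * (m * (x * y))\<bar> \<le> \<bar>Q * x\<^sup>2 + P * y\<^sup>2\<bar>"
    by (simp add: abs_le_square_iff)
  then show ?thesis using assms by (simp add: abs_mult)
qed

text \<open>
  With \<open>\<sigma> = sgn a2\<close>, \<open>\<tau> = sgn a1\<close> and small \<open>\<kappa> > 0\<close>, the form
  \<open>\<sigma> (y\<^sup>2 - a1 x\<^sup>2) / 2 + \<kappa> \<tau> x y\<close> strictly increases along \<open>x' = y, y' = a1 x + a2 y\<close>, whatever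
  the signs of \<open>a1\<close> and \<open>a2\<close>: node, focus and saddle need no separate treatment.
\<close>

definition robustly_increasing_form ::
    "real \<Rightarrow> real \<Rightarrow> real \<Rightarrow> real \<Rightarrow> real \<Rightarrow> real \<Rightarrow> real \<Rightarrow> bool" where
  "robustly_increasing_form a1 a2 d \<eta> A B C \<longleftrightarrow> (\<forall>p q x y. \<bar>p\<bar> \<le> d \<longrightarrow> \<bar>q\<bar> \<le> d \<longrightarrow>
    \<eta> * (x\<^sup>2 + y\<^sup>2) \<le> (2 * A * x + B * y) * y + (B * x + 2 * C * y) * ((a1 + p) * x + (a2 + q) * y))"

lemma robustly_increasing_form_exists:
  fixes a1 a2 :: real
  assumes "a1 \<noteq> 0" "a2 \<noteq> 0"
  obtains A B C \<eta> d :: real where "0 < \<eta>" "0 < d"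
    "robustly_increasing_form a1 a2 d \<eta> A B C"
    "\<And>x y. a1 < 0 \<Longrightarrow> a2 < 0 \<Longrightarrow> \<eta> * (x\<^sup>2 + y\<^sup>2) \<le> - (A * x\<^sup>2 + B * (x * y) + C * y\<^sup>2)"
    "\<not> (a1 < 0 \<and> a2 < 0) \<Longrightarrow> \<exists>x y. 0 < A * x\<^sup>2 + B * (x * y) + C * y\<^sup>2"
proof -
  define \<sigma> where "\<sigma> = sgn a2"
  define \<tau> where "\<tau> = sgn a1"
  \<comment> \<open>This is the small weight of the mixed term. The first bound keeps the
    coefficient of \<open>y\<^sup>2\<close> in the derivative above \<open>P\<close>, the second
    makes the cross coefficient \<open>c2\<close> satisfy
    \<open>c2\<^sup>2 \<le> P * Q\<close>.\<close>
  define k where "k = min (\<bar>a2\<bar> / 4) (\<bar>a1\<bar> / (9 * \<bar>a2\<bar>))"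
  \<comment> \<open>The tolerated perturbation: |a1|/2 keeps the \<open>x\<^sup>2\<close>
    coefficient above \<open>Q\<close>, |a2|/4 keeps the \<open>y\<^sup>2\<close> coefficient above
    \<open>P\<close>, and k |a2|/4 keeps the cross coefficient below (5/4 + 1/4) k |a2|.\<close>
  define d where "d = min (\<bar>a1\<bar> / 2) (min (\<bar>a2\<bar> / 4) (k * \<bar>a2\<bar> / 4))"
  define P where "P = \<bar>a2\<bar> / 2"
  define Q where "Q = k * \<bar>a1\<bar> / 2"
  \<comment> \<open>The halves of \<open>P\<close> and \<open>Q\<close> are what remains of the
    derivative after its cross term is absorbed; 1/4 and |a1|/4 remain of the form itself in the
    stable case.\<close>
  define \<eta> where "\<eta> = min (min P Q / 2) (min (1 / 4) (\<bar>a1\<bar> / 4))"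
  have sg: "\<bar>\<sigma>\<bar> = 1" "\<bar>\<tau>\<bar> = 1" "\<sigma> * a2 = \<bar>a2\<bar>" "\<tau> * a1 = \<bar>a1\<bar>"
    using assms by (auto simp: \<sigma>_def \<tau>_def sgn_if)
  have k: "0 < k" "k \<le> \<bar>a2\<bar> / 4" "k * (9 * \<bar>a2\<bar>) \<le> \<bar>a1\<bar>"
    using assms by (auto simp: k_def min_def field_simps)
  have d: "0 < d" "d \<le> \<bar>a1\<bar> / 2" "d \<le> \<bar>a2\<bar> / 4" "d \<le> k * \<bar>a2\<bar> / 4"
    using assms k by (auto simp: d_def)
  have PQ: "0 < P" "0 < Q" using assms k by (auto simp: P_def Q_def)
  have \<eta>: "0 < \<eta>" "\<eta> \<le> P / 2" "\<eta> \<le> Q / 2" "\<eta> \<le> 1 / 4" "\<eta> \<le> \<bar>a1\<bar> / 4"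
    using PQ assms by (auto simp: \<eta>_def)
  have grow: "\<eta> * (x\<^sup>2 + y\<^sup>2) \<le> (2 * (- \<sigma> * a1 / 2) * x + (k * \<tau>) * y) * y
      + ((k * \<tau>) * x + 2 * (\<sigma> / 2) * y) * ((a1 + p) * x + (a2 + q) * y)"
    if p: "\<bar>p\<bar> \<le> d" and q: "\<bar>q\<bar> \<le> d" for p q x y
  proof -
    define c1 where "c1 = k * (\<bar>a1\<bar> + \<tau> * p)"
    define c2 where "c2 = k * (\<tau> * (a2 + q)) + \<sigma> * p"
    define c3 where "c3 = k * \<tau> + \<bar>a2\<bar> + \<sigma> * q"
    have a: "\<bar>\<tau> * p\<bar> \<le> d" "\<bar>\<sigma> * q\<bar> \<le> d" "\<bar>\<sigma> * p\<bar> \<le> d" "\<bar>k * \<tau>\<bar> = k" "\<bar>\<tau> * (a2 + q)\<bar> = \<bar>a2 + q\<bar>"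
      using p q sg k by (auto simp: abs_mult)
    have "(2 * (- \<sigma> * a1 / 2) * x + (k * \<tau>) * y) * y
      + ((k * \<tau>) * x + 2 * (\<sigma> / 2) * y) * ((a1 + p) * x + (a2 + q) * y)
      = k * (\<tau> * a1 + \<tau> * p) * x\<^sup>2 + c2 * (x * y) + (k * \<tau> + \<sigma> * a2 + \<sigma> * q) * y\<^sup>2"
      by (simp add: c2_def power2_eq_square algebra_simps)
    then have eq: "(2 * (- \<sigma> * a1 / 2) * x + (k * \<tau>) * y) * y
      + ((k * \<tau>) * x + 2 * (\<sigma> / 2) * y) * ((a1 + p) * x + (a2 + q) * y)
      = c1 * x\<^sup>2 + c2 * (x * y) + c3 * y\<^sup>2"
      by (simp add: c1_def c3_def sg)
    have "\<bar>a1\<bar> / 2 \<le> \<bar>a1\<bar> + \<tau> * p" using a d by linarith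
    then have "k * (\<bar>a1\<bar> / 2) \<le> c1" unfolding c1_def using k by (intro mult_left_mono) auto
    then have c1: "Q \<le> c1" by (simp add: Q_def)
    have c3: "P \<le> c3" unfolding c3_def P_def using a d k by linarith
    have "\<bar>k * (\<tau> * (a2 + q))\<bar> = k * \<bar>a2 + q\<bar>" using k a by (simp add: abs_mult)
    also have "\<dots> \<le> k * (5 / 4 * \<bar>a2\<bar>)" using k q d abs_triangle_ineq[of a2 q] by (intro mult_left_mono) linarith+
    finally have "\<bar>c2\<bar> \<le> 3 / 2 * (k * \<bar>a2\<bar>)" unfolding c2_def using a d by linarith
    then have "\<bar>c2\<bar>\<^sup>2 \<le> (3 / 2 * (k * \<bar>a2\<bar>))\<^sup>2" by (intro power_mono) auto
    also have "\<dots> = (k * \<bar>a2\<bar> / 4) * (k * (9 * \<bar>a2\<bar>))" by (simp add: power2_eq_square)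
    also have "\<dots> \<le> (k * \<bar>a2\<bar> / 4) * \<bar>a1\<bar>" using k by (intro mult_left_mono) auto
    also have "\<dots> = P * Q" by (simp add: P_def Q_def)
    finally have "c2\<^sup>2 \<le> P * Q" by simp
    then have cr: "\<bar>c2 * (x * y)\<bar> \<le> (Q * x\<^sup>2 + P * y\<^sup>2) / 2"
      using PQ by (intro abs_cross_term_le) auto
    have "Q * x\<^sup>2 \<le> c1 * x\<^sup>2" "P * y\<^sup>2 \<le> c3 * y\<^sup>2" "\<eta> * x\<^sup>2 \<le> Q / 2 * x\<^sup>2" "\<eta> * y\<^sup>2 \<le> P / 2 * y\<^sup>2"
      using c1 c3 \<eta> by (intro mult_right_mono; simp)+
    then show ?thesis unfolding eq using cr by (auto simp: distrib_left)
  qed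
  have stab: "\<eta> * (x\<^sup>2 + y\<^sup>2) \<le> - ((- \<sigma> * a1 / 2) * x\<^sup>2 + (k * \<tau>) * (x * y) + (\<sigma> / 2) * y\<^sup>2)"
    if "a1 < 0" "a2 < 0" for x y
  proof -
    have s: "\<sigma> = -1" "\<tau> = -1" using that by (auto simp: \<sigma>_def \<tau>_def)
    \<comment> \<open>For two negative coefficients the negated form is
      \<open>(\<bar>a1\<bar> * x\<^sup>2 + y\<^sup>2) / 2 + k * (x * y)\<close>; the smallness of
      \<open>k\<close> lets the cross term cost at most half of each square.\<close>
    have "k * k \<le> k * (\<bar>a2\<bar> / 4)" using k by (intro mult_left_mono) auto
    then have "k\<^sup>2 \<le> \<bar>a1\<bar> / 4" using k unfolding power2_eq_square by linarith
    then have "\<bar>k * (x * y)\<bar> \<le> (\<bar>a1\<bar> / 2 * x\<^sup>2 + 1 / 2 * y\<^sup>2) / 2"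
      by (intro abs_cross_term_le) auto
    moreover have "\<eta> * x\<^sup>2 \<le> \<bar>a1\<bar> / 4 * x\<^sup>2" "\<eta> * y\<^sup>2 \<le> 1 / 4 * y\<^sup>2"
      using \<eta> by (intro mult_right_mono; simp)+
    ultimately show ?thesis unfolding s using that by (auto simp: distrib_left)
  qed
  \<comment> \<open>If \<open>a2 > 0\<close>, the \<open>y\<close>-axis is a positive direction;
    otherwise \<open>a1 > 0\<close> with \<open>a2 < 0\<close>, and the \<open>x\<close>-axis is
    one.\<close>
  have unst: "\<exists>x y. 0 < (- \<sigma> * a1 / 2) * x\<^sup>2 + (k * \<tau>) * (x * y) + (\<sigma> / 2) * y\<^sup>2"
    if "\<not> (a1 < 0 \<and> a2 < 0)"
  proof (cases "0 < a2")
    case True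
    then show ?thesis by (intro exI[of _ 0] exI[of _ 1]) (simp add: \<sigma>_def)
  next
    case False
    then have "0 < a1" "\<sigma> = -1" using that assms by (auto simp: \<sigma>_def)
    then show ?thesis by (intro exI[of _ 1] exI[of _ 0]) simp
  qed
  have "robustly_increasing_form a1 a2 d \<eta> (- \<sigma> * a1 / 2) (k * \<tau>) (\<sigma> / 2)"
    unfolding robustly_increasing_form_def using grow by blast
  from that[OF \<eta>(1) d(1) this stab unst] show thesis .
qed

section \<open>Lipschitz and Taylor estimates for smooth functions near the origin\<close>

lemma lipschitz_on_of_continuous_partials:
  fixes g G1 G2 :: "real \<times> real \<Rightarrow> real"
  assumes S: "compact S" "convex S"
    and der: "\<And>p. p \<in> S \<Longrightarrow> (g has_derivative (\<lambda>(a, b). G1 p * a + G2 p * b)) (at p)"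
    and cont: "continuous_on S G1" "continuous_on S G2"
  obtains K where "K-lipschitz_on S g"
proof -
  have "bounded (G1 ` S)" "bounded (G2 ` S)"
    using S cont by (auto intro!: compact_imp_bounded compact_continuous_image)
  then obtain B1 B2 where B: "0 < B1" "0 < B2" "\<And>p. p \<in> S \<Longrightarrow> \<bar>G1 p\<bar> \<le> B1" "\<And>p. p \<in> S \<Longrightarrow> \<bar>G2 p\<bar> \<le> B2"
    unfolding bounded_pos by (metis image_eqI real_norm_def)
  have "(B1 + B2)-lipschitz_on S g"
  proof (rule lipschitz_onI)
    fix p q assume pq: "p \<in> S" "q \<in> S"
    have "norm (g p - g q) \<le> (B1 + B2) * norm (p - q)"
    proof (rule differentiable_bound[OF S(2) _ _ pq])
      fix r assume r: "r \<in> S"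
      show "(g has_derivative (\<lambda>(a, b). G1 r * a + G2 r * b)) (at r within S)"
        by (rule has_derivative_at_withinI[OF der[OF r]])
      have "norm (case h of (a, b) \<Rightarrow> G1 r * a + G2 r * b) \<le> (B1 + B2) * norm h" for h
      proof -
        obtain a b where h: "h = (a, b)" by (cases h)
        have "\<bar>G1 r * a\<bar> \<le> B1 * norm h" "\<bar>G2 r * b\<bar> \<le> B2 * norm h"
          using B(1,2) B(3,4)[OF r] norm_fst_le[of a b] norm_snd_le[of b a] unfolding h abs_mult
          by (auto intro!: mult_mono)
        then show ?thesis by (simp add: h distrib_right)
      qed
      then show "onorm (\<lambda>(a, b). G1 r * a + G2 r * b) \<le> B1 + B2"
        by (intro onorm_le)
    qed
    then show "dist (g p) (g q) \<le> (B1 + B2) * dist p q" by (simp add: dist_norm)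
  qed (use B in auto)
  then show thesis by (rule that)
qed

definition square :: "real \<Rightarrow> (real \<times> real) set" where
  "square m = cbox (- m, - m) (m, m)"

lemma mem_square_iff: "(u, v) \<in> square m \<longleftrightarrow> \<bar>u\<bar> \<le> m \<and> \<bar>v\<bar> \<le> m"
  by (auto simp: square_def cbox_Pair_iff abs_le_iff)

lemma smooth_with_taylor_continuous_on:
  assumes "smooth_with_taylor U f c"
  shows "continuous_on U (\<lambda>p. f (fst p) (snd p))"
proof -
  obtain D where D: "\<And>u v. (u, v) \<in> U \<Longrightarrow> D 0 0 (u, v) = f u v"
    "\<And>k l p. p \<in> U \<Longrightarrow> (D k l has_derivative (\<lambda>(a, b). D (Suc k) l p * a + D k (Suc l) p * b)) (at p)"
    using assms unfolding smooth_with_taylor_def by blast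
  have "continuous_on U (D 0 0)"
    using D(2) by (meson continuous_at_imp_continuous_on has_derivative_continuous)
  moreover have "D 0 0 p = f (fst p) (snd p)" if "p \<in> U" for p
    using D(1)[of "fst p" "snd p"] that by simp
  ultimately show ?thesis by (simp cong: continuous_on_cong)
qed

text \<open>On a compact square the function and its partial derivative in \<open>v\<close> are
  Lipschitz, which yields all the estimates. In the last one the derivative of \<open>f 0 v\<close>
  differs from \<open>c 0 1\<close> by at most half of it; multiplying by \<open>c 0 1\<close> gives
  a lower bound on the slope that is the same for both signs of the coefficient.\<close>

lemma smooth_with_taylor_on_square:
  assumes f: "smooth_with_taylor U f c" and sub: "square m \<subseteq> U" and "0 < m"
  obtains K where "0 < K"
    "\<And>u v u' v'. (u, v) \<in> square m \<Longrightarrow> (u', v') \<in> square m \<Longrightarrow>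
      \<bar>f u v - f u' v'\<bar> \<le> K * (\<bar>u - u'\<bar> + \<bar>v - v'\<bar>)"
    "f 0 0 = c 0 0"
    "\<And>v. \<bar>v\<bar> \<le> m \<Longrightarrow> \<bar>f 0 v - c 0 0 - c 0 1 * v\<bar> \<le> K * v\<^sup>2"
    "\<And>v v'. \<bar>v\<bar> \<le> m \<Longrightarrow> \<bar>v'\<bar> \<le> m \<Longrightarrow> K * \<bar>v\<bar> \<le> \<bar>c 0 1\<bar> / 2 \<Longrightarrow> K * \<bar>v'\<bar> \<le> \<bar>c 0 1\<bar> / 2 \<Longrightarrow>
      (c 0 1)\<^sup>2 / 2 * (v - v')\<^sup>2 \<le> c 0 1 * (f 0 v - f 0 v') * (v - v')"
proof -
  obtain D where D: "\<And>u v. (u, v) \<in> U \<Longrightarrow> D 0 0 (u, v) = f u v"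
    "\<And>k l p. p \<in> U \<Longrightarrow> (D k l has_derivative (\<lambda>(a, b). D (Suc k) l p * a + D k (Suc l) p * b)) (at p)"
    "\<And>k l. D k l (0, 0) = fact k * fact l * c k l"
    using f unfolding smooth_with_taylor_def by blast
  have S: "compact (square m)" "convex (square m)" by (auto simp: square_def)
  have cont: "continuous_on (square m) (D k l)" for k l
    using D(2) sub by (meson continuous_at_imp_continuous_on has_derivative_continuous subset_iff)
  have lip: "\<exists>K. K-lipschitz_on (square m) (D k l)" for k l
    using lipschitz_on_of_continuous_partials[OF S D(2) cont cont] sub by blast
  obtain K0 K1 where K0: "K0-lipschitz_on (square m) (D 0 0)" and K1: "K1-lipschitz_on (square m) (D 0 1)"
    using lip by blast
  define K where "K = K0 + K1 + 1"
  have Kp: "0 \<le> K0" "0 \<le> K1" using K0 K1 lipschitz_on_nonneg by blast+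
  then have K: "0 < K" "K0 \<le> K" "K1 \<le> K" by (auto simp: K_def)
  have f_eq: "f u v = D 0 0 (u, v)" if "(u, v) \<in> square m" for u v
    using that sub D(1) by auto
  have lipD: "\<bar>g (u, v) - g (u', v')\<bar> \<le> K * (\<bar>u - u'\<bar> + \<bar>v - v'\<bar>)"
    if "(u, v) \<in> square m" "(u', v') \<in> square m" "L-lipschitz_on (square m) g" "L \<le> K"
    for u v u' v' L and g :: "real \<times> real \<Rightarrow> real"
  proof -
    have "\<bar>g (u, v) - g (u', v')\<bar> \<le> L * dist (u, v) (u', v')"
      using lipschitz_onD[OF that(3,1,2)] by (simp add: dist_real_def)
    also have "\<dots> \<le> K * dist (u, v) (u', v')" using that by (intro mult_right_mono) auto
    also have "dist (u, v) (u', v') \<le> \<bar>u - u'\<bar> + \<bar>v - v'\<bar>"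
      using sqrt_sum_squares_le_sum_abs[of "u - u'" "v - v'"] by (simp add: dist_Pair_Pair dist_real_def)
    finally show ?thesis using K by (simp add: mult_left_mono)
  qed
  have near: "\<bar>D 0 1 (0, v) - c 0 1\<bar> \<le> K * \<bar>v\<bar>" if "\<bar>v\<bar> \<le> m" for v
    using lipD[OF _ _ K1 K(3), of 0 v 0 0] that \<open>0 < m\<close> D(3)[of 0 1] by (auto simp: mem_square_iff)
  have der: "((\<lambda>v. D 0 0 (0, v)) has_real_derivative D 0 1 (0, v)) (at v within X)" if "\<bar>v\<bar> \<le> m" for v X
  proof -
    have "(0, v) \<in> U" using sub that \<open>0 < m\<close> by (auto simp: mem_square_iff)
    from D(2)[OF this, of 0 0]
    have "((\<lambda>v. D 0 0 (0, v)) has_derivative (\<lambda>h. case (0, h) of (a, b) \<Rightarrow> D (Suc 0) 0 (0, v) * a + D 0 (Suc 0) (0, v) * b)) (at v within X)"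
      by (rule has_derivative_compose[rotated]) (auto intro!: derivative_eq_intros)
    then show ?thesis by (simp add: has_field_derivative_def mult_commute_abs)
  qed
  \<comment> \<open>The mean value theorem for unordered endpoints; the bound on the intermediate
    point is kept because closeness of the derivative to \<open>c 0 1\<close> is controlled by
    \<open>K * \<bar>w\<bar>\<close>.\<close>
  have mvt: "\<exists>w. \<bar>w\<bar> \<le> max \<bar>v\<bar> \<bar>v'\<bar> \<and> f 0 v - f 0 v' = D 0 1 (0, w) * (v - v')"
    if v: "\<bar>v\<bar> \<le> m" "\<bar>v'\<bar> \<le> m" for v v'
  proof -
    have *: "\<exists>w. \<bar>w\<bar> \<le> max \<bar>a\<bar> \<bar>b\<bar> \<and> f 0 b - f 0 a = D 0 1 (0, w) * (b - a)"
      if "a < b" "\<bar>a\<bar> \<le> m" "\<bar>b\<bar> \<le> m" for a b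
    proof -
      have "\<exists>w>a. w < b \<and> D 0 0 (0, b) - D 0 0 (0, a) = (b - a) * D 0 1 (0, w)"
      proof (rule MVT2[OF \<open>a < b\<close>])
        fix x assume "a \<le> x" "x \<le> b"
        then have "\<bar>x\<bar> \<le> m" using that by linarith
        then show "((\<lambda>v. D 0 0 (0, v)) has_real_derivative D 0 1 (0, x)) (at x)" by (rule der)
      qed
      then obtain w where "a < w" "w < b" "D 0 0 (0, b) - D 0 0 (0, a) = (b - a) * D 0 1 (0, w)"
        by blast
      then show ?thesis
        using that \<open>0 < m\<close> f_eq[of 0 a] f_eq[of 0 b] by (intro exI[of _ w]) (auto simp: mem_square_iff)
    qed
    consider "v < v'" | "v = v'" | "v' < v" by linarith
    then show ?thesis
    proof cases
      case 1
      then obtain w where "\<bar>w\<bar> \<le> max \<bar>v\<bar> \<bar>v'\<bar>" "f 0 v' - f 0 v = D 0 1 (0, w) * (v' - v)"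
        using *[of v v'] v by auto
      then show ?thesis by (intro exI[of _ w]) (auto simp: algebra_simps)
    next
      case 2
      then show ?thesis by (intro exI[of _ v]) auto
    next
      case 3
      then show ?thesis using *[of v' v] v by (auto simp: max.commute)
    qed
  qed
  show thesis
  proof (rule that[OF K(1)])
    show "\<bar>f u v - f u' v'\<bar> \<le> K * (\<bar>u - u'\<bar> + \<bar>v - v'\<bar>)"
      if "(u, v) \<in> square m" "(u', v') \<in> square m" for u v u' v'
      using lipD[OF that K0 K(2)] f_eq that by simp
    show f0: "f 0 0 = c 0 0" using f_eq[of 0 0] D(3)[of 0 0] \<open>0 < m\<close> by (simp add: mem_square_iff)
    show "\<bar>f 0 v - c 0 0 - c 0 1 * v\<bar> \<le> K * v\<^sup>2" if v: "\<bar>v\<bar> \<le> m" for v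
    proof -
      obtain w where w: "\<bar>w\<bar> \<le> \<bar>v\<bar>" "f 0 v - f 0 0 = D 0 1 (0, w) * v"
        using mvt[of v 0] v \<open>0 < m\<close> by auto
      have "\<bar>f 0 v - c 0 0 - c 0 1 * v\<bar> = \<bar>D 0 1 (0, w) - c 0 1\<bar> * \<bar>v\<bar>"
        using w f0 by (simp add: abs_mult[symmetric] left_diff_distrib)
      also have "\<dots> \<le> (K * \<bar>v\<bar>) * \<bar>v\<bar>"
        using near[of w] w v K by (intro mult_right_mono) (auto intro: order_trans mult_left_mono)
      finally show ?thesis by (simp add: power2_eq_square mult.assoc)
    qed
    show "(c 0 1)\<^sup>2 / 2 * (v - v')\<^sup>2 \<le> c 0 1 * (f 0 v - f 0 v') * (v - v')"
      if v: "\<bar>v\<bar> \<le> m" "\<bar>v'\<bar> \<le> m" "K * \<bar>v\<bar> \<le> \<bar>c 0 1\<bar> / 2" "K * \<bar>v'\<bar> \<le> \<bar>c 0 1\<bar> / 2" for v v'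
    proof -
      obtain w where w: "\<bar>w\<bar> \<le> max \<bar>v\<bar> \<bar>v'\<bar>" "f 0 v - f 0 v' = D 0 1 (0, w) * (v - v')"
        using mvt[of v v'] v by auto
      have "K * \<bar>w\<bar> \<le> K * max \<bar>v\<bar> \<bar>v'\<bar>" using w K by (intro mult_left_mono) auto
      then have "\<bar>D 0 1 (0, w) - c 0 1\<bar> \<le> \<bar>c 0 1\<bar> / 2"
        using near[of w] w v by (auto simp: max_def split: if_splits)
      then have "\<bar>c 0 1 * (D 0 1 (0, w) - c 0 1)\<bar> \<le> \<bar>c 0 1\<bar> * (\<bar>c 0 1\<bar> / 2)"
        unfolding abs_mult by (intro mult_left_mono) auto
      from abs_le_D2[OF this] have "(c 0 1)\<^sup>2 / 2 \<le> c 0 1 * D 0 1 (0, w)"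
        by (simp add: power2_eq_square right_diff_distrib)
      then have "(c 0 1)\<^sup>2 / 2 * (v - v')\<^sup>2 \<le> c 0 1 * D 0 1 (0, w) * (v - v')\<^sup>2"
        by (intro mult_right_mono) auto
      then show ?thesis unfolding w(2) by (simp add: power2_eq_square mult_ac)
    qed
  qed
qed

section \<open>The quadratic form of the limit cycle\<close>

lemma lipschitz_on_mult_compact:
  fixes f g :: "'a::metric_space \<Rightarrow> real"
  assumes S: "compact S" and f: "L-lipschitz_on S f" and g: "M-lipschitz_on S g"
  shows "\<exists>N. N-lipschitz_on S (\<lambda>x. f x * g x)"
proof -
  have LM: "0 \<le> L" "0 \<le> M" using f g lipschitz_on_nonneg by blast+
  have "bounded (f ` S)" "bounded (g ` S)"
    using S f g by (auto intro!: compact_imp_bounded compact_continuous_image lipschitz_on_continuous_on)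
  then obtain A B where AB: "0 < A" "0 < B" "\<And>x. x \<in> S \<Longrightarrow> \<bar>f x\<bar> \<le> A" "\<And>x. x \<in> S \<Longrightarrow> \<bar>g x\<bar> \<le> B"
    unfolding bounded_pos by (metis image_eqI real_norm_def)
  have "(A * M + L * B)-lipschitz_on S (\<lambda>x. f x * g x)"
  proof (rule lipschitz_onI)
    fix x y assume xy: "x \<in> S" "y \<in> S"
    have "f x * g x - f y * g y = f x * (g x - g y) + (f x - f y) * g y" by (simp add: algebra_simps)
    then have "\<bar>f x * g x - f y * g y\<bar> \<le> \<bar>f x\<bar> * \<bar>g x - g y\<bar> + \<bar>f x - f y\<bar> * \<bar>g y\<bar>"
      by (metis abs_mult abs_triangle_ineq)
    also have "\<dots> \<le> A * (M * dist x y) + (L * dist x y) * B"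
      using AB xy LM lipschitz_onD[OF f xy] lipschitz_onD[OF g xy]
      by (intro add_mono mult_mono) (auto simp: dist_real_def)
    finally show "dist (f x * g x) (f y * g y) \<le> (A * M + L * B) * dist x y"
      by (simp add: dist_real_def algebra_simps)
  qed (use AB LM in auto)
  then show ?thesis ..
qed

text \<open>\<open>k\<close> stands for the coefficient of \<open>v\<close> in \<phi>_3. The
  unfolding parameters are deliberately no locale parameters: \<open>m\<close> and \<open>K\<close>
  must serve all of them at once. The monotonicity assumption is multiplied by \<open>k\<close> so
  that supercritical and subcritical cases share every estimate.\<close>

locale hopf_normal_form =
  fixes U :: "(real \<times> real) set" and \<phi> :: "nat \<Rightarrow> real \<Rightarrow> real \<Rightarrow> real" and k m K :: real
  assumes m_pos: "0 < m" and K_pos: "0 < K" and k_nonzero: "k \<noteq> 0"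
    and square_subset: "square m \<subseteq> U"
    and \<phi>_continuous: "\<And>j. j \<in> {1..4} \<Longrightarrow> continuous_on U (\<lambda>p. \<phi> j (fst p) (snd p))"
    and \<phi>_zero: "\<And>j. j \<in> {1..4} \<Longrightarrow> \<phi> j 0 0 = 0"
    and \<phi>_lipschitz: "\<And>j u v u' v'. j \<in> {1..4} \<Longrightarrow> (u, v) \<in> square m \<Longrightarrow> (u', v') \<in> square m \<Longrightarrow>
      \<bar>\<phi> j u v - \<phi> j u' v'\<bar> \<le> K * (\<bar>u - u'\<bar> + \<bar>v - v'\<bar>)"
    and \<phi>3_expansion: "\<And>v. \<bar>v\<bar> \<le> m \<Longrightarrow> \<bar>\<phi> 3 0 v - k * v\<bar> \<le> K * v\<^sup>2"
    and \<phi>3_monotone: "\<And>v v'. \<bar>v\<bar> \<le> m \<Longrightarrow> \<bar>v'\<bar> \<le> m \<Longrightarrow>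
      k\<^sup>2 / 2 * (v - v')\<^sup>2 \<le> k * (\<phi> 3 0 v - \<phi> 3 0 v') * (v - v')"
begin

lemma in_domain: "\<bar>u\<bar> \<le> m \<Longrightarrow> \<bar>v\<bar> \<le> m \<Longrightarrow> (u, v) \<in> U"
  using square_subset by (auto simp: mem_square_iff)

lemma \<phi>_small:
  assumes "j \<in> {1..4}" "\<bar>u\<bar> \<le> m" "\<bar>v\<bar> \<le> m"
  shows "\<bar>\<phi> j u v\<bar> \<le> K * (\<bar>u\<bar> + \<bar>v\<bar>)"
  using \<phi>_lipschitz[OF assms(1), of u v 0 0] \<phi>_zero[OF assms(1)] assms m_pos
  by (simp add: mem_square_iff)

lemma lipschitz_on_polar_field:
  assumes S: "compact S"
    and sub: "\<And>x. x \<in> S \<Longrightarrow> (fst x)\<^sup>2 \<le> m \<and> (snd (snd x))\<^sup>2 \<le> m"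
  shows "\<exists>L. L-lipschitz_on S (polar_field \<phi> \<alpha>1 \<alpha>2 \<alpha>3)"
proof -
  let ?lip = "\<lambda>f :: real \<times> real \<times> real \<Rightarrow> real. \<exists>L. L-lipschitz_on S f"
  have 1: "?lip fst" by (intro exI[of _ 1] lipschitz_onI) (auto simp: dist_fst_le)
  have 2: "?lip (\<lambda>x. fst (snd x))"
    by (intro exI[of _ 1] lipschitz_onI) (auto intro: order_trans[OF dist_fst_le dist_snd_le])
  have 3: "?lip (\<lambda>x. snd (snd x))"
    by (intro exI[of _ 1] lipschitz_onI) (auto intro: order_trans[OF dist_snd_le dist_snd_le])
  have mult: "?lip (\<lambda>x. f x * g x)" if "?lip f" "?lip g" for f g
    using that lipschitz_on_mult_compact[OF S] by blast
  have add: "?lip (\<lambda>x. f x + g x)" if "?lip f" "?lip g" for f g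
    using that lipschitz_on_add by blast
  have const: "?lip (\<lambda>x. a)" for a using lipschitz_on_constant by blast
  have \<phi>: "?lip (\<lambda>x. \<phi> j ((fst x)\<^sup>2) ((snd (snd x))\<^sup>2))" if j: "j \<in> {1..4}" for j
  proof -
    obtain L M where L: "L-lipschitz_on S (\<lambda>x. (fst x)\<^sup>2)" and M: "M-lipschitz_on S (\<lambda>x. (snd (snd x))\<^sup>2)"
      using mult[OF 1 1] mult[OF 3 3] by (auto simp: power2_eq_square)
    have LM: "0 \<le> L" "0 \<le> M" using L M lipschitz_on_nonneg by blast+
    have "(K * (L + M))-lipschitz_on S (\<lambda>x. \<phi> j ((fst x)\<^sup>2) ((snd (snd x))\<^sup>2))"
    proof (rule lipschitz_onI)
      fix x y assume xy: "x \<in> S" "y \<in> S"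
      have "\<bar>\<phi> j ((fst x)\<^sup>2) ((snd (snd x))\<^sup>2) - \<phi> j ((fst y)\<^sup>2) ((snd (snd y))\<^sup>2)\<bar>
          \<le> K * (\<bar>(fst x)\<^sup>2 - (fst y)\<^sup>2\<bar> + \<bar>(snd (snd x))\<^sup>2 - (snd (snd y))\<^sup>2\<bar>)"
        using sub xy by (intro \<phi>_lipschitz j) (auto simp: mem_square_iff)
      also have "\<dots> \<le> K * (L * dist x y + M * dist x y)"
        using lipschitz_onD[OF L xy] lipschitz_onD[OF M xy] K_pos
        by (intro mult_left_mono add_mono) (auto simp: dist_real_def)
      finally show "dist (\<phi> j ((fst x)\<^sup>2) ((snd (snd x))\<^sup>2)) (\<phi> j ((fst y)\<^sup>2) ((snd (snd y))\<^sup>2))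
          \<le> K * (L + M) * dist x y"
        by (simp add: dist_real_def algebra_simps)
    qed (use K_pos LM in auto)
    then show ?thesis ..
  qed
  obtain L1 L2 L3 where "L1-lipschitz_on S (\<lambda>x. fst (snd x))"
    "L2-lipschitz_on S (\<lambda>x. (\<alpha>1 + \<phi> 1 ((fst x)\<^sup>2) ((snd (snd x))\<^sup>2)) * fst x
      + (\<alpha>2 + \<phi> 2 ((fst x)\<^sup>2) ((snd (snd x))\<^sup>2)) * fst (snd x))"
    "L3-lipschitz_on S (\<lambda>x. (\<alpha>3 + \<phi> 3 ((fst x)\<^sup>2) ((snd (snd x))\<^sup>2)) * snd (snd x))"
  proof -
    have "?lip (\<lambda>x. (\<alpha>1 + \<phi> 1 ((fst x)\<^sup>2) ((snd (snd x))\<^sup>2)) * fst x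
        + (\<alpha>2 + \<phi> 2 ((fst x)\<^sup>2) ((snd (snd x))\<^sup>2)) * fst (snd x))"
      by (intro add mult const \<phi> 1 2) auto
    moreover have "?lip (\<lambda>x. (\<alpha>3 + \<phi> 3 ((fst x)\<^sup>2) ((snd (snd x))\<^sup>2)) * snd (snd x))"
      by (intro add mult const \<phi> 3) auto
    ultimately show thesis using 2 that by blast
  qed
  from lipschitz_on_Pair[OF this(1) lipschitz_on_Pair[OF this(2,3)]]
  show ?thesis unfolding polar_field_def case_prod_beta' by blast
qed

end

text \<open>
  The radial direction contributes \<open>sgn k (r - R)\<^sup>2 / 2\<close> and the transversal plane a multiple \<open>a\<close>
  of the strict Lyapunov form, large enough to absorb the coupling \<open>\<phi>\<^sub>3(y\<^sub>1\<^sup>2, r\<^sup>2) - \<phi>\<^sub>3(0, r\<^sup>2)\<close>,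
  which is quadratic in \<open>y\<^sub>1\<close>.
\<close>

definition cycle_form :: "real \<Rightarrow> real \<Rightarrow> real \<Rightarrow> real \<Rightarrow> real \<Rightarrow> real \<Rightarrow> real \<times> real \<times> real \<Rightarrow> real" where
  "cycle_form \<sigma> a A B C R = (\<lambda>(y1, y2, r).
    \<sigma> / 2 * (r - R)\<^sup>2 + a * (A * y1\<^sup>2 + B * (y1 * y2) + C * y2\<^sup>2))"

definition cycle_form_deriv ::
    "real \<Rightarrow> real \<Rightarrow> real \<Rightarrow> real \<Rightarrow> real \<Rightarrow> real \<Rightarrow> real \<times> real \<times> real \<Rightarrow> real \<times> real \<times> real \<Rightarrow> real" where
  "cycle_form_deriv \<sigma> a A B C R = (\<lambda>(y1, y2, r) (h1, h2, h3).
    \<sigma> * (r - R) * h3 + a * ((2 * A * y1 + B * y2) * h1 + (B * y1 + 2 * C * y2) * h2))"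

lemma has_derivative_cycle_form:
  "(cycle_form \<sigma> a A B C R has_derivative cycle_form_deriv \<sigma> a A B C R x) (at x)"
proof -
  have "((\<lambda>x. \<sigma> / 2 * (snd (snd x) - R)\<^sup>2 + a * (A * (fst x)\<^sup>2 + B * (fst x * fst (snd x)) + C * (fst (snd x))\<^sup>2))
      has_derivative cycle_form_deriv \<sigma> a A B C R x) (at x)"
    unfolding cycle_form_deriv_def case_prod_beta
    by (auto intro!: derivative_eq_intros simp: algebra_simps power2_eq_square)
  then show ?thesis by (simp only: cycle_form_def case_prod_beta')
qed

lemma dist_circle_point_squared:
  "(dist (y1, y2, r) (0, 0, R))\<^sup>2 = y1\<^sup>2 + y2\<^sup>2 + (r - R)\<^sup>2" for y1 y2 r R :: real
  by (simp add: dist_Pair_Pair dist_real_def)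

lemma cycle_form_le:
  assumes "\<bar>\<sigma>\<bar> \<le> 1" "0 \<le> a"
  shows "\<bar>cycle_form \<sigma> a A B C R x\<bar> \<le> (1 + a * (\<bar>A\<bar> + \<bar>B\<bar> + \<bar>C\<bar>)) * (dist x (0, 0, R))\<^sup>2"
proof -
  obtain y1 y2 r where x: "x = (y1, y2, r)" by (cases x) auto
  have "\<bar>y1 * y2\<bar> \<le> y1\<^sup>2 + y2\<^sup>2"
    using abs_cross_term_le[of 1 1 1 y1 y2] zero_le_power2[of y1] zero_le_power2[of y2] by simp
  then have "\<bar>B * (y1 * y2)\<bar> \<le> \<bar>B\<bar> * (y1\<^sup>2 + y2\<^sup>2)"
    unfolding abs_mult[of B] by (intro mult_left_mono) auto
  moreover have "\<bar>A * y1\<^sup>2\<bar> \<le> \<bar>A\<bar> * (y1\<^sup>2 + y2\<^sup>2)" "\<bar>C * y2\<^sup>2\<bar> \<le> \<bar>C\<bar> * (y1\<^sup>2 + y2\<^sup>2)"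
    by (auto simp: abs_mult intro!: mult_left_mono)
  ultimately have "\<bar>A * y1\<^sup>2 + B * (y1 * y2) + C * y2\<^sup>2\<bar> \<le> (\<bar>A\<bar> + \<bar>B\<bar> + \<bar>C\<bar>) * (y1\<^sup>2 + y2\<^sup>2)"
    unfolding distrib_right by linarith
  then have "\<bar>a * (A * y1\<^sup>2 + B * (y1 * y2) + C * y2\<^sup>2)\<bar> \<le> a * ((\<bar>A\<bar> + \<bar>B\<bar> + \<bar>C\<bar>) * (y1\<^sup>2 + y2\<^sup>2))"
    unfolding abs_mult[of a] using assms by (intro mult_mono) auto
  moreover have "\<bar>\<sigma> / 2 * (r - R)\<^sup>2\<bar> \<le> 1 * (r - R)\<^sup>2"
    unfolding abs_mult using assms by (intro mult_mono) auto
  ultimately have "\<bar>cycle_form \<sigma> a A B C R x\<bar>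
      \<le> 1 * (r - R)\<^sup>2 + a * (\<bar>A\<bar> + \<bar>B\<bar> + \<bar>C\<bar>) * (y1\<^sup>2 + y2\<^sup>2)"
    unfolding cycle_form_def x by (simp add: mult.assoc)
  also have "\<dots> \<le> (1 + a * (\<bar>A\<bar> + \<bar>B\<bar> + \<bar>C\<bar>)) * (y1\<^sup>2 + y2\<^sup>2 + (r - R)\<^sup>2)"
  proof -
    have "0 \<le> a * (\<bar>A\<bar> + \<bar>B\<bar> + \<bar>C\<bar>) * (r - R)\<^sup>2" using assms by auto
    then show ?thesis by (simp add: algebra_simps)
  qed
  finally show ?thesis by (simp add: x dist_circle_point_squared)
qed

context hopf_normal_form
begin

text \<open>Since \<open>R\<close> is a root, the rate is the difference of \<phi>_3(0, .) at
  \<open>r\<^sup>2\<close> and \<open>R\<^sup>2\<close>, to which monotonicity applies. With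
  \<open>r\<^sup>2 - R\<^sup>2 = (r - R) * (r + R)\<close> one factor \<open>r + R\<close> cancels,
  and \<open>r + R \<ge> R\<close>, \<open>r \<ge> R / 2\<close> produce the constant.\<close>

lemma radial_rate_ge:
  assumes R: "0 < R" "R\<^sup>2 \<le> m" "\<alpha>3 + \<phi> 3 0 (R\<^sup>2) = 0" and r: "R / 2 \<le> r" "r\<^sup>2 \<le> m"
  shows "\<bar>k\<bar> * R\<^sup>2 / 4 * (r - R)\<^sup>2 \<le> sgn k * (r - R) * ((\<alpha>3 + \<phi> 3 0 (r\<^sup>2)) * r)"
proof (cases "r = R")
  case False
  define s where "s = r - R"
  define \<Delta> where "\<Delta> = \<phi> 3 0 (r\<^sup>2) - \<phi> 3 0 (R\<^sup>2)"
  have rR: "0 < r + R" using R r by linarith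
  have sq: "r\<^sup>2 - R\<^sup>2 = s * (r + R)" by (simp add: s_def power2_eq_square algebra_simps)
  have "k\<^sup>2 / 2 * (s * (r + R))\<^sup>2 \<le> k * \<Delta> * (s * (r + R))"
    using \<phi>3_monotone[of "r\<^sup>2" "R\<^sup>2"] R r by (simp add: \<Delta>_def sq)
  then have "(r + R) * (k\<^sup>2 / 2 * s\<^sup>2 * (r + R)) \<le> (r + R) * (k * \<Delta> * s)"
    by (simp add: power2_eq_square algebra_simps)
  then have "k\<^sup>2 / 2 * s\<^sup>2 * (r + R) \<le> k * \<Delta> * s" using rR by simp
  then have "k\<^sup>2 / 2 * s\<^sup>2 * (r + R) * r \<le> k * \<Delta> * s * r"
    using R r by (intro mult_right_mono) auto
  moreover have "k\<^sup>2 / 2 * s\<^sup>2 * (R * (R / 2)) \<le> k\<^sup>2 / 2 * s\<^sup>2 * ((r + R) * r)"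
    using R r by (intro mult_left_mono mult_mono) auto
  moreover have "k\<^sup>2 / 2 * s\<^sup>2 * ((r + R) * r) = k\<^sup>2 / 2 * s\<^sup>2 * (r + R) * r"
    by (simp only: mult.assoc)
  ultimately have "k\<^sup>2 / 2 * s\<^sup>2 * (R * (R / 2)) \<le> k * \<Delta> * s * r" by linarith
  then have "\<bar>k\<bar> * (\<bar>k\<bar> * R\<^sup>2 / 4 * s\<^sup>2) \<le> \<bar>k\<bar> * (sgn k * s * (\<Delta> * r))"
    using k_nonzero by (simp add: power2_eq_square abs_sgn mult_ac sgn_if split: if_splits)
  then have "\<bar>k\<bar> * R\<^sup>2 / 4 * s\<^sup>2 \<le> sgn k * s * (\<Delta> * r)" using k_nonzero by simp
  moreover have "\<Delta> = \<alpha>3 + \<phi> 3 0 (r\<^sup>2)" using R by (simp add: \<Delta>_def)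
  ultimately show ?thesis by (simp add: s_def)
qed simp

text \<open>In the ball of radius \<open>R / 2\<close> one has
  \<open>y1\<^sup>2 \<le> R\<^sup>2\<close> and \<open>r \<le> 2 * R\<close>, so
  \<open>y1\<^sup>2 + r\<^sup>2 \<le> 5 * R\<^sup>2\<close>; the assumption
  \<open>5 * (K * R\<^sup>2) \<le> d\<close> therefore keeps \<phi>_1 and \<phi>_2 within the
  tolerance of the planar form. The weight satisfies \<open>a * \<eta> = K * R\<^sup>2 + 1\<close>:
  the first summand pays for the coupling, the second remains as growth.\<close>

lemma cycle_form_growth:
  assumes \<eta>: "0 < \<eta>" and grow: "robustly_increasing_form \<alpha>1 \<alpha>2 d \<eta> A B C"
    and R: "0 < R" "4 * R\<^sup>2 \<le> m" "5 * (K * R\<^sup>2) \<le> d" "\<alpha>3 + \<phi> 3 0 (R\<^sup>2) = 0"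
    and a: "a = (K * R\<^sup>2 + 1) / \<eta>" and lam: "lam = min 1 (\<bar>k\<bar> * R\<^sup>2 / 4)"
    and x: "x \<in> cball (0, 0, R) (R / 2)"
  shows "lam * (dist x (0, 0, R))\<^sup>2 \<le> cycle_form_deriv (sgn k) a A B C R x (polar_field \<phi> \<alpha>1 \<alpha>2 \<alpha>3 x)"
    and "(fst x)\<^sup>2 \<le> m \<and> (snd (snd x))\<^sup>2 \<le> m" and "0 \<le> snd (snd x)"
proof -
  obtain y1 y2 r where xe: "x = (y1, y2, r)" by (cases x) auto
  have "dist x (0, 0, R) \<le> R / 2" using x by (simp add: dist_commute)
  then have "(dist x (0, 0, R))\<^sup>2 \<le> (R / 2)\<^sup>2" by (intro power_mono) auto
  then have sq: "y1\<^sup>2 + y2\<^sup>2 + (r - R)\<^sup>2 \<le> (R / 2)\<^sup>2" by (simp add: xe dist_circle_point_squared)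
  have y1: "y1\<^sup>2 \<le> R\<^sup>2"
  proof -
    have "(R / 2)\<^sup>2 \<le> R\<^sup>2" by (simp add: power_divide)
    then show ?thesis
      using sq zero_le_power2[of y2] zero_le_power2[of "r - R"] by linarith
  qed
  have "(r - R)\<^sup>2 \<le> (R / 2)\<^sup>2" using sq zero_le_power2[of y2] zero_le_power2[of y1] by linarith
  then have rb: "\<bar>r - R\<bar> \<le> R / 2" using R abs_le_square_iff[of "r - R" "R / 2"] by simp
  then have r: "R / 2 \<le> r" "r \<le> 2 * R" using R by linarith+
  have "r\<^sup>2 \<le> (2 * R)\<^sup>2" using r R by (intro power_mono) auto
  then have r2: "r\<^sup>2 \<le> 4 * R\<^sup>2" by (simp add: power_mult_distrib)
  have in_sq: "y1\<^sup>2 \<le> m" "r\<^sup>2 \<le> m" using y1 r2 R zero_le_power2[of R] by linarith+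
  then show "(fst x)\<^sup>2 \<le> m \<and> (snd (snd x))\<^sup>2 \<le> m" "0 \<le> snd (snd x)" using r R by (auto simp: xe)
  define p where "p = \<phi> 1 (y1\<^sup>2) (r\<^sup>2)"
  define q where "q = \<phi> 2 (y1\<^sup>2) (r\<^sup>2)"
  have "K * (y1\<^sup>2 + r\<^sup>2) \<le> K * (5 * R\<^sup>2)" using K_pos y1 r2 by (intro mult_left_mono) auto
  then have pq: "\<bar>p\<bar> \<le> d" "\<bar>q\<bar> \<le> d"
    using \<phi>_small[of 1 "y1\<^sup>2" "r\<^sup>2"] \<phi>_small[of 2 "y1\<^sup>2" "r\<^sup>2"] in_sq R by (auto simp: p_def q_def)
  define W where "W = (2 * A * y1 + B * y2) * y2 + (B * y1 + 2 * C * y2) * ((\<alpha>1 + p) * y1 + (\<alpha>2 + q) * y2)"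
  have "a * (\<eta> * (y1\<^sup>2 + y2\<^sup>2)) \<le> a * W"
    unfolding W_def using grow pq a \<eta> K_pos
    by (intro mult_left_mono) (auto simp: robustly_increasing_form_def)
  then have W: "(K * R\<^sup>2 + 1) * (y1\<^sup>2 + y2\<^sup>2) \<le> a * W" using a \<eta> by simp
  \<comment> \<open>The coupling of the radial equation to the transversal plane. It is at most
    \<open>K * y1\<^sup>2\<close>, and its factor (r - R) r is at most (R/2)(2R).\<close>
  define e where "e = \<phi> 3 (y1\<^sup>2) (r\<^sup>2) - \<phi> 3 0 (r\<^sup>2)"
  have e1: "\<bar>e\<bar> \<le> K * y1\<^sup>2"
    using \<phi>_lipschitz[of 3 "y1\<^sup>2" "r\<^sup>2" 0 "r\<^sup>2"] in_sq m_pos by (simp add: e_def mem_square_iff)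
  have e2: "\<bar>sgn k * (r - R)\<bar> * \<bar>r\<bar> \<le> (R / 2) * (2 * R)"
    using rb r R k_nonzero by (intro mult_mono) (auto simp: abs_mult abs_sgn_eq)
  have "(\<bar>sgn k * (r - R)\<bar> * \<bar>r\<bar>) * \<bar>e\<bar> \<le> ((R / 2) * (2 * R)) * (K * y1\<^sup>2)"
    by (rule mult_mono[OF e2 e1]) (use R in auto)
  then have "\<bar>sgn k * (r - R) * (e * r)\<bar> \<le> K * R\<^sup>2 * y1\<^sup>2"
    by (simp add: abs_mult power2_eq_square mult_ac)
  moreover have "K * R\<^sup>2 * y1\<^sup>2 \<le> K * R\<^sup>2 * (y1\<^sup>2 + y2\<^sup>2)" using K_pos by (intro mult_left_mono) auto
  ultimately have e: "- (K * R\<^sup>2 * (y1\<^sup>2 + y2\<^sup>2)) \<le> sgn k * (r - R) * (e * r)" by linarith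
  have rad: "\<bar>k\<bar> * R\<^sup>2 / 4 * (r - R)\<^sup>2 \<le> sgn k * (r - R) * ((\<alpha>3 + \<phi> 3 0 (r\<^sup>2)) * r)"
    proof (rule radial_rate_ge)
    show "R\<^sup>2 \<le> m" using R(2) zero_le_power2[of R] by linarith
  qed (use R r in_sq in auto)
  have eq: "cycle_form_deriv (sgn k) a A B C R x (polar_field \<phi> \<alpha>1 \<alpha>2 \<alpha>3 x)
      = sgn k * (r - R) * ((\<alpha>3 + \<phi> 3 0 (r\<^sup>2)) * r) + sgn k * (r - R) * (e * r) + a * W"
    by (simp add: xe cycle_form_deriv_def polar_field_def e_def W_def p_def q_def algebra_simps)
  have "lam * (y1\<^sup>2 + y2\<^sup>2) \<le> 1 * (y1\<^sup>2 + y2\<^sup>2)" "lam * (r - R)\<^sup>2 \<le> \<bar>k\<bar> * R\<^sup>2 / 4 * (r - R)\<^sup>2"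
    by (rule mult_right_mono; simp add: lam)+
  then have "lam * (y1\<^sup>2 + y2\<^sup>2 + (r - R)\<^sup>2) \<le> cycle_form_deriv (sgn k) a A B C R x (polar_field \<phi> \<alpha>1 \<alpha>2 \<alpha>3 x)"
    unfolding eq using rad e W by (simp add: distrib_left distrib_right)
  then show "lam * (dist x (0, 0, R))\<^sup>2 \<le> cycle_form_deriv (sgn k) a A B C R x (polar_field \<phi> \<alpha>1 \<alpha>2 \<alpha>3 x)"
    by (simp add: xe dist_circle_point_squared)
qed

end

context hopf_normal_form
begin

text \<open>Positive values of the form occur arbitrarily near the circle: for \<open>0 < k\<close>
  by displacing \<open>r\<close> alone, otherwise by displacing \<open>(y1, y2)\<close> at
  \<open>r = R\<close> along a positive direction of the planar form, scaled down by
  homogeneity.\<close>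

lemma z_circle_not_orbitally_stable:
  assumes \<eta>: "0 < \<eta>" and grow: "robustly_increasing_form \<alpha>1 \<alpha>2 d \<eta> A B C"
    and R: "0 < R" "4 * R\<^sup>2 \<le> m" "5 * (K * R\<^sup>2) \<le> d" "\<alpha>3 + \<phi> 3 0 (R\<^sup>2) = 0"
    and unst: "0 < k \<or> (\<exists>x y. 0 < A * x\<^sup>2 + B * (x * y) + C * y\<^sup>2)"
  shows "\<not> orbitally_stable (nf_trajectory U \<phi> \<alpha>1 \<alpha>2 \<alpha>3) (z_circle R)"
proof -
  define a where "a = (K * R\<^sup>2 + 1) / \<eta>"
  define lam where "lam = min 1 (\<bar>k\<bar> * R\<^sup>2 / 4)"
  define M where "M = 1 + a * (\<bar>A\<bar> + \<bar>B\<bar> + \<bar>C\<bar>)"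
  have a: "0 < a" using \<eta> K_pos R by (auto simp: a_def add_nonneg_pos)
  have lam: "0 < lam" using R k_nonzero by (simp add: lam_def)
  have M: "0 < M" using a by (auto simp: M_def intro!: add_pos_nonneg)
  note growth = cycle_form_growth[OF \<eta> grow R a_def lam_def]
  have sub: "(fst x)\<^sup>2 \<le> m \<and> (snd (snd x))\<^sup>2 \<le> m" "0 \<le> snd (snd x)"
    if "x \<in> cball (0, 0, R) (R / 2)" for x :: "real \<times> real \<times> real"
    using growth(2,3)[OF that] by auto
  obtain L where L: "L-lipschitz_on (cball (0, 0, R) (R / 2)) (polar_field \<phi> \<alpha>1 \<alpha>2 \<alpha>3)"
    using lipschitz_on_polar_field[OF compact_cball sub(1)] by blast
  show ?thesis
  proof (rule nf_not_orbitally_stable[where V = "cycle_form (sgn k) a A B C R", OF _ _ L lam M _ _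
        has_derivative_cycle_form])
    show "continuous_on U (\<lambda>p. \<phi> 4 (fst p) (snd p))" by (rule \<phi>_continuous) simp
    show "0 \<le> r \<and> (y1\<^sup>2, r\<^sup>2) \<in> U" if "(y1, y2, r) \<in> cball (0, 0, R) (R / 2)" for y1 y2 r :: real
      using sub[OF that] by (auto intro!: in_domain)
    show "lam * (dist x (0, 0, R))\<^sup>2
        \<le> cycle_form_deriv (sgn k) a A B C R x (polar_field \<phi> \<alpha>1 \<alpha>2 \<alpha>3 x)"
      if "x \<in> cball (0, 0, R) (R / 2)" for x
      using growth(1)[OF that] by auto
    show "cycle_form (sgn k) a A B C R x \<le> M * (dist x (0, 0, R))\<^sup>2" for x
      using cycle_form_le[of "sgn k" a A B C R x] a by (simp add: M_def abs_sgn_eq)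
    show "\<exists>x. dist x (0, 0, R) < \<delta> \<and> 0 < cycle_form (sgn k) a A B C R x" if \<delta>: "0 < \<delta>" for \<delta>
    proof (cases "0 < k")
      case True
      then show ?thesis using \<delta>
        by (intro exI[of _ "(0, 0, R + \<delta> / 2)"])
          (simp add: cycle_form_def dist_Pair_Pair dist_real_def)
    next
      case False
      then obtain x y where xy: "0 < A * x\<^sup>2 + B * (x * y) + C * y\<^sup>2" using unst by blast
      \<comment> \<open>The scaling brings \<open>(x, y)\<close> to length at most
        \<open>\<delta> / 2\<close>; the added 1 keeps the denominator positive.\<close>
      define t where "t = \<delta> / (2 * (norm (x, y) + 1))"
      have t: "0 < t" using \<delta> by (simp add: t_def add_nonneg_pos)
      have "norm (t * x, t * y) = t * norm (x, y)"
        using norm_scaleR[of t "(x, y)"] t by simp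
      also have "\<dots> < \<delta>"
      proof -
        have "t * norm (x, y) \<le> t * (norm (x, y) + 1)" using t by simp
        also have "\<dots> = \<delta> / 2"
        proof -
          have "norm (x, y) + 1 \<noteq> 0" using norm_ge_zero[of "(x, y)"] by linarith
          then show ?thesis by (simp add: t_def field_simps)
        qed
        finally show ?thesis using \<delta> by linarith
      qed
      finally have "dist (t * x, t * y, R) (0, 0, R) < \<delta>"
        by (simp add: dist_Pair_Pair norm_Pair)
      moreover have "cycle_form (sgn k) a A B C R (t * x, t * y, R) = a * t\<^sup>2 * (A * x\<^sup>2 + B * (x * y) + C * y\<^sup>2)"
        by (simp add: cycle_form_def power2_eq_square algebra_simps)
      then have "0 < cycle_form (sgn k) a A B C R (t * x, t * y, R)" using a t xy by simp
      ultimately show ?thesis by blast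
    qed
  qed (use R in auto)
qed

lemma z_circle_orbitally_asymptotically_stable:
  assumes \<eta>: "0 < \<eta>" and grow: "robustly_increasing_form \<alpha>1 \<alpha>2 d \<eta> A B C"
    and R: "0 < R" "4 * R\<^sup>2 \<le> m" "5 * (K * R\<^sup>2) \<le> d" "\<alpha>3 + \<phi> 3 0 (R\<^sup>2) = 0"
    and "k < 0" and neg: "\<And>x y. \<eta> * (x\<^sup>2 + y\<^sup>2) \<le> - (A * x\<^sup>2 + B * (x * y) + C * y\<^sup>2)"
  shows "orbitally_asymptotically_stable (nf_trajectory U \<phi> \<alpha>1 \<alpha>2 \<alpha>3) (z_circle R)"
proof -
  define a where "a = (K * R\<^sup>2 + 1) / \<eta>"
  define lam where "lam = min 1 (\<bar>k\<bar> * R\<^sup>2 / 4)"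
  define M where "M = 1 + a * (\<bar>A\<bar> + \<bar>B\<bar> + \<bar>C\<bar>)"
  \<comment> \<open>For \<open>k < 0\<close> the negated form is \<open>(r - R)\<^sup>2 / 2\<close>
    plus a planar part bounded below by \<open>a * \<eta>\<close> times the squared length.\<close>
  define \<mu> where "\<mu> = min (1 / 2) (a * \<eta>)"
  have a: "0 < a" using \<eta> K_pos R by (auto simp: a_def add_nonneg_pos)
  have lam: "0 < lam" using R k_nonzero by (simp add: lam_def)
  have M: "0 < M" using a by (auto simp: M_def intro!: add_pos_nonneg)
  have \<mu>: "0 < \<mu>" using a \<eta> by (simp add: \<mu>_def)
  note growth = cycle_form_growth[OF \<eta> grow R a_def lam_def]
  have sub: "(fst x)\<^sup>2 \<le> m \<and> (snd (snd x))\<^sup>2 \<le> m" "0 \<le> snd (snd x)"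
    if "x \<in> cball (0, 0, R) (R / 2)" for x :: "real \<times> real \<times> real"
    using growth(2,3)[OF that] by auto
  obtain L where L: "L-lipschitz_on (cball (0, 0, R) (R / 2)) (polar_field \<phi> \<alpha>1 \<alpha>2 \<alpha>3)"
    using lipschitz_on_polar_field[OF compact_cball sub(1)] by blast
  show ?thesis
  proof (rule nf_orbitally_asymptotically_stable[where E = "\<lambda>x. - cycle_form (sgn k) a A B C R x", OF _ _ L lam M \<mu> _ _
        has_derivative_minus[OF has_derivative_cycle_form]])
    show "continuous_on U (\<lambda>p. \<phi> 4 (fst p) (snd p))" by (rule \<phi>_continuous) simp
    show "0 \<le> r \<and> (y1\<^sup>2, r\<^sup>2) \<in> U" if "(y1, y2, r) \<in> cball (0, 0, R) (R / 2)" for y1 y2 r :: real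
      using sub[OF that] by (auto intro!: in_domain)
    show "- cycle_form_deriv (sgn k) a A B C R x (polar_field \<phi> \<alpha>1 \<alpha>2 \<alpha>3 x)
        \<le> - lam * (dist x (0, 0, R))\<^sup>2"
      if "x \<in> cball (0, 0, R) (R / 2)" for x
      using growth(1)[OF that] by auto
    show "- cycle_form (sgn k) a A B C R x \<le> M * (dist x (0, 0, R))\<^sup>2" for x
      using cycle_form_le[of "sgn k" a A B C R x] a by (simp add: M_def abs_sgn_eq)
    show "\<mu> * (dist x (0, 0, R))\<^sup>2 \<le> - cycle_form (sgn k) a A B C R x" for x
    proof -
      obtain y1 y2 r where x: "x = (y1, y2, r)" by (cases x) auto
      have "a * (\<eta> * (y1\<^sup>2 + y2\<^sup>2)) \<le> a * (- (A * y1\<^sup>2 + B * (y1 * y2) + C * y2\<^sup>2))"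
        using neg a by (intro mult_left_mono) auto
      moreover have "\<mu> * (y1\<^sup>2 + y2\<^sup>2) \<le> (a * \<eta>) * (y1\<^sup>2 + y2\<^sup>2)" "\<mu> * (r - R)\<^sup>2 \<le> 1 / 2 * (r - R)\<^sup>2"
        by (rule mult_right_mono; simp add: \<mu>_def)+
      moreover have "\<mu> * (dist x (0, 0, R))\<^sup>2 = \<mu> * (y1\<^sup>2 + y2\<^sup>2) + \<mu> * (r - R)\<^sup>2"
        by (simp add: x dist_circle_point_squared distrib_left)
      moreover have "- cycle_form (sgn k) a A B C R x
          = 1 / 2 * (r - R)\<^sup>2 + a * (- (A * y1\<^sup>2 + B * (y1 * y2) + C * y2\<^sup>2))"
        using \<open>k < 0\<close> by (simp add: x cycle_form_def algebra_simps)
      ultimately show ?thesis by (simp only: mult.assoc)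
    qed
  qed (use R in auto)
qed

end

text \<open>The conclusion is about the derivative because it is the derivative that dominates a
  square, which is thereby forced to vanish.\<close>

lemma periodic_nondecreasing_imp_constant:
  fixes f :: "real \<Rightarrow> real"
  assumes P: "0 < P" and per: "\<And>t. f (t + P) = f t"
    and der: "\<And>t. (f has_real_derivative f' t) (at t)" and nn: "\<And>t. 0 \<le> f' t"
  shows "f' t = 0"
proof -
  have mono: "f s \<le> f t" if "s \<le> t" for s t
    using DERIV_nonneg_imp_nondecreasing[OF that] der nn by blast
  have shift: "f (t + real n * P) = f t" for n t
  proof (induction n)
    case (Suc n)
    have "f (t + real (Suc n) * P) = f ((t + real n * P) + P)" by (simp add: algebra_simps)
    then show ?case using per Suc by simp
  qed simp
  have le: "f t \<le> f s" if "s \<le> t" for s t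
  proof -
    \<comment> \<open>Shifting \<open>s\<close> by enough periods carries it past \<open>t\<close>
      without changing the value, so the function cannot have increased.\<close>
    obtain n where "t - s < real n * P" using reals_Archimedean3[OF P] by blast
    then have "f t \<le> f (s + real n * P)" by (intro mono) linarith
    then show ?thesis by (simp add: shift)
  qed
  have "f s = f 0" for s
    using mono[of s 0] mono[of 0 s] le[of s 0] le[of 0 s] by linarith
  then have "f = (\<lambda>_. f 0)" by auto
  then have "(f has_real_derivative 0) (at t)" by (subst \<open>f = (\<lambda>_. f 0)\<close>) (rule DERIV_const)
  then show ?thesis using der DERIV_unique by blast
qed

lemma z_circle_periodic_solution:
  assumes R: "0 < R" "(0, R\<^sup>2) \<in> U" "\<alpha>3 + \<phi> 3 0 (R\<^sup>2) = 0"
    and \<omega>: "\<omega> = 1 + \<phi> 4 0 (R\<^sup>2)" "0 < \<omega>"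
  shows "nf_solution U \<phi> \<alpha>1 \<alpha>2 \<alpha>3 UNIV (\<lambda>_. 0) (\<lambda>_. 0) (\<lambda>_. R) (\<lambda>t. \<theta>0 + \<omega> * t)"
    and "periodic_solution (nf_trajectory U \<phi> \<alpha>1 \<alpha>2 \<alpha>3) (2 * pi / \<omega>) (\<lambda>t. nf_point 0 0 R (\<theta>0 + \<omega> * t))"
    and "range (\<lambda>t. nf_point 0 0 R (\<theta>0 + \<omega> * t)) = z_circle R"
proof -
  show sol: "nf_solution U \<phi> \<alpha>1 \<alpha>2 \<alpha>3 UNIV (\<lambda>_. 0) (\<lambda>_. 0) (\<lambda>_. R) (\<lambda>t. \<theta>0 + \<omega> * t)"
    unfolding nf_solution_def using R \<omega> by (auto intro!: derivative_eq_intros)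
  let ?w = "\<lambda>t. nf_point 0 0 R (\<theta>0 + \<omega> * t)"
  have tr: "nf_trajectory U \<phi> \<alpha>1 \<alpha>2 \<alpha>3 UNIV ?w"
    unfolding nf_trajectory_def using sol by auto
  \<comment> \<open>Rotation at constant speed: whether a shift returns to the same point does not
    depend on \<open>t\<close>, so excluding smaller periods can be done at
    \<open>t = 0\<close>.\<close>
  have eq_iff: "?w (t + s) = ?w t \<longleftrightarrow> cis (\<omega> * s) = 1" for t s
  proof -
    have "cis (\<theta>0 + \<omega> * (t + s)) = cis (\<theta>0 + \<omega> * t) * cis (\<omega> * s)"
      by (simp add: cis_mult algebra_simps)
    then show ?thesis using R by (simp add: nf_point_def)
  qed
  have "?w (t + 2 * pi / \<omega>) = ?w t" for t using \<omega> by (subst eq_iff) simp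
  moreover have "?w (0 + Q) \<noteq> ?w 0" if Q: "0 < Q" "Q < 2 * pi / \<omega>" for Q
  proof
    assume "?w (0 + Q) = ?w 0"
    then have "cos (\<omega> * Q) = 1" unfolding eq_iff by (simp add: complex_eq_iff)
    then obtain n :: int where n: "\<omega> * Q = of_int n * (2 * pi)"
      by (auto simp: cos_one_2pi_int mult.assoc)
    have "0 < \<omega> * Q" "\<omega> * Q < 2 * pi"
      using Q \<omega>(2) by (auto simp: pos_less_divide_eq mult.commute)
    then have "0 < of_int n * (2 * pi)" "of_int n * (2 * pi) < 1 * (2 * pi)" using n by auto
    then have "0 < n" "real_of_int n < 1" by (auto simp: zero_less_mult_iff mult_less_cancel_right)
    then show False by linarith
  qed
  moreover have "0 < 2 * pi / \<omega>" using \<omega>(2) by simp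
  ultimately show "periodic_solution (nf_trajectory U \<phi> \<alpha>1 \<alpha>2 \<alpha>3) (2 * pi / \<omega>) ?w"
    unfolding periodic_solution_def using tr by blast
  show "range ?w = z_circle R"
  proof
    show "range ?w \<subseteq> z_circle R" using R by (auto simp: nf_point_def z_circle_def norm_mult)
    show "z_circle R \<subseteq> range ?w"
    proof
      fix q assume "q \<in> z_circle R"
      then obtain z where q: "q = (0, 0, z)" "cmod z = R" by (cases q) (auto simp: z_circle_def)
      have "q = ?w ((Arg z - \<theta>0) / \<omega>)"
        using q \<omega> rcis_cmod_Arg[of z] by (simp add: nf_point_def rcis_def)
      then show "q \<in> range ?w" by blast
    qed
  qed
qed

section \<open>Small periodic orbits\<close>

context hopf_normal_form
begin

lemma periodic_solution_is_circle:
  assumes \<eta>: "0 < \<eta>" and grow: "robustly_increasing_form \<alpha>1 \<alpha>2 d \<eta> A B C"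
    and \<delta>: "0 < \<delta>" "\<delta>\<^sup>2 \<le> m" "2 * (K * \<delta>\<^sup>2) \<le> d"
    and sol: "nf_solution U \<phi> \<alpha>1 \<alpha>2 \<alpha>3 UNIV y1 y2 r \<theta>"
    and P: "0 < P" and per: "\<And>t. y1 (t + P) = y1 t" "\<And>t. y2 (t + P) = y2 t" "\<And>t. r (t + P) = r t"
    and small: "\<And>t. \<bar>y1 t\<bar> < \<delta>" "\<And>t. r t < \<delta>"
  shows "y1 t = 0" and "y2 t = 0" and "r t = r 0" and "(\<alpha>3 + \<phi> 3 0 ((r 0)\<^sup>2)) * r 0 = 0"
proof -
  define p where "p t = \<phi> 1 ((y1 t)\<^sup>2) ((r t)\<^sup>2)" for t
  define q where "q t = \<phi> 2 ((y1 t)\<^sup>2) ((r t)\<^sup>2)" for t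
  have r_nn: "0 \<le> r t" for t using sol by (auto simp: nf_solution_def)
  have d1: "(y1 has_real_derivative y2 t) (at t)" for t
    using sol by (simp add: nf_solution_def)
  have d2: "(y2 has_real_derivative (\<alpha>1 + p t) * y1 t + (\<alpha>2 + q t) * y2 t) (at t)" for t
    using sol by (simp add: nf_solution_def p_def q_def)
  have d3: "(r has_real_derivative (\<alpha>3 + \<phi> 3 ((y1 t)\<^sup>2) ((r t)\<^sup>2)) * r t) (at t)" for t
    using sol by (simp add: nf_solution_def)
  have sq: "(y1 t)\<^sup>2 \<le> \<delta>\<^sup>2" "(r t)\<^sup>2 < \<delta>\<^sup>2" for t
  proof -
    have "\<bar>y1 t\<bar>\<^sup>2 \<le> \<delta>\<^sup>2" using small(1)[of t] by (intro power_mono) auto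
    then show "(y1 t)\<^sup>2 \<le> \<delta>\<^sup>2" by simp
    show "(r t)\<^sup>2 < \<delta>\<^sup>2" using small(2)[of t] r_nn by (intro power_strict_mono) auto
  qed
  have pq: "\<bar>p t\<bar> \<le> d" "\<bar>q t\<bar> \<le> d" for t
  proof -
    have "K * ((y1 t)\<^sup>2 + (r t)\<^sup>2) \<le> K * (2 * \<delta>\<^sup>2)"
      using sq[of t] K_pos by (intro mult_left_mono) auto
    moreover have "(y1 t)\<^sup>2 \<le> m" "(r t)\<^sup>2 \<le> m" using sq[of t] \<delta> by linarith+
    ultimately show "\<bar>p t\<bar> \<le> d" "\<bar>q t\<bar> \<le> d"
      using \<phi>_small[of 1 "(y1 t)\<^sup>2" "(r t)\<^sup>2"] \<phi>_small[of 2 "(y1 t)\<^sup>2" "(r t)\<^sup>2"] \<delta>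
      by (auto simp: p_def q_def)
  qed
  define W where "W t = A * (y1 t)\<^sup>2 + B * (y1 t * y2 t) + C * (y2 t)\<^sup>2" for t
  define W' where "W' t = (2 * A * y1 t + B * y2 t) * y2 t
    + (B * y1 t + 2 * C * y2 t) * ((\<alpha>1 + p t) * y1 t + (\<alpha>2 + q t) * y2 t)" for t
  have W'_ge: "\<eta> * ((y1 t)\<^sup>2 + (y2 t)\<^sup>2) \<le> W' t" for t
    using grow pq[of t] by (simp add: robustly_increasing_form_def W'_def)
  have W_der: "(W has_real_derivative W' t) (at t)" for t
    unfolding W_def W'_def
    by (auto intro!: derivative_eq_intros d1 d2 simp: algebra_simps power2_eq_square)
  have "W' t = 0" for t
  proof (rule periodic_nondecreasing_imp_constant[OF P _ W_der])
    show "W (s + P) = W s" for s by (simp add: W_def per)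
    show "0 \<le> W' s" for s
    proof -
      have "0 \<le> \<eta> * ((y1 s)\<^sup>2 + (y2 s)\<^sup>2)" using \<eta> by simp
      then show ?thesis using W'_ge[of s] by linarith
    qed
  qed
  then have "\<eta> * ((y1 t)\<^sup>2 + (y2 t)\<^sup>2) \<le> 0" for t using W'_ge[of t] by simp
  then have "(y1 t)\<^sup>2 + (y2 t)\<^sup>2 \<le> 0" for t using \<eta> by (simp add: mult_le_0_iff)
  then have y: "y1 t = 0 \<and> y2 t = 0" for t
    using sum_power2_le_zero_iff[of "y1 t" "y2 t"] by auto
  then show "y1 t = 0" "y2 t = 0" by auto
  define g where "g v = \<alpha>3 + \<phi> 3 0 v" for v
  have "continuous_on {- m..m} (\<lambda>v. \<phi> 3 0 v)"
  proof -
    have "continuous_on {- m..m} (\<lambda>v. (0, v))" by (intro continuous_intros)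
    from continuous_on_compose2[OF \<phi>_continuous[of 3] this] in_domain m_pos show ?thesis
      by (auto simp: image_subset_iff abs_le_iff)
  qed
  then have "continuous_on {- m..m} g" unfolding g_def by (intro continuous_intros)
  then obtain G where G: "\<And>v. v \<in> {- m..m} \<Longrightarrow> (G has_vector_derivative g v) (at v within {- m..m})"
    using antiderivative_continuous by blast
  have G': "(G has_real_derivative g ((r t)\<^sup>2)) (at ((r t)\<^sup>2))" for t
  proof -
    \<comment> \<open>The strict bound \<open>r t < \<delta>\<close> puts the squared radius in the
      open interval, where the one-sided derivative of the primitive is a two-sided one.\<close>
    have i: "(r t)\<^sup>2 \<in> {- m<..<m}" using sq(2)[of t] \<delta> m_pos zero_le_power2[of "r t"]
      unfolding greaterThanLessThan_iff by linarith
    then have "(G has_real_derivative g ((r t)\<^sup>2)) (at ((r t)\<^sup>2) within {- m..m})"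
      using G[of "(r t)\<^sup>2"] by (simp add: has_real_derivative_iff_has_vector_derivative)
    then have "(G has_real_derivative g ((r t)\<^sup>2)) (at ((r t)\<^sup>2) within {- m<..<m})"
      by (rule DERIV_subset) auto
    then show ?thesis using i at_within_open[of "(r t)\<^sup>2" "{- m<..<m}"] by simp
  qed
  have r_der: "(r has_real_derivative g ((r t)\<^sup>2) * r t) (at t)" for t
    using d3[of t] y by (simp add: g_def)
  \<comment> \<open>The primitive \<open>G\<close> of the radial rate is a potential for the radial
    motion: its derivative along \<open>r\<^sup>2\<close> is twice the square of the radial
    velocity, nonnegative whatever the sign of the rate.\<close>
  have G_der: "((\<lambda>t. G ((r t)\<^sup>2)) has_real_derivative 2 * (g ((r t)\<^sup>2) * r t)\<^sup>2) (at t)" for t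
  proof -
    have "((\<lambda>t. (r t)\<^sup>2) has_real_derivative 2 * r t * (g ((r t)\<^sup>2) * r t)) (at t)"
      by (auto intro!: derivative_eq_intros r_der)
    from DERIV_chain2[where f = G and g = "\<lambda>t. (r t)\<^sup>2", OF G' this] show ?thesis
      by (simp add: power2_eq_square mult_ac)
  qed
  have "2 * (g ((r t)\<^sup>2) * r t)\<^sup>2 = 0" for t
    by (rule periodic_nondecreasing_imp_constant[OF P _ G_der]) (auto simp: per)
  then have zero: "g ((r t)\<^sup>2) * r t = 0" for t by simp
  then have "(r has_real_derivative 0) (at t)" for t using r_der[of t] by (simp only: zero)
  then show "r t = r 0" using DERIV_isconst_all by blast
  show "(\<alpha>3 + \<phi> 3 0 ((r 0)\<^sup>2)) * r 0 = 0" using zero[of 0] by (simp add: g_def)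
qed

text \<open>The last condition on \<open>\<delta>\<close> keeps the angular speed at least 1/2, so
  every root really gives a rotating circle. None of the conditions on \<open>\<delta>\<close>
  involves \<open>\<alpha>3\<close>, which yields uniqueness in one fixed ball.\<close>

lemma small_periodic_orbit_iff:
  assumes \<eta>: "0 < \<eta>" and grow: "robustly_increasing_form \<alpha>1 \<alpha>2 d \<eta> A B C"
    and \<delta>: "0 < \<delta>" "\<delta>\<^sup>2 \<le> m" "2 * (K * \<delta>\<^sup>2) \<le> d" "2 * (K * \<delta>\<^sup>2) \<le> 1"
  shows "periodic_orbit (nf_trajectory U \<phi> \<alpha>1 \<alpha>2 \<alpha>3) G \<and> G \<subseteq> ball 0 \<delta> \<longleftrightarrow>
    (\<exists>R. 0 < R \<and> R < \<delta> \<and> \<alpha>3 + \<phi> 3 0 (R\<^sup>2) = 0 \<and> G = z_circle R)"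
proof -
  have inv: "0 < 1 + \<phi> 4 0 (R\<^sup>2) \<and> (0, R\<^sup>2) \<in> U" if "0 \<le> R" "R < \<delta>" for R
  proof -
    have R: "R\<^sup>2 < \<delta>\<^sup>2" using that by (intro power_strict_mono) auto
    then have "R\<^sup>2 \<le> m" using \<delta> by linarith
    then have "\<bar>\<phi> 4 0 (R\<^sup>2)\<bar> \<le> K * R\<^sup>2" using \<phi>_small[of 4 0 "R\<^sup>2"] m_pos by simp
    moreover have "K * R\<^sup>2 \<le> K * \<delta>\<^sup>2" using R K_pos by (intro mult_left_mono) auto
    ultimately show ?thesis using \<delta> \<open>R\<^sup>2 \<le> m\<close> m_pos by (auto intro!: in_domain)
  qed
  show ?thesis
  proof
    assume "\<exists>R. 0 < R \<and> R < \<delta> \<and> \<alpha>3 + \<phi> 3 0 (R\<^sup>2) = 0 \<and> G = z_circle R"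
    then obtain R where R: "0 < R" "R < \<delta>" "\<alpha>3 + \<phi> 3 0 (R\<^sup>2) = 0" "G = z_circle R" by blast
    have i: "(0, R\<^sup>2) \<in> U" "0 < 1 + \<phi> 4 0 (R\<^sup>2)" using inv[of R] R by auto
    have "periodic_orbit (nf_trajectory U \<phi> \<alpha>1 \<alpha>2 \<alpha>3) G"
      unfolding periodic_orbit_def R(4)
      using z_circle_periodic_solution(2)[where \<phi> = \<phi> and R = R and U = U and
          ?\<alpha>3.0 = \<alpha>3, OF R(1) i(1) R(3) refl i(2)]
        z_circle_periodic_solution(3)[where \<phi> = \<phi> and R = R and U = U and
          ?\<alpha>3.0 = \<alpha>3, OF R(1) i(1) R(3) refl i(2)]
      by metis
    moreover have "z_circle R \<subseteq> ball 0 \<delta>"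
      using R(2) by (auto simp: z_circle_def norm_Pair)
    ultimately show "periodic_orbit (nf_trajectory U \<phi> \<alpha>1 \<alpha>2 \<alpha>3) G \<and> G \<subseteq> ball 0 \<delta>"
      using R(4) by blast
  next
    assume "periodic_orbit (nf_trajectory U \<phi> \<alpha>1 \<alpha>2 \<alpha>3) G \<and> G \<subseteq> ball 0 \<delta>"
    then obtain P w where ps: "periodic_solution (nf_trajectory U \<phi> \<alpha>1 \<alpha>2 \<alpha>3) P w"
      and G: "G = range w" "range w \<subseteq> ball 0 \<delta>"
      unfolding periodic_orbit_def by blast
    obtain y1 y2 r \<theta> where sol: "nf_solution U \<phi> \<alpha>1 \<alpha>2 \<alpha>3 UNIV y1 y2 r \<theta>"
      and w: "\<And>t. w t = nf_point (y1 t) (y2 t) (r t) (\<theta> t)"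
      using ps unfolding periodic_solution_def nf_trajectory_def by auto
    have P: "0 < P" "\<And>t. w (t + P) = w t"
      and least: "\<And>Q. 0 < Q \<Longrightarrow> Q < P \<Longrightarrow> \<exists>t. w (t + Q) \<noteq> w t"
      using ps unfolding periodic_solution_def by auto
    have r_nn: "0 \<le> r t" for t using sol by (auto simp: nf_solution_def)
    \<comment> \<open>Because \<open>r\<close> is nonnegative it is recovered from the point as a
      modulus, so it inherits the period of \<open>w\<close>; the phase need not be periodic as a
      real function.\<close>
    have comp: "y1 t = fst (w t)" "y2 t = fst (snd (w t))" "r t = cmod (snd (snd (w t)))" for t
      using r_nn[of t] by (auto simp: w nf_point_def norm_mult)
    have bd: "\<bar>y1 t\<bar> < \<delta> \<and> r t < \<delta>" for t
    proof -
      have "w t \<in> ball 0 \<delta>" using G(2) by blast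
      then have "norm (w t) < \<delta>" by simp
      moreover have "norm (fst (w t)) \<le> norm (w t)" "norm (snd (snd (w t))) \<le> norm (w t)"
        using norm_fst_le[of "fst (w t)" "snd (w t)"] norm_snd_le[of "snd (w t)" "fst (w t)"]
          norm_snd_le[of "snd (snd (w t))" "fst (snd (w t))"] by auto
      ultimately show ?thesis unfolding comp by auto
    qed
    have per: "y1 (t + P) = y1 t" "y2 (t + P) = y2 t" "r (t + P) = r t" for t
      by (simp_all only: comp P(2))
    have small: "\<bar>y1 t\<bar> < \<delta>" "r t < \<delta>" for t using bd by auto
    note c = periodic_solution_is_circle[OF \<eta> grow \<delta>(1-3) sol P(1) per small]
    \<comment> \<open>A vanishing radius would make \<open>w\<close> the equilibrium, for which half
      of \<open>P\<close> is already a period.\<close>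
    have r0: "r 0 \<noteq> 0"
    proof
      assume "r 0 = 0"
      then have "r t = 0" for t using c(3)[of t] by simp
      then have "w t = 0" for t by (simp add: w c(1,2) nf_point_def zero_prod_def)
      then show False using least[of "P / 2"] P(1) by auto
    qed
    define R where "R = r 0"
    have R: "0 < R" "R < \<delta>" "\<alpha>3 + \<phi> 3 0 (R\<^sup>2) = 0"
      using r0 r_nn[of 0] small(2)[of 0] c(4) by (auto simp: R_def)
    define \<omega> where "\<omega> = 1 + \<phi> 4 0 (R\<^sup>2)"
    have i: "(0, R\<^sup>2) \<in> U" "0 < \<omega>" using inv[of R] R by (auto simp: \<omega>_def)
    have "(\<theta> has_real_derivative \<omega>) (at t)" for t
    proof -
      have "(\<theta> has_real_derivative 1 + \<phi> 4 ((y1 t)\<^sup>2) ((r t)\<^sup>2)) (at t)"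
        using sol by (simp add: nf_solution_def)
      then show ?thesis unfolding c(1) c(3)[of t] by (simp add: \<omega>_def R_def)
    qed
    then have "((\<lambda>t. \<theta> t - \<omega> * t) has_real_derivative 0) (at t)" for t
      by (auto intro!: derivative_eq_intros)
    then have iso: "\<theta> t - \<omega> * t = \<theta> 0 - \<omega> * 0" for t
      using DERIV_isconst_all[of "\<lambda>t. \<theta> t - \<omega> * t"] by blast
    have \<theta>: "\<theta> t = \<theta> 0 + \<omega> * t" for t using iso[of t] by linarith
    have "w = (\<lambda>t. nf_point 0 0 R (\<theta> 0 + \<omega> * t))"
    proof
      fix t show "w t = nf_point 0 0 R (\<theta> 0 + \<omega> * t)"
        unfolding w c(1,2) R_def using c(3)[of t] \<theta>[of t] by simp
    qed
    then have "G = z_circle R"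
      using z_circle_periodic_solution(3)[where \<phi> = \<phi> and R = R and U = U and
          ?\<alpha>3.0 = \<alpha>3 and \<omega> = \<omega>, OF R(1) i(1) R(3) \<omega>_def i(2)] G(1) by simp
    then show "\<exists>R. 0 < R \<and> R < \<delta> \<and> \<alpha>3 + \<phi> 3 0 (R\<^sup>2) = 0 \<and> G = z_circle R"
      using R by blast
  qed
qed

end

section \<open>Invariance and linearization\<close>

lemma z_plane_eq: "z_plane = (\<lambda>z. (0, 0, z)) ` UNIV"
  by (auto simp: z_plane_def)

lemma subspace_z_plane: "subspace z_plane"
  unfolding z_plane_def subspace_def by (auto simp: zero_prod_def)

lemma dim_z_plane: "dim z_plane = 2"
proof -
  have "linear (\<lambda>z :: complex. (0 :: real, 0 :: real, z))"
    by (auto intro!: linearI)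
  then have "dim z_plane = dim (UNIV :: complex set)"
    unfolding z_plane_eq by (rule dim_image_eq) (auto simp: inj_on_def)
  then show ?thesis by (simp add: dim_UNIV)
qed

text \<open>Both time directions are covered, \<open>exp (- K t) N t\<close> being nonincreasing and
  \<open>exp (K t) N t\<close> nondecreasing, because invariance is asked before as well as after
  the time spent in the set.\<close>

lemma gronwall_zero:
  fixes N :: "real \<Rightarrow> real"
  assumes der: "\<And>t. t \<in> {a..b} \<Longrightarrow> (N has_real_derivative N' t) (at t within {a..b})"
    and bd: "\<And>t. t \<in> {a..b} \<Longrightarrow> \<bar>N' t\<bar> \<le> K * N t"
    and nn: "\<And>t. 0 \<le> N t" and "s \<in> {a..b}" "N s = 0" "t \<in> {a..b}"
  shows "N t = 0"
proof -
  have sub: "(N has_real_derivative N' r) (at r within {c..d})" if "a \<le> c" "d \<le> b" "r \<in> {c..d}" for c d r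
    using that by (intro DERIV_subset[OF der]) auto
  consider "s \<le> t" | "t \<le> s" by linarith
  then have "N t \<le> 0"
  proof cases
    case 1
    have "exp (- K * t) * N t \<le> exp (- K * s) * N s"
    proof (rule decreasing_of_derivative_le_0[OF 1])
      fix r assume r: "r \<in> {s..t}"
      have "(N has_real_derivative N' r) (at r within {s..t})" using sub[of s t r] r assms by auto
      then show "((\<lambda>r. exp (- K * r) * N r) has_real_derivative exp (- K * r) * (N' r - K * N r)) (at r within {s..t})"
        by (auto intro!: derivative_eq_intros simp: algebra_simps)
      have "\<bar>N' r\<bar> \<le> K * N r" using bd[of r] r assms by auto
      then have "N' r - K * N r \<le> 0" by linarith
      then show "exp (- K * r) * (N' r - K * N r) \<le> 0" by (simp add: mult_nonneg_nonpos)
    qed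
    then show ?thesis using assms by (simp add: mult_le_0_iff)
  next
    case 2
    have "- (exp (K * s) * N s) \<le> - (exp (K * t) * N t)"
    proof (rule decreasing_of_derivative_le_0[OF 2])
      fix r assume r: "r \<in> {t..s}"
      have "(N has_real_derivative N' r) (at r within {t..s})" using sub[of t s r] r assms by auto
      then show "((\<lambda>r. - (exp (K * r) * N r)) has_real_derivative - (exp (K * r) * (N' r + K * N r))) (at r within {t..s})"
        by (auto intro!: derivative_eq_intros simp: algebra_simps)
      have "\<bar>N' r\<bar> \<le> K * N r" using bd[of r] r assms by auto
      then have "0 \<le> N' r + K * N r" by linarith
      then show "- (exp (K * r) * (N' r + K * N r)) \<le> 0" by simp
    qed
    then show ?thesis using assms by (simp add: mult_le_0_iff)
  qed
  then show ?thesis using nn[of t] by simp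
qed

text \<open>Along a given trajectory \<open>(y1, y2)\<close> solves a linear equation with
  time-dependent coefficients \<open>a1\<close>, \<open>a2\<close>. These are continuous, hence
  bounded on the compact interval between \<open>t0\<close> and \<open>t\<close>, so Gronwall
  applies to the squared length \<open>N\<close>.\<close>

lemma invariant_z_plane:
  assumes \<phi>: "\<And>j. j \<in> {1..4} \<Longrightarrow> continuous_on U (\<lambda>p. \<phi> j (fst p) (snd p))"
  shows "invariant_set (nf_trajectory U \<phi> \<alpha>1 \<alpha>2 \<alpha>3) z_plane"
  unfolding invariant_set_def
proof (intro allI impI ballI, elim conjE)
  fix T w t0 t
  assume T: "is_interval T" and tr: "nf_trajectory U \<phi> \<alpha>1 \<alpha>2 \<alpha>3 T w"
    and t0: "t0 \<in> T" "w t0 \<in> z_plane" and t: "t \<in> T"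
  obtain y1 y2 r \<theta> where sol: "nf_solution U \<phi> \<alpha>1 \<alpha>2 \<alpha>3 T y1 y2 r \<theta>"
    and w: "\<And>t. t \<in> T \<Longrightarrow> w t = nf_point (y1 t) (y2 t) (r t) (\<theta> t)"
    using tr unfolding nf_trajectory_def by blast
  define a where "a = min t0 t"
  define b where "b = max t0 t"
  have ab: "{a..b} \<subseteq> T"
  proof
    have "a \<in> T" "b \<in> T" using t0 t by (auto simp: a_def b_def min_def max_def)
    show "s \<in> T" if "s \<in> {a..b}" for s
      by (rule mem_is_interval_1_I[OF T \<open>a \<in> T\<close> \<open>b \<in> T\<close>]) (use that in auto)
  qed
  have der: "(f has_real_derivative f') (at s within {a..b})"
    if "(f has_real_derivative f') (at s within T)" for f :: "real \<Rightarrow> real" and f' s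
    using that ab by (rule DERIV_subset)
  have d1: "(y1 has_real_derivative y2 s) (at s within {a..b})"
    and d2: "(y2 has_real_derivative (\<alpha>1 + \<phi> 1 ((y1 s)\<^sup>2) ((r s)\<^sup>2)) * y1 s + (\<alpha>2 + \<phi> 2 ((y1 s)\<^sup>2) ((r s)\<^sup>2)) * y2 s) (at s within {a..b})"
    and d3: "(r has_real_derivative (\<alpha>3 + \<phi> 3 ((y1 s)\<^sup>2) ((r s)\<^sup>2)) * r s) (at s within {a..b})"
    and in_U: "((y1 s)\<^sup>2, (r s)\<^sup>2) \<in> U" if "s \<in> {a..b}" for s
    using der sol[unfolded nf_solution_def, rule_format, of s] ab that by blast+
  have C: "continuous_on {a..b} f"
    if "\<And>s. s \<in> {a..b} \<Longrightarrow> (f has_real_derivative f' s) (at s within {a..b})" for f f' :: "real \<Rightarrow> real"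
    unfolding continuous_on_eq_continuous_within using DERIV_continuous[OF that] by blast
  have c: "continuous_on {a..b} y1" "continuous_on {a..b} y2" "continuous_on {a..b} r"
    by (rule C[OF d1] C[OF d2] C[OF d3]; assumption)+
  have c\<phi>: "continuous_on {a..b} (\<lambda>s. \<phi> j ((y1 s)\<^sup>2) ((r s)\<^sup>2))" if "j \<in> {1..4}" for j
  proof -
    have "continuous_on {a..b} (\<lambda>s. ((y1 s)\<^sup>2, (r s)\<^sup>2))" by (intro continuous_intros c)
    moreover have "(\<lambda>s. ((y1 s)\<^sup>2, (r s)\<^sup>2)) ` {a..b} \<subseteq> U" using in_U by blast
    ultimately show ?thesis using continuous_on_compose2[OF \<phi>[OF that]] by fastforce
  qed
  define a1 where "a1 s = \<alpha>1 + \<phi> 1 ((y1 s)\<^sup>2) ((r s)\<^sup>2)" for s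
  define a2 where "a2 s = \<alpha>2 + \<phi> 2 ((y1 s)\<^sup>2) ((r s)\<^sup>2)" for s
  have "continuous_on {a..b} a1" "continuous_on {a..b} a2"
    unfolding a1_def a2_def by (intro continuous_intros c\<phi>; simp)+
  then have "bounded (a1 ` {a..b})" "bounded (a2 ` {a..b})"
    by (auto intro!: compact_imp_bounded compact_continuous_image)
  then obtain B1 B2 where B: "0 < B1" "0 < B2" "\<And>s. s \<in> {a..b} \<Longrightarrow> \<bar>a1 s\<bar> \<le> B1" "\<And>s. s \<in> {a..b} \<Longrightarrow> \<bar>a2 s\<bar> \<le> B2"
    unfolding bounded_pos by (metis image_eqI real_norm_def)
  define N where "N s = (y1 s)\<^sup>2 + (y2 s)\<^sup>2" for s
  have N0: "N t0 = 0" using t0 w[OF t0(1)] by (simp add: N_def z_plane_def nf_point_def)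
  have "N t = 0"
  proof (rule gronwall_zero[where N = N and t = t and a = a and b = b and s = t0 and K = "1 + B1 + 2 * B2"
        and N' = "\<lambda>s. 2 * (1 + a1 s) * (y1 s * y2 s) + 2 * a2 s * (y2 s)\<^sup>2"])
    fix s assume s: "s \<in> {a..b}"
    show "(N has_real_derivative 2 * (1 + a1 s) * (y1 s * y2 s) + 2 * a2 s * (y2 s)\<^sup>2) (at s within {a..b})"
      unfolding N_def
      using d1[OF s] d2[OF s] by (auto intro!: derivative_eq_intros
          simp: a1_def a2_def algebra_simps power2_eq_square)
    have "\<bar>2 * (1 + a1 s)\<bar> \<le> 2 * (1 + B1)" using B(3)[OF s] unfolding abs_le_iff by auto
    moreover have "\<bar>y1 s * y2 s\<bar> \<le> N s / 2"
      using abs_cross_term_le[of 1 1 1 "y1 s" "y2 s"] by (simp add: N_def)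
    ultimately have "\<bar>2 * (1 + a1 s)\<bar> * \<bar>y1 s * y2 s\<bar> \<le> (2 * (1 + B1)) * (N s / 2)"
      using B by (intro mult_mono) auto
    then have "\<bar>2 * (1 + a1 s) * (y1 s * y2 s)\<bar> \<le> (2 * (1 + B1)) * (N s / 2)"
      by (simp only: abs_mult[of "2 * (1 + a1 s)"])
    moreover have "\<bar>2 * a2 s\<bar> * (y2 s)\<^sup>2 \<le> (2 * B2) * N s"
      using B(4)[OF s] B(2) by (intro mult_mono) (auto simp: N_def)
    then have "\<bar>2 * a2 s * (y2 s)\<^sup>2\<bar> \<le> (2 * B2) * N s"
      by (simp only: abs_mult[of "2 * a2 s"] abs_power2)
    moreover have "(1 + B1 + 2 * B2) * N s = (2 * (1 + B1)) * (N s / 2) + (2 * B2) * N s"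
      by (simp add: algebra_simps)
    ultimately show "\<bar>2 * (1 + a1 s) * (y1 s * y2 s) + 2 * a2 s * (y2 s)\<^sup>2\<bar> \<le> (1 + B1 + 2 * B2) * N s"
      using abs_triangle_ineq[of "2 * (1 + a1 s) * (y1 s * y2 s)" "2 * a2 s * (y2 s)\<^sup>2"] by linarith
  qed (use N0 in \<open>auto simp: N_def a_def b_def\<close>)
  then have "y1 t = 0 \<and> y2 t = 0" by (simp add: N_def)
  then show "w t \<in> z_plane" using w[OF t] by (simp add: z_plane_def nf_point_def)
qed

text \<open>The characteristic polynomial of \<open>x' = y, y' = a1 x + a2 y\<close> does not vanish at \<open>\<plusminus>i\<close>.\<close>

lemma planar_kernel_trivial:
  fixes a1 a2 x y :: real
  assumes "a2 \<noteq> 0" and 1: "a1 * x + a2 * y + x = 0" and 2: "a1 * y + a2 * (a1 * x + a2 * y) + y = 0"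
  shows "x = 0 \<and> y = 0"
proof -
  have "a1 * x + a2 * y = - x" using 1 by linarith
  with 2 have e2: "a1 * y - a2 * x + y = 0" by simp
  have "a2 * (x\<^sup>2 + y\<^sup>2) = (a1 * x + a2 * y + x) * y - (a1 * y - a2 * x + y) * x"
    by (simp add: power2_eq_square algebra_simps)
  also have "\<dots> = 0" by (simp only: 1 e2)
  finally show ?thesis using assms(1) by simp
qed

text \<open>For X = x + i x' the equations combine to (a1 + w^2 + i a2 w) X = 0. If X were nonzero,
  the imaginary part would force w = 0 and the real part then a1 = 0; the eigenvalue 0 is thus
  excluded as well.\<close>

lemma planar_imaginary_eigenvector_trivial:
  fixes a1 a2 w x y x' y' :: real
  assumes "a1 \<noteq> 0" "a2 \<noteq> 0"
    and e: "y = - w * x'" "a1 * x + a2 * y = - w * y'" "y' = w * x" "a1 * x' + a2 * y' = w * y"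
  shows "x = 0 \<and> y = 0 \<and> x' = 0 \<and> y' = 0"
proof -
  have 1: "a1 * x - a2 * w * x' + w\<^sup>2 * x = 0" and 2: "a1 * x' + a2 * w * x + w\<^sup>2 * x' = 0"
    using e by (simp_all add: power2_eq_square algebra_simps)
  have "a2 * w * (x\<^sup>2 + x'\<^sup>2) = (a1 * x' + a2 * w * x + w\<^sup>2 * x') * x - (a1 * x - a2 * w * x' + w\<^sup>2 * x) * x'"
    by (simp add: power2_eq_square algebra_simps)
  also have "\<dots> = 0" by (simp only: 1 2)
  finally have "w = 0 \<or> x\<^sup>2 + x'\<^sup>2 = 0" using assms(2) by simp
  moreover have "(a1 + w\<^sup>2) * (x\<^sup>2 + x'\<^sup>2) = (a1 * x - a2 * w * x' + w\<^sup>2 * x) * x + (a1 * x' + a2 * w * x + w\<^sup>2 * x') * x'"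
    by (simp add: power2_eq_square algebra_simps)
  then have "(a1 + w\<^sup>2) * (x\<^sup>2 + x'\<^sup>2) = 0" by (simp only: 1 2)
  ultimately have "x\<^sup>2 + x'\<^sup>2 = 0" using assms(1) by auto
  then have "x = 0" "x' = 0" by simp_all
  then show ?thesis using e by simp
qed

section \<open>The linearization at the equilibrium and its spectrum\<close>

definition nf_linearization :: "real \<Rightarrow> real \<Rightarrow> real \<Rightarrow> real \<times> real \<times> complex \<Rightarrow> real \<times> real \<times> complex" where
  "nf_linearization \<alpha>1 \<alpha>2 \<mu> = (\<lambda>(y1, y2, z). (y2, \<alpha>1 * y1 + \<alpha>2 * y2, Complex \<mu> 1 * z))"

lemma bounded_linear_nf_linearization: "bounded_linear (nf_linearization \<alpha>1 \<alpha>2 \<mu>)"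
  unfolding linear_conv_bounded_linear[symmetric]
  by (rule linearI) (auto simp: nf_linearization_def algebra_simps)

lemma nf_linearization_spectrum:
  assumes "\<alpha>1 \<noteq> 0" "\<alpha>2 \<noteq> 0"
  shows "complex_eigenvalue (nf_linearization \<alpha>1 \<alpha>2 \<mu>) (Complex \<mu> 1)"
    and "simple_imaginary_pair (nf_linearization \<alpha>1 \<alpha>2 0) 1"
    and "complex_eigenvalue (nf_linearization \<alpha>1 \<alpha>2 0) \<nu> \<Longrightarrow> Re \<nu> = 0 \<Longrightarrow>
      \<nu> \<in> {Complex 0 1, Complex 0 (- 1)}"
proof -
  \<comment> \<open>The witness is u = 1, v = -i in the z-plane, where i is a vector of that real
    plane and not the scalar of the complexification; indeed (\<mu> + i) 1 = \<mu> u - v and (\<mu>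
    + i)(-i) = u + \<mu> v.\<close>
  show ev: "complex_eigenvalue (nf_linearization \<alpha>1 \<alpha>2 \<mu>) (Complex \<mu> 1)" for \<mu>
    unfolding complex_eigenvalue_def
    by (intro exI[of _ "(0, 0, 1)"] exI[of _ "(0, 0, - \<i>)"])
      (auto simp: nf_linearization_def complex_eq_iff zero_prod_def)
  \<comment> \<open>On the z-plane \<open>Q\<close> is zero, as multiplication by i squares to -1;
    on the transversal plane it is injective. So the kernel of the iterated \<open>Q\<close> is
    exactly the z-plane.\<close>
  define Q where "Q x = nf_linearization \<alpha>1 \<alpha>2 0 (nf_linearization \<alpha>1 \<alpha>2 0 x) + 1\<^sup>2 *\<^sub>R x" for x
  have Q: "Q (y1, y2, z) = (\<alpha>1 * y1 + \<alpha>2 * y2 + y1, \<alpha>1 * y2 + \<alpha>2 * (\<alpha>1 * y1 + \<alpha>2 * y2) + y2, 0)" for y1 y2 z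
    by (simp add: Q_def nf_linearization_def complex_eq_iff)
  have ker: "y1 = 0 \<and> y2 = 0" if "Q (y1, y2, z) = (0, 0, z')" for y1 y2 z z'
    using planar_kernel_trivial[OF assms(2), of \<alpha>1 y1 y2] that unfolding Q by simp
  have "{x. Q (Q x) = 0} = z_plane"
  proof safe
    fix y1 y2 z assume "Q (Q (y1, y2, z)) = 0"
    then have "Q (y1, y2, z) = (0, 0, 0)"
      using ker[of "fst (Q (y1, y2, z))" "fst (snd (Q (y1, y2, z)))" 0 0]
      by (simp add: Q zero_prod_def)
    then show "(y1, y2, z) \<in> z_plane" using ker by (simp add: z_plane_def)
  qed (auto simp: z_plane_def Q zero_prod_def)
  then show "simple_imaginary_pair (nf_linearization \<alpha>1 \<alpha>2 0) 1"
    unfolding simple_imaginary_pair_def Let_def Q_def using ev[of 0] dim_z_plane by simp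
  assume "complex_eigenvalue (nf_linearization \<alpha>1 \<alpha>2 0) \<nu>" and re: "Re \<nu> = 0"
  then obtain u v where nz: "u \<noteq> 0 \<or> v \<noteq> 0"
    and "nf_linearization \<alpha>1 \<alpha>2 0 u = Re \<nu> *\<^sub>R u - Im \<nu> *\<^sub>R v"
      "nf_linearization \<alpha>1 \<alpha>2 0 v = Im \<nu> *\<^sub>R u + Re \<nu> *\<^sub>R v"
    unfolding complex_eigenvalue_def by blast
  then have uv: "nf_linearization \<alpha>1 \<alpha>2 0 u = - Im \<nu> *\<^sub>R v" "nf_linearization \<alpha>1 \<alpha>2 0 v = Im \<nu> *\<^sub>R u"
    using re by simp_all
  obtain x y z where u: "u = (x, y, z)" by (cases u) auto
  obtain x' y' z' where v: "v = (x', y', z')" by (cases v) auto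
  have "x = 0 \<and> y = 0 \<and> x' = 0 \<and> y' = 0"
    using uv by (intro planar_imaginary_eigenvector_trivial[OF assms, where w = "Im \<nu>"])
      (auto simp: u v nf_linearization_def)
  then have nz': "z \<noteq> 0 \<or> z' \<noteq> 0" using nz by (auto simp: u v zero_prod_def)
  have z: "Complex 0 1 * z = - (of_real (Im \<nu>) * z')" "Complex 0 1 * z' = of_real (Im \<nu>) * z"
    using uv by (auto simp: u v nf_linearization_def scaleR_conv_of_real)
  have ii: "Complex 0 1 = \<i>" by (simp add: complex_eq_iff)
  \<comment> \<open>Applying i twice eliminates the other component, so that (Im \<nu>)^2 fixes a
    nonzero vector and equals 1.\<close>
  have "z = of_real ((Im \<nu>)\<^sup>2) * z" "z' = of_real ((Im \<nu>)\<^sup>2) * z'"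
  proof -
    have iz: "\<i> * z = - (of_real (Im \<nu>) * z')" and iz': "\<i> * z' = of_real (Im \<nu>) * z"
      using z ii by simp_all
    have "z = - (\<i> * (\<i> * z))" by simp
    also have "\<dots> = of_real (Im \<nu>) * (\<i> * z')" unfolding iz by simp
    finally show "z = of_real ((Im \<nu>)\<^sup>2) * z" unfolding iz' by (simp add: power2_eq_square mult_ac)
    have "z' = - (\<i> * (\<i> * z'))" by simp
    also have "\<dots> = - (of_real (Im \<nu>) * (\<i> * z))" unfolding iz' by simp
    finally show "z' = of_real ((Im \<nu>)\<^sup>2) * z'" unfolding iz by (simp add: power2_eq_square mult_ac)
  qed
  then have "complex_of_real ((Im \<nu>)\<^sup>2) = 1" using nz' by auto
  then have "(Im \<nu>)\<^sup>2 = 1" using of_real_eq_1_iff by blast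
  then have "Im \<nu> = 1 \<or> Im \<nu> = - 1" by (simp add: power2_eq_1_iff)
  then show "\<nu> \<in> {Complex 0 1, Complex 0 (- 1)}" using re by (auto simp: complex_eq_iff)
qed

context hopf_normal_form
begin

text \<open>The remainder consists of the \<phi>_j times coordinates. Each \<phi>_j is of second
  order, so the remainder is of third order; the radius \<open>min 1 m\<close> ensures that the
  squared norm stays below \<open>m\<close>.\<close>

lemma nf_field_has_derivative_at_0:
  "(nf_field \<phi> \<alpha>1 \<alpha>2 \<mu> has_derivative nf_linearization \<alpha>1 \<alpha>2 \<mu>) (at 0)"
proof (rule has_derivativeI_sandwich[where e = "min 1 m" and H = "\<lambda>x. 8 * K * (norm x)\<^sup>2"])
  show "0 < min 1 m" using m_pos by simp
  show "bounded_linear (nf_linearization \<alpha>1 \<alpha>2 \<mu>)" by (rule bounded_linear_nf_linearization)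
  have "((\<lambda>x :: real \<times> real \<times> complex. norm x) \<longlongrightarrow> norm (0 :: real \<times> real \<times> complex)) (at 0)"
    by (rule tendsto_norm[OF tendsto_ident_at])
  then have "((\<lambda>x :: real \<times> real \<times> complex. 8 * K * (norm x)\<^sup>2) \<longlongrightarrow> 8 * K * (norm (0 :: real \<times> real \<times> complex))\<^sup>2) (at 0)"
    by (intro tendsto_mult tendsto_power tendsto_const)
  then show "((\<lambda>x :: real \<times> real \<times> complex. 8 * K * (norm x)\<^sup>2) \<longlongrightarrow> 0) (at (0 :: real \<times> real \<times> complex))" by simp
  fix x :: "real \<times> real \<times> complex" assume "dist x 0 < min 1 m"
  then have n: "norm x < 1" "norm x < m" by auto
  obtain y1 y2 z where x: "x = (y1, y2, z)" by (cases x) auto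
  have le: "\<bar>y1\<bar> \<le> norm x" "\<bar>y2\<bar> \<le> norm x" "cmod z \<le> norm x"
    using norm_fst_le[of y1 "(y2, z)"] norm_snd_le[of "(y2, z)" y1] norm_fst_le[of y2 z] norm_snd_le[of z y2]
    unfolding x by auto
  have sq: "(norm x)\<^sup>2 \<le> m"
    using n mult_right_mono[of "norm x" 1 "norm x"] by (auto simp: power2_eq_square)
  have sq1: "y1\<^sup>2 \<le> (norm x)\<^sup>2" "(cmod z)\<^sup>2 \<le> (norm x)\<^sup>2"
    using power_mono[OF le(1), of 2] power_mono[OF le(3), of 2] by auto
  then have sqm: "y1\<^sup>2 \<le> m" "(cmod z)\<^sup>2 \<le> m" using sq by linarith+
  \<comment> \<open>\<open>b\<close> bounds all four functions; the remainder collects four such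
    terms, whence the constant 8.\<close>
  define b where "b = 2 * K * (norm x)\<^sup>2"
  have b0: "0 \<le> b" using K_pos by (simp add: b_def)
  have b: "\<bar>\<phi> j (y1\<^sup>2) ((cmod z)\<^sup>2)\<bar> \<le> b" if "j \<in> {1..4}" for j
  proof -
    have "\<bar>\<phi> j (y1\<^sup>2) ((cmod z)\<^sup>2)\<bar> \<le> K * (\<bar>y1\<^sup>2\<bar> + \<bar>(cmod z)\<^sup>2\<bar>)"
      using sqm by (intro \<phi>_small that) simp_all
    also have "\<bar>y1\<^sup>2\<bar> + \<bar>(cmod z)\<^sup>2\<bar> \<le> 2 * (norm x)\<^sup>2" unfolding abs_power2 using sq1 by linarith
    finally show ?thesis using K_pos by (simp add: b_def mult_left_mono)
  qed
  let ?\<phi> = "\<lambda>j. \<phi> j (y1\<^sup>2) ((cmod z)\<^sup>2)"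
  have prod_le: "\<bar>?\<phi> j * y\<bar> \<le> b * norm x" if "j \<in> {1..4}" "\<bar>y\<bar> \<le> norm x" for j y
  proof -
    have "\<bar>?\<phi> j * y\<bar> = \<bar>?\<phi> j\<bar> * \<bar>y\<bar>" by (rule abs_mult)
    also have "\<dots> \<le> b * norm x" by (rule mult_mono[OF b[OF that(1)] that(2) b0]) simp
    finally show ?thesis .
  qed
  have z0: "nf_field \<phi> \<alpha>1 \<alpha>2 \<mu> 0 = 0" by (simp add: nf_field_def zero_prod_def)
  have rem: "nf_field \<phi> \<alpha>1 \<alpha>2 \<mu> x - nf_field \<phi> \<alpha>1 \<alpha>2 \<mu> 0 - nf_linearization \<alpha>1 \<alpha>2 \<mu> (x - 0)
      = (0, ?\<phi> 1 * y1 + ?\<phi> 2 * y2, Complex (?\<phi> 3) (?\<phi> 4) * z)"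
    unfolding z0 by (simp add: x nf_field_def nf_linearization_def Let_def complex_eq_iff algebra_simps)
  have "norm (0 :: real, ?\<phi> 1 * y1 + ?\<phi> 2 * y2, Complex (?\<phi> 3) (?\<phi> 4) * z)
      \<le> \<bar>?\<phi> 1 * y1 + ?\<phi> 2 * y2\<bar> + cmod (Complex (?\<phi> 3) (?\<phi> 4)) * cmod z"
    using norm_Pair_le[of "?\<phi> 1 * y1 + ?\<phi> 2 * y2" "Complex (?\<phi> 3) (?\<phi> 4) * z"]
    by (simp add: norm_Pair norm_mult)
  also have "\<dots> \<le> (b * norm x + b * norm x) + (2 * b) * norm x"
  proof (rule add_mono)
    have "\<bar>?\<phi> 1 * y1 + ?\<phi> 2 * y2\<bar> \<le> \<bar>?\<phi> 1 * y1\<bar> + \<bar>?\<phi> 2 * y2\<bar>"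
      by (rule abs_triangle_ineq)
    also have "\<dots> \<le> b * norm x + b * norm x"
      by (intro add_mono prod_le le) simp_all
    finally show "\<bar>?\<phi> 1 * y1 + ?\<phi> 2 * y2\<bar> \<le> b * norm x + b * norm x" .
    have "cmod (Complex (?\<phi> 3) (?\<phi> 4)) \<le> 2 * b"
      using cmod_le[of "Complex (?\<phi> 3) (?\<phi> 4)"] b[of 3] b[of 4] by simp
    then show "cmod (Complex (?\<phi> 3) (?\<phi> 4)) * cmod z \<le> 2 * b * norm x"
      using le b0 by (intro mult_mono) auto
  qed
  also have "\<dots> = 8 * K * (norm x)\<^sup>2 * norm x" by (simp add: b_def)
  finally have "norm (nf_field \<phi> \<alpha>1 \<alpha>2 \<mu> x - nf_field \<phi> \<alpha>1 \<alpha>2 \<mu> 0 - nf_linearization \<alpha>1 \<alpha>2 \<mu> (x - 0))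
      \<le> 8 * K * (norm x)\<^sup>2 * norm x"
    unfolding rem .
  moreover assume "x \<noteq> 0"
  ultimately show "norm (nf_field \<phi> \<alpha>1 \<alpha>2 \<mu> x - nf_field \<phi> \<alpha>1 \<alpha>2 \<mu> 0 - nf_linearization \<alpha>1 \<alpha>2 \<mu> (x - 0)) / norm (x - 0)
      \<le> 8 * K * (norm x)\<^sup>2"
    by (simp add: pos_divide_le_eq)
qed

lemma hopf_crossing_nf_field:
  assumes "\<alpha>1 \<noteq> 0" "\<alpha>2 \<noteq> 0"
  shows "hopf_crossing (nf_field \<phi> \<alpha>1 \<alpha>2) 1"
proof -
  have "((\<lambda>\<mu>. Complex \<mu> 1) has_vector_derivative 1) (at 0)"
    unfolding has_vector_derivative_complex_iff by (auto intro!: derivative_eq_intros)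
  moreover have "nf_field \<phi> \<alpha>1 \<alpha>2 \<mu> 0 = 0" for \<mu> by (simp add: nf_field_def zero_prod_def)
  ultimately show ?thesis
    unfolding hopf_crossing_def
    using nf_field_has_derivative_at_0 nf_linearization_spectrum[OF assms]
    by (intro conjI exI[of _ "nf_linearization \<alpha>1 \<alpha>2"] exI[of _ "\<lambda>\<mu>. Complex \<mu> 1"] exI[of _ 1]) auto
qed

end

section \<open>The bifurcation\<close>

context hopf_normal_form
begin

section \<open>The amplitude of the cycle as a function of \<open>\<alpha>3\<close>\<close>

lemma root_unique:
  assumes "0 < R" "R\<^sup>2 \<le> m" "0 < S" "S\<^sup>2 \<le> m"
    and "\<alpha> + \<phi> 3 0 (R\<^sup>2) = 0" "\<alpha> + \<phi> 3 0 (S\<^sup>2) = 0"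
  shows "R = S"
proof -
  have eq: "\<phi> 3 0 (R\<^sup>2) - \<phi> 3 0 (S\<^sup>2) = 0" using assms(5,6) by linarith
  have "k\<^sup>2 / 2 * (R\<^sup>2 - S\<^sup>2)\<^sup>2 \<le> k\<^sup>2 / 2 * 0"
    using \<phi>3_monotone[of "R\<^sup>2" "S\<^sup>2"] assms(2,4) unfolding eq by simp
  moreover have "0 < k\<^sup>2 / 2" using k_nonzero by simp
  ultimately have "(R\<^sup>2 - S\<^sup>2)\<^sup>2 \<le> 0" by (simp only: mult_le_cancel_left_pos)
  then have "R\<^sup>2 = S\<^sup>2" by simp
  then show ?thesis using assms(1,3) by (simp add: power2_eq_iff_nonneg)
qed

text \<open>Comparing the root with \<open>v = 0\<close> shows that \<phi>_3 at the root has the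
  sign of \<open>k\<close>, and \<open>\<alpha>\<close> is its negative.\<close>

lemma root_imp_sign:
  assumes "0 < R" "R\<^sup>2 \<le> m" "\<alpha> + \<phi> 3 0 (R\<^sup>2) = 0"
  shows "\<alpha> * k < 0"
proof -
  have "k\<^sup>2 / 2 * (R\<^sup>2)\<^sup>2 \<le> k * \<phi> 3 0 (R\<^sup>2) * R\<^sup>2"
    using \<phi>3_monotone[of "R\<^sup>2" 0] assms m_pos \<phi>_zero[of 3] by simp
  moreover have "\<phi> 3 0 (R\<^sup>2) = - \<alpha>" using assms(3) by linarith
  moreover have "0 < k\<^sup>2 / 2 * (R\<^sup>2)\<^sup>2" using assms(1) k_nonzero by simp
  ultimately have "(\<alpha> * k) * R\<^sup>2 < 0" by (simp add: mult_ac)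
  then show ?thesis unfolding mult_less_0_iff[of "\<alpha> * k" "R\<^sup>2"] by simp
qed

text \<open>The intermediate value theorem is applied to \<open>k * \<phi> 3 0 v\<close>, which
  grows for either sign of \<open>k\<close>; slope at least |k|/2 makes it reach the required value
  before \<open>v = m\<close> and also yields the a priori bound on \<open>R\<close>.\<close>

lemma root_exists:
  assumes "\<alpha> * k < 0" "\<bar>\<alpha>\<bar> < \<bar>k\<bar> * m / 2"
  shows "\<exists>R>0. R\<^sup>2 \<le> m \<and> \<alpha> + \<phi> 3 0 (R\<^sup>2) = 0 \<and> \<bar>k\<bar> * R\<^sup>2 \<le> 2 * \<bar>\<alpha>\<bar>"
proof -
  have ak: "- (k * \<alpha>) = \<bar>k\<bar> * \<bar>\<alpha>\<bar>" using assms(1) by (simp add: abs_mult[symmetric] mult.commute)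
  have "continuous_on {0..m} (\<lambda>v. k * \<phi> 3 0 v)"
  proof -
    have "continuous_on {0..m} (\<lambda>v. (0, v))" by (intro continuous_intros)
    from continuous_on_compose2[OF \<phi>_continuous[of 3] this] in_domain m_pos
    have "continuous_on {0..m} (\<lambda>v. \<phi> 3 0 v)" by (auto simp: image_subset_iff)
    then show ?thesis by (intro continuous_intros)
  qed
  moreover have "k * \<phi> 3 0 0 \<le> - (k * \<alpha>)" using \<phi>_zero[of 3] ak by simp
  moreover have "- (k * \<alpha>) \<le> k * \<phi> 3 0 m"
  proof -
    have "m * (k\<^sup>2 / 2 * m) \<le> m * (k * \<phi> 3 0 m)"
      using \<phi>3_monotone[of m 0] m_pos \<phi>_zero[of 3] by (simp add: power2_eq_square mult_ac)
    then have "k\<^sup>2 / 2 * m \<le> k * \<phi> 3 0 m" using m_pos by simp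
    moreover have "\<bar>k\<bar> * \<bar>\<alpha>\<bar> \<le> \<bar>k\<bar> * (\<bar>k\<bar> * m / 2)" using assms(2) by (intro mult_left_mono) auto
    moreover have "\<bar>k\<bar> * (\<bar>k\<bar> * m / 2) = k\<^sup>2 / 2 * m" by (simp add: power2_eq_square)
    ultimately show ?thesis using ak by linarith
  qed
  ultimately obtain v where v: "0 \<le> v" "v \<le> m" "k * \<phi> 3 0 v = - (k * \<alpha>)"
    using IVT'[of "\<lambda>v. k * \<phi> 3 0 v" 0 "- (k * \<alpha>)" m] m_pos by auto
  have "k * (\<phi> 3 0 v + \<alpha>) = 0" using v(3) by (simp add: distrib_left)
  then have root: "\<alpha> + \<phi> 3 0 v = 0" using k_nonzero by simp
  have "v \<noteq> 0" using root \<phi>_zero[of 3] assms(1) by auto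
  then have "0 < v" using v(1) by simp
  have "k\<^sup>2 / 2 * v\<^sup>2 \<le> k * \<phi> 3 0 v * v" using \<phi>3_monotone[of v 0] v m_pos \<phi>_zero[of 3] by simp
  then have "(\<bar>k\<bar> * v / 2) * (\<bar>k\<bar> * v) \<le> (\<bar>\<alpha>\<bar>) * (\<bar>k\<bar> * v)"
    unfolding v(3) ak by (simp add: power2_eq_square mult_ac)
  then have "\<bar>k\<bar> * v / 2 \<le> \<bar>\<alpha>\<bar>"
    using \<open>0 < v\<close> k_nonzero by (simp add: mult_le_cancel_right)
  then show ?thesis using \<open>0 < v\<close> v root by (intro exI[of _ "sqrt v"]) auto
qed

text \<open>With v = R^2 and w = -\<alpha>/k, the expansion gives v - w = O(\<alpha>^2). Passing to
  square roots divides by R + sqrt w, which is at least of order |\<alpha>|^(1/2); this explains the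
  exponent 3/2.\<close>

lemma root_asymptotics:
  assumes R: "0 < R" "R\<^sup>2 \<le> m" "\<alpha> + \<phi> 3 0 (R\<^sup>2) = 0" "\<bar>k\<bar> * R\<^sup>2 \<le> 2 * \<bar>\<alpha>\<bar>"
    and \<alpha>: "\<alpha> * k < 0"
  shows "\<bar>R - sqrt (- \<alpha> / k)\<bar> \<le> 4 * K * sqrt \<bar>k\<bar> / \<bar>k\<bar> ^ 3 * \<bar>\<alpha>\<bar> powr (3 / 2)"
proof -
  define v where "v = R\<^sup>2"
  define w where "w = - \<alpha> / k"
  define x where "x = \<bar>\<alpha>\<bar>"
  define \<kappa> where "\<kappa> = \<bar>k\<bar>"
  have pos: "0 < x" "0 < \<kappa>" using \<alpha> by (auto simp: x_def \<kappa>_def)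
  have w: "w = x / \<kappa>" "0 < w"
    using \<alpha> by (auto simp: w_def x_def \<kappa>_def abs_if mult_less_0_iff zero_less_mult_iff field_simps)
  have v: "v \<le> 2 * x / \<kappa>" "0 \<le> v"
    using R(4) pos by (auto simp: v_def x_def \<kappa>_def field_simps)
  have "\<bar>\<phi> 3 0 v - k * v\<bar> \<le> K * v\<^sup>2"
    using \<phi>3_expansion[of v] R(2) by (simp add: v_def)
  also have "\<phi> 3 0 v - k * v = k * (w - v)"
    using R(3) k_nonzero by (simp add: v_def w_def right_diff_distrib)
  finally have "\<kappa> * \<bar>v - w\<bar> \<le> K * v\<^sup>2"
    by (simp add: abs_mult \<kappa>_def abs_minus_commute)
  also have "\<dots> \<le> K * (2 * x / \<kappa>)\<^sup>2" using K_pos v by (intro mult_left_mono power_mono) auto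
  finally have vw: "\<bar>v - w\<bar> \<le> 4 * K * x\<^sup>2 / \<kappa> ^ 3"
    using pos by (simp add: field_simps power2_eq_square power3_eq_cube)
  have "R - sqrt w = (v - w) / (R + sqrt w)"
  proof -
    have "(R - sqrt w) * (R + sqrt w) = v - w"
      using w(2) by (simp add: v_def power2_eq_square algebra_simps)
    moreover have "0 < R + sqrt w" using R(1) w(2) by (intro add_pos_pos) auto
    ultimately show ?thesis by (simp add: eq_divide_eq)
  qed
  then have "\<bar>R - sqrt w\<bar> = \<bar>v - w\<bar> / (R + sqrt w)" using R(1) w(2) by simp
  also have "\<dots> \<le> \<bar>v - w\<bar> / sqrt w"
    using R(1) w(2) by (intro divide_left_mono) (auto intro!: mult_pos_pos add_pos_pos)
  also have "\<dots> \<le> (4 * K * x\<^sup>2 / \<kappa> ^ 3) / sqrt w"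
    using vw w(2) by (intro divide_right_mono) auto
  also have "\<dots> = 4 * K * sqrt \<kappa> / \<kappa> ^ 3 * (x\<^sup>2 / sqrt x)"
    using pos by (simp add: w(1) real_sqrt_divide)
  also have "x\<^sup>2 / sqrt x = x powr (3 / 2)"
  proof -
    have "x\<^sup>2 = x powr 2" "sqrt x = x powr (1 / 2)" using pos by (auto simp: powr_half_sqrt)
    then show ?thesis by (simp add: powr_diff[symmetric])
  qed
  finally show ?thesis by (simp add: w_def x_def \<kappa>_def)
qed

text \<open>\<open>R\<close> and \<open>\<epsilon>0\<close> are given in advance and do not depend
  on \<open>\<alpha>1\<close>, \<open>\<alpha>2\<close>; \<open>\<delta>\<close> and
  \<open>\<epsilon>\<close> do, through the tolerance \<open>d\<close> of the planar form. The ball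
  of radius \<open>\<delta>\<close> then also serves as the isolating neighbourhood in the
  definition of a limit cycle.\<close>

lemma local_bifurcation:
  assumes \<alpha>: "\<alpha>1 \<noteq> 0" "\<alpha>2 \<noteq> 0" and "0 < \<epsilon>0"
    and R: "\<And>\<alpha>3. \<bar>\<alpha>3\<bar> < \<epsilon>0 \<Longrightarrow> \<alpha>3 * k < 0 \<Longrightarrow> 0 < R \<alpha>3 \<and> (R \<alpha>3)\<^sup>2 \<le> m \<and>
      \<alpha>3 + \<phi> 3 0 ((R \<alpha>3)\<^sup>2) = 0 \<and> \<bar>k\<bar> * (R \<alpha>3)\<^sup>2 \<le> 2 * \<bar>\<alpha>3\<bar>"
  shows "\<exists>\<epsilon>>0. \<exists>\<delta>>0. \<epsilon> \<le> \<epsilon>0 \<and> (\<forall>\<alpha>3. \<bar>\<alpha>3\<bar> < \<epsilon> \<longrightarrow>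
    {G. periodic_orbit (nf_trajectory U \<phi> \<alpha>1 \<alpha>2 \<alpha>3) G \<and> G \<subseteq> ball 0 \<delta>}
      = (if \<alpha>3 * k < 0 then {z_circle (R \<alpha>3)} else {}) \<and>
    (\<alpha>3 * k < 0 \<longrightarrow> limit_cycle (nf_trajectory U \<phi> \<alpha>1 \<alpha>2 \<alpha>3) (z_circle (R \<alpha>3)) \<and>
      (if k < 0 \<and> \<alpha>1 < 0 \<and> \<alpha>2 < 0
       then orbitally_asymptotically_stable (nf_trajectory U \<phi> \<alpha>1 \<alpha>2 \<alpha>3) (z_circle (R \<alpha>3))
       else \<not> orbitally_stable (nf_trajectory U \<phi> \<alpha>1 \<alpha>2 \<alpha>3) (z_circle (R \<alpha>3)))))"
proof -
  obtain A B C \<eta> d where \<eta>: "0 < \<eta>" and d: "0 < d"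
    and form: "robustly_increasing_form \<alpha>1 \<alpha>2 d \<eta> A B C"
    and neg: "\<And>x y. \<alpha>1 < 0 \<Longrightarrow> \<alpha>2 < 0 \<Longrightarrow> \<eta> * (x\<^sup>2 + y\<^sup>2) \<le> - (A * x\<^sup>2 + B * (x * y) + C * y\<^sup>2)"
    and unst: "\<not> (\<alpha>1 < 0 \<and> \<alpha>2 < 0) \<Longrightarrow> \<exists>x y. 0 < A * x\<^sup>2 + B * (x * y) + C * y\<^sup>2"
    using robustly_increasing_form_exists[OF \<alpha>] by metis
  \<comment> \<open>\<open>\<rho>\<close> is the square of \<open>\<delta>\<close>; its three bounds
    are the three upper bounds on \<open>\<delta>\<close> required for classifying small periodic
    orbits.\<close>
  define \<rho> where "\<rho> = min m (min (d / (2 * K)) (1 / (2 * K)))"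
  define \<delta> where "\<delta> = sqrt \<rho>"
  have "0 < \<rho>" using m_pos d K_pos by (simp add: \<rho>_def)
  then have \<delta>2: "0 < \<delta>" "\<delta>\<^sup>2 = \<rho>" by (auto simp: \<delta>_def)
  have \<delta>: "0 < \<delta>" "\<delta>\<^sup>2 \<le> m" "2 * (K * \<delta>\<^sup>2) \<le> d" "2 * (K * \<delta>\<^sup>2) \<le> 1"
  proof -
    have "\<rho> \<le> d / (2 * K)" "\<rho> \<le> 1 / (2 * K)" by (auto simp: \<rho>_def)
    then show "2 * (K * \<delta>\<^sup>2) \<le> d" "2 * (K * \<delta>\<^sup>2) \<le> 1"
      unfolding \<delta>2(2) using K_pos by (auto simp: pos_le_divide_eq mult_ac)
  qed (use \<delta>2 in \<open>auto simp: \<rho>_def\<close>)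
  \<comment> \<open>An upper bound for the squared radius: \<open>\<rho>\<close> places the cycle in
    the ball, \<open>m / 4\<close> and \<open>d / (5 * K)\<close> meet the conditions for the growth
    of the cycle form. The choice of \<open>\<epsilon>\<close> inverts \<open>\<bar>k\<bar> * (R
    \<alpha>3)\<^sup>2 \<le> 2 * \<bar>\<alpha>3\<bar>\<close>.\<close>
  define \<beta> where "\<beta> = min \<rho> (min (m / 4) (d / (5 * K)))"
  have \<beta>: "0 < \<beta>" using \<open>0 < \<rho>\<close> m_pos d K_pos by (simp add: \<beta>_def)
  define \<epsilon> where "\<epsilon> = min \<epsilon>0 (\<bar>k\<bar> * \<beta> / 2)"
  have \<epsilon>: "0 < \<epsilon>" "\<epsilon> \<le> \<epsilon>0" using assms(3) \<beta> k_nonzero by (auto simp: \<epsilon>_def)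
  have small: "R \<alpha>3 < \<delta> \<and> 4 * (R \<alpha>3)\<^sup>2 \<le> m \<and> 5 * (K * (R \<alpha>3)\<^sup>2) \<le> d"
    if "\<bar>\<alpha>3\<bar> < \<epsilon>" "\<alpha>3 * k < 0" for \<alpha>3
  proof -
    have "\<bar>k\<bar> * (R \<alpha>3)\<^sup>2 \<le> 2 * \<bar>\<alpha>3\<bar>" using R[of \<alpha>3] that \<epsilon> by simp
    moreover have "2 * \<bar>\<alpha>3\<bar> < \<bar>k\<bar> * \<beta>" using that(1) by (simp add: \<epsilon>_def)
    ultimately have "\<bar>k\<bar> * (R \<alpha>3)\<^sup>2 < \<bar>k\<bar> * \<beta>" by linarith
    then have lt: "(R \<alpha>3)\<^sup>2 < \<beta>" using k_nonzero by (simp add: mult_less_cancel_left)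
    then have "(R \<alpha>3)\<^sup>2 < \<delta>\<^sup>2" by (simp add: \<delta>2(2) \<beta>_def)
    then have "R \<alpha>3 < \<delta>" by (rule power2_less_imp_less) (use \<delta>(1) in simp)
    moreover have "(R \<alpha>3)\<^sup>2 \<le> m / 4" "(R \<alpha>3)\<^sup>2 \<le> d / (5 * K)" using lt by (auto simp: \<beta>_def)
    ultimately show ?thesis using K_pos by (auto simp: pos_le_divide_eq mult_ac)
  qed
  have orbits: "{G. periodic_orbit (nf_trajectory U \<phi> \<alpha>1 \<alpha>2 \<alpha>3) G \<and> G \<subseteq> ball 0 \<delta>}
      = (if \<alpha>3 * k < 0 then {z_circle (R \<alpha>3)} else {})" if a: "\<bar>\<alpha>3\<bar> < \<epsilon>" for \<alpha>3
  proof -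
    have m_ge: "S\<^sup>2 \<le> m" if "0 < S" "S < \<delta>" for S
    proof -
      have "S\<^sup>2 \<le> \<delta>\<^sup>2" using that by (intro power_mono) auto
      then show ?thesis using \<delta>(2) by linarith
    qed
    show ?thesis
    proof (cases "\<alpha>3 * k < 0")
      case True
      have r: "0 < R \<alpha>3" "(R \<alpha>3)\<^sup>2 \<le> m" "\<alpha>3 + \<phi> 3 0 ((R \<alpha>3)\<^sup>2) = 0" "R \<alpha>3 < \<delta>"
        using R[of \<alpha>3] small[OF a True] a \<epsilon> True by auto
      have "S = R \<alpha>3" if "0 < S" "S < \<delta>" "\<alpha>3 + \<phi> 3 0 (S\<^sup>2) = 0" for S
        using root_unique[OF that(1) m_ge[OF that(1,2)] r(1,2) that(3) r(3)] .
      then have "(\<exists>S. 0 < S \<and> S < \<delta> \<and> \<alpha>3 + \<phi> 3 0 (S\<^sup>2) = 0 \<and> G = z_circle S) \<longleftrightarrow> G = z_circle (R \<alpha>3)" for G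
        using r by blast
      then show ?thesis unfolding small_periodic_orbit_iff[OF \<eta> form \<delta>] using True by simp
    next
      case False
      then have "\<not> (\<exists>S. 0 < S \<and> S < \<delta> \<and> \<alpha>3 + \<phi> 3 0 (S\<^sup>2) = 0 \<and> G = z_circle S)" for G
        using root_imp_sign m_ge by blast
      then show ?thesis unfolding small_periodic_orbit_iff[OF \<eta> form \<delta>] using False by simp
    qed
  qed
  have cycle: "limit_cycle (nf_trajectory U \<phi> \<alpha>1 \<alpha>2 \<alpha>3) (z_circle (R \<alpha>3))"
    if "\<bar>\<alpha>3\<bar> < \<epsilon>" "\<alpha>3 * k < 0" for \<alpha>3
  proof -
    have "{G. periodic_orbit (nf_trajectory U \<phi> \<alpha>1 \<alpha>2 \<alpha>3) G \<and> G \<subseteq> ball 0 \<delta>} = {z_circle (R \<alpha>3)}"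
      using orbits[OF that(1)] that(2) by simp
    then show ?thesis
      unfolding limit_cycle_def by (intro conjI exI[of _ "ball 0 \<delta>"]) blast+
  qed
  have stab: "if k < 0 \<and> \<alpha>1 < 0 \<and> \<alpha>2 < 0
       then orbitally_asymptotically_stable (nf_trajectory U \<phi> \<alpha>1 \<alpha>2 \<alpha>3) (z_circle (R \<alpha>3))
       else \<not> orbitally_stable (nf_trajectory U \<phi> \<alpha>1 \<alpha>2 \<alpha>3) (z_circle (R \<alpha>3))"
    if "\<bar>\<alpha>3\<bar> < \<epsilon>" "\<alpha>3 * k < 0" for \<alpha>3
  proof -
    have r: "0 < R \<alpha>3" "4 * (R \<alpha>3)\<^sup>2 \<le> m" "5 * (K * (R \<alpha>3)\<^sup>2) \<le> d" "\<alpha>3 + \<phi> 3 0 ((R \<alpha>3)\<^sup>2) = 0"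
      using R[of \<alpha>3] small[OF that] that \<epsilon> by auto
    show ?thesis
    proof (cases "k < 0 \<and> \<alpha>1 < 0 \<and> \<alpha>2 < 0")
      case True
      then show ?thesis
        using z_circle_orbitally_asymptotically_stable[OF \<eta> form r] neg by simp
    next
      case False
      then have "0 < k \<or> (\<exists>x y. 0 < A * x\<^sup>2 + B * (x * y) + C * y\<^sup>2)"
        using unst k_nonzero by (cases "0 < k") auto
      then show ?thesis
        unfolding if_not_P[OF False] by (rule z_circle_not_orbitally_stable[OF \<eta> form r])
    qed
  qed
  show ?thesis using \<epsilon> \<delta>(1) orbits cycle stab by blast
qed

text \<open>The radial equation in the z-plane contains neither \<open>\<alpha>1\<close> nor
  \<open>\<alpha>2\<close>, which is why one radius function serves all of them and can be chosen
  before they are.\<close>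

lemma hopf_bifurcation:
  "\<exists>\<epsilon>0>0. \<exists>R :: real \<Rightarrow> real.
    (\<forall>\<alpha>3. \<bar>\<alpha>3\<bar> < \<epsilon>0 \<and> \<alpha>3 * k < 0 \<longrightarrow>
      0 < R \<alpha>3 \<and> 0 < 1 + \<phi> 4 0 ((R \<alpha>3)\<^sup>2) \<and>
      (\<forall>\<alpha>1 \<alpha>2 \<theta>0.
        let \<theta> = (\<lambda>t. \<theta>0 + (1 + \<phi> 4 0 ((R \<alpha>3)\<^sup>2)) * t) in
        nf_solution U \<phi> \<alpha>1 \<alpha>2 \<alpha>3 UNIV (\<lambda>_. 0) (\<lambda>_. 0) (\<lambda>_. R \<alpha>3) \<theta> \<and>
        periodic_solution (nf_trajectory U \<phi> \<alpha>1 \<alpha>2 \<alpha>3)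
          (2 * pi / (1 + \<phi> 4 0 ((R \<alpha>3)\<^sup>2))) (\<lambda>t. nf_point 0 0 (R \<alpha>3) (\<theta> t)))) \<and>
    (\<lambda>\<alpha>3. R \<alpha>3 - sqrt (- \<alpha>3 / k))
      \<in> O[at 0 within {\<alpha>3. \<alpha>3 * k < 0}](\<lambda>\<alpha>3. \<bar>\<alpha>3\<bar> powr (3 / 2)) \<and>
    ((\<lambda>\<alpha>3. 2 * pi / (1 + \<phi> 4 0 ((R \<alpha>3)\<^sup>2))) \<longlongrightarrow> 2 * pi)
      (at 0 within {\<alpha>3. \<alpha>3 * k < 0}) \<and>
    (\<forall>\<alpha>1 \<alpha>2. \<alpha>1 \<noteq> 0 \<and> \<alpha>2 \<noteq> 0 \<longrightarrow>
      hopf_crossing (nf_field \<phi> \<alpha>1 \<alpha>2) 1 \<and>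
      (\<exists>\<epsilon>>0. \<exists>\<delta>>0. \<epsilon> \<le> \<epsilon>0 \<and>
        (\<forall>\<alpha>3. \<bar>\<alpha>3\<bar> < \<epsilon> \<longrightarrow>
          (let traj = nf_trajectory U \<phi> \<alpha>1 \<alpha>2 \<alpha>3; \<Gamma> = z_circle (R \<alpha>3) in
            (k < 0 \<longrightarrow>
              {G. periodic_orbit traj G \<and> G \<subseteq> ball 0 \<delta>} = (if 0 < \<alpha>3 then {\<Gamma>} else {})) \<and>
            (0 < k \<longrightarrow>
              {G. periodic_orbit traj G \<and> G \<subseteq> ball 0 \<delta>} = (if \<alpha>3 < 0 then {\<Gamma>} else {})) \<and>
            (\<alpha>3 * k < 0 \<longrightarrow>
              limit_cycle traj \<Gamma> \<and>
              (if k < 0 \<and> \<alpha>1 < 0 \<and> \<alpha>2 < 0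
               then orbitally_asymptotically_stable traj \<Gamma>
               else \<not> orbitally_stable traj \<Gamma>))))))"
proof -
  \<comment> \<open>The first bound lets the amplitude equation be solved, the second keeps
    |\<phi>_4| below 1/2 on the cycle, so that the angular speed is positive.\<close>
  define \<epsilon>0 where "\<epsilon>0 = min (\<bar>k\<bar> * m / 2) (\<bar>k\<bar> / (4 * K))"
  have \<epsilon>0: "0 < \<epsilon>0" using m_pos K_pos k_nonzero by (simp add: \<epsilon>0_def)
  have "\<exists>R. \<bar>\<alpha>3\<bar> < \<epsilon>0 \<and> \<alpha>3 * k < 0 \<longrightarrow> 0 < R \<and> R\<^sup>2 \<le> m \<and>
      \<alpha>3 + \<phi> 3 0 (R\<^sup>2) = 0 \<and> \<bar>k\<bar> * R\<^sup>2 \<le> 2 * \<bar>\<alpha>3\<bar>" for \<alpha>3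
    using root_exists[of \<alpha>3] by (auto simp: \<epsilon>0_def)
  then obtain R where R: "\<And>\<alpha>3. \<bar>\<alpha>3\<bar> < \<epsilon>0 \<Longrightarrow> \<alpha>3 * k < 0 \<Longrightarrow> 0 < R \<alpha>3 \<and> (R \<alpha>3)\<^sup>2 \<le> m \<and>
      \<alpha>3 + \<phi> 3 0 ((R \<alpha>3)\<^sup>2) = 0 \<and> \<bar>k\<bar> * (R \<alpha>3)\<^sup>2 \<le> 2 * \<bar>\<alpha>3\<bar>"
    by metis
  let ?F = "at 0 within {\<alpha>3. \<alpha>3 * k < 0}"
  have ev: "\<forall>\<^sub>F \<alpha>3 in ?F. \<bar>\<alpha>3\<bar> < \<epsilon>0 \<and> \<alpha>3 * k < 0"
    unfolding eventually_at using \<epsilon>0 by (intro exI[of _ \<epsilon>0]) (auto simp: dist_real_def)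
  have \<phi>4: "\<bar>\<phi> 4 0 ((R \<alpha>3)\<^sup>2)\<bar> \<le> 2 * K / \<bar>k\<bar> * \<bar>\<alpha>3\<bar>" if "\<bar>\<alpha>3\<bar> < \<epsilon>0" "\<alpha>3 * k < 0" for \<alpha>3
  proof -
    have "\<bar>\<phi> 4 0 ((R \<alpha>3)\<^sup>2)\<bar> \<le> K * (R \<alpha>3)\<^sup>2"
      using \<phi>_small[of 4 0 "(R \<alpha>3)\<^sup>2"] R[OF that] m_pos by simp
    also have "\<dots> \<le> K * (2 * \<bar>\<alpha>3\<bar> / \<bar>k\<bar>)"
      using R[OF that] K_pos k_nonzero by (intro mult_left_mono) (auto simp: pos_le_divide_eq mult.commute)
    finally show ?thesis by (simp add: mult_ac)
  qed
  have freq: "0 < 1 + \<phi> 4 0 ((R \<alpha>3)\<^sup>2)" if "\<bar>\<alpha>3\<bar> < \<epsilon>0" "\<alpha>3 * k < 0" for \<alpha>3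
  proof -
    have "\<bar>\<alpha>3\<bar> < \<bar>k\<bar> / (4 * K)" using that by (simp add: \<epsilon>0_def)
    then have "2 * K / \<bar>k\<bar> * \<bar>\<alpha>3\<bar> < 2 * K / \<bar>k\<bar> * (\<bar>k\<bar> / (4 * K))"
      using K_pos k_nonzero by (intro mult_strict_left_mono) auto
    also have "\<dots> = 1 / 2" using K_pos k_nonzero by simp
    finally show ?thesis using \<phi>4[OF that] by linarith
  qed
  have periodic: "let \<theta> = (\<lambda>t. \<theta>0 + (1 + \<phi> 4 0 ((R \<alpha>3)\<^sup>2)) * t) in
        nf_solution U \<phi> \<alpha>1 \<alpha>2 \<alpha>3 UNIV (\<lambda>_. 0) (\<lambda>_. 0) (\<lambda>_. R \<alpha>3) \<theta> \<and>
        periodic_solution (nf_trajectory U \<phi> \<alpha>1 \<alpha>2 \<alpha>3)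
          (2 * pi / (1 + \<phi> 4 0 ((R \<alpha>3)\<^sup>2))) (\<lambda>t. nf_point 0 0 (R \<alpha>3) (\<theta> t))"
    if "\<bar>\<alpha>3\<bar> < \<epsilon>0" "\<alpha>3 * k < 0" for \<alpha>1 \<alpha>2 \<alpha>3 \<theta>0
  proof -
    have r: "0 < R \<alpha>3" "(0, (R \<alpha>3)\<^sup>2) \<in> U" "\<alpha>3 + \<phi> 3 0 ((R \<alpha>3)\<^sup>2) = 0"
      using R[OF that] m_pos by (auto intro!: in_domain)
    show ?thesis
      unfolding Let_def using z_circle_periodic_solution(1,2)[where U = U and \<phi> = \<phi> and R = "R \<alpha>3"
          and ?\<alpha>3.0 = \<alpha>3 and ?\<alpha>1.0 = \<alpha>1 and ?\<alpha>2.0 = \<alpha>2 and ?\<theta>0.0 = \<theta>0,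
          OF r refl freq[OF that]] by simp
  qed
  have asym: "(\<lambda>\<alpha>3. R \<alpha>3 - sqrt (- \<alpha>3 / k)) \<in> O[?F](\<lambda>\<alpha>3. \<bar>\<alpha>3\<bar> powr (3 / 2))"
  proof (rule bigoI)
    show "\<forall>\<^sub>F \<alpha>3 in ?F. norm (R \<alpha>3 - sqrt (- \<alpha>3 / k))
        \<le> (4 * K * sqrt \<bar>k\<bar> / \<bar>k\<bar> ^ 3) * norm (\<bar>\<alpha>3\<bar> powr (3 / 2))"
      using ev
    proof eventually_elim
      case (elim \<alpha>3)
      then show ?case using root_asymptotics[of "R \<alpha>3" \<alpha>3] R[of \<alpha>3] by simp
    qed
  qed
  have lim: "((\<lambda>\<alpha>3. 2 * pi / (1 + \<phi> 4 0 ((R \<alpha>3)\<^sup>2))) \<longlongrightarrow> 2 * pi) ?F"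
  proof -
    have "((\<lambda>\<alpha>3. \<bar>\<alpha>3\<bar>) \<longlongrightarrow> \<bar>0\<bar>) ?F" by (intro tendsto_intros)
    then have "((\<lambda>\<alpha>3. 2 * K / \<bar>k\<bar> * \<bar>\<alpha>3\<bar>) \<longlongrightarrow> 2 * K / \<bar>k\<bar> * \<bar>0\<bar>) ?F" by (intro tendsto_mult tendsto_const)
    then have "((\<lambda>\<alpha>3. 2 * K / \<bar>k\<bar> * \<bar>\<alpha>3\<bar>) \<longlongrightarrow> 0) ?F" by simp
    then have "((\<lambda>\<alpha>3. \<phi> 4 0 ((R \<alpha>3)\<^sup>2)) \<longlongrightarrow> 0) ?F"
      by (rule Lim_null_comparison[rotated])
        (rule eventually_mono[OF ev], unfold real_norm_def, rule \<phi>4, auto)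
    then have "((\<lambda>\<alpha>3. 2 * pi / (1 + \<phi> 4 0 ((R \<alpha>3)\<^sup>2))) \<longlongrightarrow> 2 * pi / (1 + 0)) ?F"
      by (intro tendsto_intros) auto
    then show ?thesis by simp
  qed
  have local: "hopf_crossing (nf_field \<phi> \<alpha>1 \<alpha>2) 1 \<and>
      (\<exists>\<epsilon>>0. \<exists>\<delta>>0. \<epsilon> \<le> \<epsilon>0 \<and>
        (\<forall>\<alpha>3. \<bar>\<alpha>3\<bar> < \<epsilon> \<longrightarrow>
          (let traj = nf_trajectory U \<phi> \<alpha>1 \<alpha>2 \<alpha>3; \<Gamma> = z_circle (R \<alpha>3) in
            (k < 0 \<longrightarrow>
              {G. periodic_orbit traj G \<and> G \<subseteq> ball 0 \<delta>} = (if 0 < \<alpha>3 then {\<Gamma>} else {})) \<and>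
            (0 < k \<longrightarrow>
              {G. periodic_orbit traj G \<and> G \<subseteq> ball 0 \<delta>} = (if \<alpha>3 < 0 then {\<Gamma>} else {})) \<and>
            (\<alpha>3 * k < 0 \<longrightarrow>
              limit_cycle traj \<Gamma> \<and>
              (if k < 0 \<and> \<alpha>1 < 0 \<and> \<alpha>2 < 0
               then orbitally_asymptotically_stable traj \<Gamma>
               else \<not> orbitally_stable traj \<Gamma>)))))"
    if nz: "\<alpha>1 \<noteq> 0" "\<alpha>2 \<noteq> 0" for \<alpha>1 \<alpha>2
  proof
    show "hopf_crossing (nf_field \<phi> \<alpha>1 \<alpha>2) 1" by (rule hopf_crossing_nf_field[OF nz])
    have sgn_iff: "k < 0 \<Longrightarrow> \<alpha>3 * k < 0 \<longleftrightarrow> 0 < \<alpha>3" "0 < k \<Longrightarrow> \<alpha>3 * k < 0 \<longleftrightarrow> \<alpha>3 < 0" for \<alpha>3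
      by (auto simp: mult_less_0_iff)
    obtain \<epsilon> \<delta> where \<epsilon>\<delta>: "0 < \<epsilon>" "0 < \<delta>" "\<epsilon> \<le> \<epsilon>0"
      and orb: "\<And>\<alpha>3. \<bar>\<alpha>3\<bar> < \<epsilon> \<Longrightarrow>
        {G. periodic_orbit (nf_trajectory U \<phi> \<alpha>1 \<alpha>2 \<alpha>3) G \<and> G \<subseteq> ball 0 \<delta>}
          = (if \<alpha>3 * k < 0 then {z_circle (R \<alpha>3)} else {})"
      and lc: "\<And>\<alpha>3. \<bar>\<alpha>3\<bar> < \<epsilon> \<Longrightarrow> \<alpha>3 * k < 0 \<Longrightarrow>
        limit_cycle (nf_trajectory U \<phi> \<alpha>1 \<alpha>2 \<alpha>3) (z_circle (R \<alpha>3))"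
      and st: "\<And>\<alpha>3. \<bar>\<alpha>3\<bar> < \<epsilon> \<Longrightarrow> \<alpha>3 * k < 0 \<Longrightarrow>
        (if k < 0 \<and> \<alpha>1 < 0 \<and> \<alpha>2 < 0
         then orbitally_asymptotically_stable (nf_trajectory U \<phi> \<alpha>1 \<alpha>2 \<alpha>3) (z_circle (R \<alpha>3))
         else \<not> orbitally_stable (nf_trajectory U \<phi> \<alpha>1 \<alpha>2 \<alpha>3) (z_circle (R \<alpha>3)))"
      using local_bifurcation[where R = R, OF nz \<epsilon>0 R] by blast
    show "\<exists>\<epsilon>>0. \<exists>\<delta>>0. \<epsilon> \<le> \<epsilon>0 \<and>
        (\<forall>\<alpha>3. \<bar>\<alpha>3\<bar> < \<epsilon> \<longrightarrow>
          (let traj = nf_trajectory U \<phi> \<alpha>1 \<alpha>2 \<alpha>3; \<Gamma> = z_circle (R \<alpha>3) in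
            (k < 0 \<longrightarrow>
              {G. periodic_orbit traj G \<and> G \<subseteq> ball 0 \<delta>} = (if 0 < \<alpha>3 then {\<Gamma>} else {})) \<and>
            (0 < k \<longrightarrow>
              {G. periodic_orbit traj G \<and> G \<subseteq> ball 0 \<delta>} = (if \<alpha>3 < 0 then {\<Gamma>} else {})) \<and>
            (\<alpha>3 * k < 0 \<longrightarrow>
              limit_cycle traj \<Gamma> \<and>
              (if k < 0 \<and> \<alpha>1 < 0 \<and> \<alpha>2 < 0
               then orbitally_asymptotically_stable traj \<Gamma>
               else \<not> orbitally_stable traj \<Gamma>))))"
      unfolding Let_def
      by (rule exI[of _ \<epsilon>], rule conjI[OF \<epsilon>\<delta>(1)], rule exI[of _ \<delta>], intro conjI \<epsilon>\<delta>(2,3) allI impI)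
        (simp only: orb sgn_iff, simp only: orb sgn_iff, rule lc, assumption+, rule st, assumption+)
  qed
  show ?thesis
    using \<epsilon>0 R freq periodic asym lim local by (intro exI[of _ \<epsilon>0] exI[of _ R] conjI) blast+
qed

end

section \<open>From smooth functions with given Taylor coefficients to the locale\<close>

lemma square_in_open:
  assumes "open U" "(0, 0) \<in> U"
  obtains m where "0 < m" "square m \<subseteq> U"
proof -
  obtain e where e: "0 < e" "ball (0, 0) e \<subseteq> U" using assms by (meson open_contains_ball)
  have "square (e / 4) \<subseteq> ball (0, 0) e"
  proof safe
    fix u v assume "(u, v) \<in> square (e / 4)"
    then have "\<bar>u\<bar> \<le> e / 4" "\<bar>v\<bar> \<le> e / 4" by (auto simp: mem_square_iff)
    then have "norm (u, v) < e" using norm_Pair_le[of u v] e(1) by simp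
    then show "(u, v) \<in> ball (0, 0) e" by (simp flip: zero_prod_def)
  qed
  then show thesis using that[of "e / 4"] e by auto
qed

lemma hopf_normal_form_exists:
  assumes "open U" "(0, 0) \<in> U"
    and \<phi>: "\<And>j. j \<in> {1..4} \<Longrightarrow> smooth_with_taylor U (\<phi> j) (c j)"
    and c0: "\<And>j. j \<in> {1..4} \<Longrightarrow> c j 0 0 = 0"
    and nz: "c 3 0 1 \<noteq> 0"
  obtains m K where "hopf_normal_form U \<phi> (c 3 0 1) m K"
proof -
  obtain m0 where m0: "0 < m0" "square m0 \<subseteq> U" using square_in_open assms(1,2) .
  have "\<exists>K>0. (\<forall>u v u' v'. (u, v) \<in> square m0 \<longrightarrow> (u', v') \<in> square m0 \<longrightarrow>
      \<bar>\<phi> j u v - \<phi> j u' v'\<bar> \<le> K * (\<bar>u - u'\<bar> + \<bar>v - v'\<bar>)) \<and> \<phi> j 0 0 = 0" if "j \<in> {1..4}" for j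
    by (rule smooth_with_taylor_on_square[OF \<phi>[OF that] m0(2,1)]) (use c0[OF that] in auto)
  then obtain L where L: "\<And>j. j \<in> {1..4} \<Longrightarrow> 0 < L j"
    "\<And>j u v u' v'. j \<in> {1..4} \<Longrightarrow> (u, v) \<in> square m0 \<Longrightarrow> (u', v') \<in> square m0 \<Longrightarrow>
      \<bar>\<phi> j u v - \<phi> j u' v'\<bar> \<le> L j * (\<bar>u - u'\<bar> + \<bar>v - v'\<bar>)"
    and \<phi>0: "\<And>j. j \<in> {1..4} \<Longrightarrow> \<phi> j 0 0 = 0"
    by metis
  obtain K3 where K3: "0 < K3"
    "\<And>v. \<bar>v\<bar> \<le> m0 \<Longrightarrow> \<bar>\<phi> 3 0 v - c 3 0 0 - c 3 0 1 * v\<bar> \<le> K3 * v\<^sup>2"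
    "\<And>v v'. \<bar>v\<bar> \<le> m0 \<Longrightarrow> \<bar>v'\<bar> \<le> m0 \<Longrightarrow> K3 * \<bar>v\<bar> \<le> \<bar>c 3 0 1\<bar> / 2 \<Longrightarrow> K3 * \<bar>v'\<bar> \<le> \<bar>c 3 0 1\<bar> / 2 \<Longrightarrow>
      (c 3 0 1)\<^sup>2 / 2 * (v - v')\<^sup>2 \<le> c 3 0 1 * (\<phi> 3 0 v - \<phi> 3 0 v') * (v - v')"
    by (rule smooth_with_taylor_on_square[OF \<phi>[of 3] m0(2,1)]) auto
  \<comment> \<open>One constant for all estimates: the Lipschitz constants of the four functions
    and the remainder constant of \<phi>_3.\<close>
  define K where "K = K3 + (\<Sum>j\<in>{1..4}. L j)"
  have L_le: "L j \<le> K" if "j \<in> {1..4}" for j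
  proof -
    have "L j \<le> (\<Sum>j\<in>{1..4}. L j)"
      using L(1) that by (intro member_le_sum) (auto intro: less_imp_le)
    then show ?thesis using K3(1) by (simp add: K_def)
  qed
  have "0 \<le> (\<Sum>j\<in>{1..4}. L j)" by (intro sum_nonneg less_imp_le L(1))
  then have K3_le: "K3 \<le> K" by (simp add: K_def)
  \<comment> \<open>Shrinking the square keeps the derivative of \<phi>_3(0, .) within half of its
    nonzero value at the origin.\<close>
  define m where "m = min m0 (\<bar>c 3 0 1\<bar> / (2 * K3))"
  have m: "0 < m" "m \<le> m0" using m0 nz K3(1) by (auto simp: m_def)
  have sub: "square m \<subseteq> square m0" using m(2) by (auto simp: mem_square_iff)
  have small: "K3 * \<bar>v\<bar> \<le> \<bar>c 3 0 1\<bar> / 2" if "\<bar>v\<bar> \<le> m" for v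
  proof -
    have "\<bar>v\<bar> \<le> \<bar>c 3 0 1\<bar> / (2 * K3)" using that by (simp add: m_def)
    then show ?thesis using K3(1) by (simp add: field_simps)
  qed
  have "hopf_normal_form U \<phi> (c 3 0 1) m K"
  proof
    show "0 < K" using K3(1) K3_le by linarith
    show "continuous_on U (\<lambda>p. \<phi> j (fst p) (snd p))" if "j \<in> {1..4}" for j
      by (rule smooth_with_taylor_continuous_on[OF \<phi>[OF that]])
    show "\<bar>\<phi> j u v - \<phi> j u' v'\<bar> \<le> K * (\<bar>u - u'\<bar> + \<bar>v - v'\<bar>)"
      if "j \<in> {1..4}" "(u, v) \<in> square m" "(u', v') \<in> square m" for j u v u' v'
    proof -
      have "\<bar>\<phi> j u v - \<phi> j u' v'\<bar> \<le> L j * (\<bar>u - u'\<bar> + \<bar>v - v'\<bar>)"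
        using that sub by (intro L(2)) auto
      also have "\<dots> \<le> K * (\<bar>u - u'\<bar> + \<bar>v - v'\<bar>)" using L_le[OF that(1)] by (intro mult_right_mono) auto
      finally show ?thesis .
    qed
    show "\<bar>\<phi> 3 0 v - c 3 0 1 * v\<bar> \<le> K * v\<^sup>2" if "\<bar>v\<bar> \<le> m" for v
    proof -
      have "\<bar>\<phi> 3 0 v - c 3 0 1 * v\<bar> \<le> K3 * v\<^sup>2" using K3(2)[of v] c0[of 3] that m(2) by simp
      also have "\<dots> \<le> K * v\<^sup>2" using K3_le by (intro mult_right_mono) auto
      finally show ?thesis .
    qed
    show "(c 3 0 1)\<^sup>2 / 2 * (v - v')\<^sup>2 \<le> c 3 0 1 * (\<phi> 3 0 v - \<phi> 3 0 v') * (v - v')"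
      if "\<bar>v\<bar> \<le> m" "\<bar>v'\<bar> \<le> m" for v v'
      using K3(3)[of v v'] small[OF that(1)] small[OF that(2)] that m(2) by simp
  qed (use m m0 sub nz \<phi>0 in auto)
  then show thesis by (rule that)
qed

theorem mainTheorem3:
  fixes U :: "(real \<times> real) set"
    and \<phi> :: "nat \<Rightarrow> real \<Rightarrow> real \<Rightarrow> real"
    and c :: "nat \<Rightarrow> nat \<Rightarrow> nat \<Rightarrow> real"
  assumes "open U" and "(0, 0) \<in> U"
    and "\<And>j. j \<in> {1..4} \<Longrightarrow> smooth_with_taylor U (\<phi> j) (c j)"
    and "\<And>j. j \<in> {1..4} \<Longrightarrow> c j 0 0 = 0"
  shows
    "subspace z_plane \<and> dim z_plane = 2 \<and>
     (\<forall>\<alpha>1 \<alpha>2 \<alpha>3. invariant_set (nf_trajectory U \<phi> \<alpha>1 \<alpha>2 \<alpha>3) z_plane) \<and>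
     (\<forall>\<alpha>1 \<alpha>2 \<alpha>3 T r \<theta>. nf_solution U \<phi> \<alpha>1 \<alpha>2 \<alpha>3 T (\<lambda>_. 0) (\<lambda>_. 0) r \<theta> \<longleftrightarrow>
       (\<forall>t\<in>T. 0 \<le> r t \<and> (0, (r t)\<^sup>2) \<in> U \<and>
         (r has_real_derivative (\<alpha>3 + \<phi> 3 0 ((r t)\<^sup>2)) * r t) (at t within T) \<and>
         (\<theta> has_real_derivative 1 + \<phi> 4 0 ((r t)\<^sup>2)) (at t within T))) \<and>
     (c 3 0 1 \<noteq> 0 \<longrightarrow>
      (\<exists>\<epsilon>0>0. \<exists>R :: real \<Rightarrow> real.
        (\<forall>\<alpha>3. \<bar>\<alpha>3\<bar> < \<epsilon>0 \<and> \<alpha>3 * c 3 0 1 < 0 \<longrightarrow>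
          0 < R \<alpha>3 \<and> 0 < 1 + \<phi> 4 0 ((R \<alpha>3)\<^sup>2) \<and>
          (\<forall>\<alpha>1 \<alpha>2 \<theta>0.
            let \<theta> = (\<lambda>t. \<theta>0 + (1 + \<phi> 4 0 ((R \<alpha>3)\<^sup>2)) * t) in
            nf_solution U \<phi> \<alpha>1 \<alpha>2 \<alpha>3 UNIV (\<lambda>_. 0) (\<lambda>_. 0) (\<lambda>_. R \<alpha>3) \<theta> \<and>
            periodic_solution (nf_trajectory U \<phi> \<alpha>1 \<alpha>2 \<alpha>3)
              (2 * pi / (1 + \<phi> 4 0 ((R \<alpha>3)\<^sup>2))) (\<lambda>t. nf_point 0 0 (R \<alpha>3) (\<theta> t)))) \<and>
        (\<lambda>\<alpha>3. R \<alpha>3 - sqrt (- \<alpha>3 / c 3 0 1))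
          \<in> O[at 0 within {\<alpha>3. \<alpha>3 * c 3 0 1 < 0}](\<lambda>\<alpha>3. \<bar>\<alpha>3\<bar> powr (3 / 2)) \<and>
        ((\<lambda>\<alpha>3. 2 * pi / (1 + \<phi> 4 0 ((R \<alpha>3)\<^sup>2))) \<longlongrightarrow> 2 * pi)
          (at 0 within {\<alpha>3. \<alpha>3 * c 3 0 1 < 0}) \<and>
        (\<forall>\<alpha>1 \<alpha>2. \<alpha>1 \<noteq> 0 \<and> \<alpha>2 \<noteq> 0 \<longrightarrow>
          hopf_crossing (nf_field \<phi> \<alpha>1 \<alpha>2) 1 \<and>
          (\<exists>\<epsilon>>0. \<exists>\<delta>>0. \<epsilon> \<le> \<epsilon>0 \<and>
            (\<forall>\<alpha>3. \<bar>\<alpha>3\<bar> < \<epsilon> \<longrightarrow>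
              (let traj = nf_trajectory U \<phi> \<alpha>1 \<alpha>2 \<alpha>3; \<Gamma> = z_circle (R \<alpha>3) in
                (c 3 0 1 < 0 \<longrightarrow>
                  {G. periodic_orbit traj G \<and> G \<subseteq> ball 0 \<delta>} = (if 0 < \<alpha>3 then {\<Gamma>} else {})) \<and>
                (0 < c 3 0 1 \<longrightarrow>
                  {G. periodic_orbit traj G \<and> G \<subseteq> ball 0 \<delta>} = (if \<alpha>3 < 0 then {\<Gamma>} else {})) \<and>
                (\<alpha>3 * c 3 0 1 < 0 \<longrightarrow>
                  limit_cycle traj \<Gamma> \<and>
                  (if c 3 0 1 < 0 \<and> \<alpha>1 < 0 \<and> \<alpha>2 < 0
                   then orbitally_asymptotically_stable traj \<Gamma>
                   else \<not> orbitally_stable traj \<Gamma>))))))))"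
proof (intro conjI allI impI)
  have cont: "continuous_on U (\<lambda>p. \<phi> j (fst p) (snd p))" if "j \<in> {1..4}" for j
    by (rule smooth_with_taylor_continuous_on[OF assms(3)[OF that]])
  show "subspace z_plane" by (rule subspace_z_plane)
  show "dim z_plane = 2" by (rule dim_z_plane)
  show "invariant_set (nf_trajectory U \<phi> \<alpha>1 \<alpha>2 \<alpha>3) z_plane" for \<alpha>1 \<alpha>2 \<alpha>3
    by (rule invariant_z_plane[OF cont])
  show "nf_solution U \<phi> \<alpha>1 \<alpha>2 \<alpha>3 T (\<lambda>_. 0) (\<lambda>_. 0) r \<theta> \<longleftrightarrow>
       (\<forall>t\<in>T. 0 \<le> r t \<and> (0, (r t)\<^sup>2) \<in> U \<and>
         (r has_real_derivative (\<alpha>3 + \<phi> 3 0 ((r t)\<^sup>2)) * r t) (at t within T) \<and>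
         (\<theta> has_real_derivative 1 + \<phi> 4 0 ((r t)\<^sup>2)) (at t within T))" for \<alpha>1 \<alpha>2 \<alpha>3 T r \<theta>
    by (simp add: nf_solution_def)
  assume "c 3 0 1 \<noteq> 0"
  then obtain m K where "hopf_normal_form U \<phi> (c 3 0 1) m K"
    using hopf_normal_form_exists[of U \<phi> c] assms by blast
  then interpret hopf_normal_form U \<phi> "c 3 0 1" m K .
  show "(\<exists>\<epsilon>0>0. \<exists>R :: real \<Rightarrow> real.
        (\<forall>\<alpha>3. \<bar>\<alpha>3\<bar> < \<epsilon>0 \<and> \<alpha>3 * c 3 0 1 < 0 \<longrightarrow>
          0 < R \<alpha>3 \<and> 0 < 1 + \<phi> 4 0 ((R \<alpha>3)\<^sup>2) \<and>
          (\<forall>\<alpha>1 \<alpha>2 \<theta>0.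
            let \<theta> = (\<lambda>t. \<theta>0 + (1 + \<phi> 4 0 ((R \<alpha>3)\<^sup>2)) * t) in
            nf_solution U \<phi> \<alpha>1 \<alpha>2 \<alpha>3 UNIV (\<lambda>_. 0) (\<lambda>_. 0) (\<lambda>_. R \<alpha>3) \<theta> \<and>
            periodic_solution (nf_trajectory U \<phi> \<alpha>1 \<alpha>2 \<alpha>3)
              (2 * pi / (1 + \<phi> 4 0 ((R \<alpha>3)\<^sup>2))) (\<lambda>t. nf_point 0 0 (R \<alpha>3) (\<theta> t)))) \<and>
        (\<lambda>\<alpha>3. R \<alpha>3 - sqrt (- \<alpha>3 / c 3 0 1))
          \<in> O[at 0 within {\<alpha>3. \<alpha>3 * c 3 0 1 < 0}](\<lambda>\<alpha>3. \<bar>\<alpha>3\<bar> powr (3 / 2)) \<and>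
        ((\<lambda>\<alpha>3. 2 * pi / (1 + \<phi> 4 0 ((R \<alpha>3)\<^sup>2))) \<longlongrightarrow> 2 * pi)
          (at 0 within {\<alpha>3. \<alpha>3 * c 3 0 1 < 0}) \<and>
        (\<forall>\<alpha>1 \<alpha>2. \<alpha>1 \<noteq> 0 \<and> \<alpha>2 \<noteq> 0 \<longrightarrow>
          hopf_crossing (nf_field \<phi> \<alpha>1 \<alpha>2) 1 \<and>
          (\<exists>\<epsilon>>0. \<exists>\<delta>>0. \<epsilon> \<le> \<epsilon>0 \<and>
            (\<forall>\<alpha>3. \<bar>\<alpha>3\<bar> < \<epsilon> \<longrightarrow>
              (let traj = nf_trajectory U \<phi> \<alpha>1 \<alpha>2 \<alpha>3; \<Gamma> = z_circle (R \<alpha>3) in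
                (c 3 0 1 < 0 \<longrightarrow>
                  {G. periodic_orbit traj G \<and> G \<subseteq> ball 0 \<delta>} = (if 0 < \<alpha>3 then {\<Gamma>} else {})) \<and>
                (0 < c 3 0 1 \<longrightarrow>
                  {G. periodic_orbit traj G \<and> G \<subseteq> ball 0 \<delta>} = (if \<alpha>3 < 0 then {\<Gamma>} else {})) \<and>
                (\<alpha>3 * c 3 0 1 < 0 \<longrightarrow>
                  limit_cycle traj \<Gamma> \<and>
                  (if c 3 0 1 < 0 \<and> \<alpha>1 < 0 \<and> \<alpha>2 < 0
                   then orbitally_asymptotically_stable traj \<Gamma>
                   else \<not> orbitally_stable traj \<Gamma>)))))))"
    by (rule hopf_bifurcation)
qed

end
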